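(* Let $K>1$ and let $h$ be a positive function on $(0,\infty)$ such that $$\varepsilon(r)=\frac{h(r)}{r^{\frac{2}{K+1}}}\to0\quad\text{as } r\to0.$$ Then there is a compact set $E\subset\mathbb{C}$ such that $\mathcal{H}^h(E)=0$ and a $K$-quasiconformal map $\phi:\mathbb{C}\to\mathbb{C}$ such that $\gamma(\phi(E))>0$ (and hence $\dot C_{\frac{2K}{2K+1},\frac{2K+1}{K+1}}(E)>0$).
   Context: A homeomorphism $\phi$ of $\mathbb{C}$ is $K$-quasiconformal if it is orientation preserving, belongs to $W^{1,2}_{\rm loc}$, and $\max_\alpha|\partial_\alpha\phi|\le K\min_\alpha|\partial_\alpha\phi|$ a.e. (max and min over directional derivatives). Generalized Hausdorff measure: $\mathcal{H}^h(E)=\lim_{\delta\to0}\inf\sum_i h(r_i)$, the infimum over all (countable) coverings of $E$ by balls $B_i$ with radii $r_i<\delta$. Analytic capacity: for compact $F\subset\mathbb{C}$, $\gamma(F)=\sup|f'(\infty)|$, the supremum over all analytic $f:\mathbb{C}\setminus F\to\mathbb{C}$ with $\|f\|_\infty\le1$, where $f'(\infty)=\lim_{z\to\infty}z(f(z)-f(\infty))$. Riesz capacity: for $\alpha>0$, $1<p<\infty$ with $0<\alpha p<2$, and $p'=p/(p-1)$, $\dot C_{\alpha,p}(F)=\sup_\mu\mu(F)^p$, the supremum over all positive Borel measures $\mu$ supported on $F$ with $\|I_\alpha(\mu)\|_{L^{p'}(\mathbb{C})}\le1$, where $I_\alpha(\mu)(x)=\int\frac{1}{|x-y|^{2-\alpha}}\,d\mu(y)$.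 *)

theory Defs
  imports "HOL-Complex_Analysis.Complex_Analysis"
begin

section \<open>Weak derivatives and quasiconformal maps\<close>

abbreviation partial_x :: "(complex \<Rightarrow> real) \<Rightarrow> complex \<Rightarrow> real" where
  "partial_x f \<equiv> (\<lambda>z. frechet_derivative f (at z) 1)"

abbreviation partial_y :: "(complex \<Rightarrow> real) \<Rightarrow> complex \<Rightarrow> real" where
  "partial_y f \<equiv> (\<lambda>z. frechet_derivative f (at z) \<i>)"

primrec C_k :: "nat \<Rightarrow> (complex \<Rightarrow> real) \<Rightarrow> bool" where
  "C_k 0 f \<longleftrightarrow> continuous_on UNIV f"
| "C_k (Suc k) f \<longleftrightarrow> f differentiable_on UNIV \<and> C_k k (partial_x f) \<and> C_k k (partial_y f)"

definition test_function :: "(complex \<Rightarrow> real) \<Rightarrow> bool" where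
  "test_function \<psi> \<longleftrightarrow> (\<forall>k. C_k k \<psi>) \<and> compact (closure {z. \<psi> z \<noteq> 0})"

definition L2_loc :: "(complex \<Rightarrow> complex) \<Rightarrow> bool" where
  "L2_loc f \<longleftrightarrow> f \<in> borel_measurable lebesgue \<and>
     (\<forall>S. compact S \<longrightarrow> set_integrable lebesgue S (\<lambda>z. (cmod (f z))\<^sup>2))"

text \<open>For \<open>\<phi>\<close>, \<open>fx\<close>, \<open>fy\<close> locally square integrable: \<open>fx\<close> and \<open>fy\<close> are the distributional
  partial derivatives of \<open>\<phi>\<close>.\<close>

definition weak_partials ::
    "(complex \<Rightarrow> complex) \<Rightarrow> (complex \<Rightarrow> complex) \<Rightarrow> (complex \<Rightarrow> complex) \<Rightarrow> bool" where
  "weak_partials \<phi> fx fy \<longleftrightarrow> (\<forall>\<psi>. test_function \<psi> \<longrightarrow>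
     (\<integral>z. partial_x \<psi> z *\<^sub>R \<phi> z \<partial>lebesgue) = - (\<integral>z. \<psi> z *\<^sub>R fx z \<partial>lebesgue) \<and>
     (\<integral>z. partial_y \<psi> z *\<^sub>R \<phi> z \<partial>lebesgue) = - (\<integral>z. \<psi> z *\<^sub>R fy z \<partial>lebesgue))"

text \<open>\<open>fx\<close>, \<open>fy\<close> witness that \<open>\<phi>\<close> belongs to the local Sobolev space with exponents \<open>1,2\<close>;
  they are unique up to null sets.\<close>

definition W12_loc_gradient ::
    "(complex \<Rightarrow> complex) \<Rightarrow> (complex \<Rightarrow> complex) \<Rightarrow> (complex \<Rightarrow> complex) \<Rightarrow> bool" where
  "W12_loc_gradient \<phi> fx fy \<longleftrightarrow>
     L2_loc \<phi> \<and> L2_loc fx \<and> L2_loc fy \<and> weak_partials \<phi> fx fy"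

text \<open>Local degree \<open>+1\<close> at every point.\<close>

definition orientation_preserving :: "(complex \<Rightarrow> complex) \<Rightarrow> bool" where
  "orientation_preserving \<phi> \<longleftrightarrow>
     (\<forall>z r. 0 < r \<longrightarrow> winding_number (\<phi> \<circ> circlepath z r) (\<phi> z) = 1)"

text \<open>The directional derivative in direction \<open>cis \<alpha>\<close> is \<open>cos \<alpha> *\<^sub>R fx z + sin \<alpha> *\<^sub>R fy z\<close>.
  Its modulus is continuous and periodic in \<open>\<alpha>\<close>, so supremum and infimum are the maximum
  and the minimum.\<close>

definition quasiconformal :: "real \<Rightarrow> (complex \<Rightarrow> complex) \<Rightarrow> bool" where
  "quasiconformal K \<phi> \<longleftrightarrow>
     (\<exists>\<phi>'. homeomorphism UNIV UNIV \<phi> \<phi>') \<and> orientation_preserving \<phi> \<and>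
     (\<exists>fx fy. W12_loc_gradient \<phi> fx fy \<and>
        (AE z in lebesgue.
           (SUP \<alpha>::real. cmod (cos \<alpha> *\<^sub>R fx z + sin \<alpha> *\<^sub>R fy z))
             \<le> K * (INF \<alpha>::real. cmod (cos \<alpha> *\<^sub>R fx z + sin \<alpha> *\<^sub>R fy z))))"

section \<open>Generalized Hausdorff measure\<close>

text \<open>Countable coverings are indexed by arbitrary subsets \<open>I\<close> of the naturals, so finite
  coverings are included. Since \<open>h\<close> need not be monotone, the radii are data of the covering.\<close>

definition hausdorff_content :: "(real \<Rightarrow> real) \<Rightarrow> real \<Rightarrow> complex set \<Rightarrow> ennreal" where
  "hausdorff_content h \<delta> E =
     Inf {\<Sum>i. if i \<in> I then ennreal (h (r i)) else 0 |
            (I :: nat set) (c :: nat \<Rightarrow> complex) (r :: nat \<Rightarrow> real).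
            (\<forall>i\<in>I. 0 < r i \<and> r i < \<delta>) \<and> E \<subseteq> (\<Union>i\<in>I. ball (c i) (r i))}"

text \<open>The content increases as \<open>\<delta>\<close> decreases, so the limit exists.\<close>

definition hausdorff_measure :: "(real \<Rightarrow> real) \<Rightarrow> complex set \<Rightarrow> ennreal" where
  "hausdorff_measure h E = Lim (at_right 0) (\<lambda>\<delta>. hausdorff_content h \<delta> E)"

section \<open>Analytic capacity\<close>

text \<open>A bounded holomorphic function on the complement of a compact set has a removable
  singularity at infinity, so both limits exist in the case of interest.\<close>

definition deriv_at_infinity :: "(complex \<Rightarrow> complex) \<Rightarrow> complex" where
  "deriv_at_infinity f = Lim at_infinity (\<lambda>z. z * (f z - Lim at_infinity f))"

definition analytic_capacity :: "complex set \<Rightarrow> ennreal" where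
  "analytic_capacity F =
     (SUP f \<in> {f. f holomorphic_on (- F) \<and> (\<forall>z\<in>- F. cmod (f z) \<le> 1)}.
        ennreal (cmod (deriv_at_infinity f)))"

section \<open>Riesz capacities\<close>

text \<open>Real powers on \<open>[0,\<infinity>]\<close>, for positive exponents.\<close>

definition ennreal_powr :: "ennreal \<Rightarrow> real \<Rightarrow> ennreal" where
  "ennreal_powr x a = (if x = \<infinity> then \<infinity> else ennreal (enn2real x powr a))"

definition Lp_norm :: "real \<Rightarrow> (complex \<Rightarrow> ennreal) \<Rightarrow> ennreal" where
  "Lp_norm q u = ennreal_powr (\<integral>\<^sup>+ x. ennreal_powr (u x) q \<partial>lebesgue) (1 / q)"

text \<open>The kernel takes the value \<open>\<infinity>\<close> on the diagonal, by \<open>1 / 0 = \<infinity>\<close> in \<^typ>\<open>ennreal\<close>.\<close>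

definition riesz_potential :: "real \<Rightarrow> complex measure \<Rightarrow> complex \<Rightarrow> ennreal" where
  "riesz_potential \<alpha> \<mu> x = (\<integral>\<^sup>+ y. 1 / ennreal (cmod (x - y) powr (2 - \<alpha>)) \<partial>\<mu>)"

text \<open>Meant for compact \<open>F\<close>, where ``supported on \<open>F\<close>'' amounts to the complement being null.\<close>

definition riesz_capacity :: "real \<Rightarrow> real \<Rightarrow> complex set \<Rightarrow> ennreal" where
  "riesz_capacity \<alpha> p F =
     (SUP \<mu> \<in> {\<mu>. sets \<mu> = sets borel \<and> emeasure \<mu> (- F) = 0 \<and>
                   Lp_norm (p / (p - 1)) (riesz_potential \<alpha> \<mu>) \<le> 1}.
        ennreal_powr (emeasure \<mu> F) p)"

end

theory Submission
  imports Defs "HOL-Probability.Probability" "HOL-Real_Asymp.Real_Asymp"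
begin

text \<open>Place \<open>m\<^sub>n\<^sup>2\<close> disjoint discs of radius \<open>1 / (2 m\<^sub>n)\<close> on a square grid in the unit disc. In each of them
  apply the radial stretching \<open>w |w|\<^sup>1\<^sup>/\<^sup>K\<^sup>-\<^sup>1\<close>, suitably normalised, outside a concentric disc of radius
  \<open>\<tau>\<^sub>n = (8 / m\<^sub>n)\<^sup>K / (2 m\<^sub>n)\<close>, whose image has radius \<open>\<sigma>\<^sub>n = 4 / m\<^sub>n\<^sup>2\<close>, and iterate inside the small discs. The
  limit is \<open>K\<close>-quasiconformal and maps a Cantor set \<open>E\<close> to a Cantor set with \<open>m\<^sub>n\<^sup>2 \<sigma>\<^sub>n = 4\<close>. The uniform measure
  of an \<open>N\<close>-th generation disc of the image is therefore \<open>4\<^sup>-\<^sup>N\<close> times its radius, which makes the Cauchy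
  potential bounded and the analytic capacity positive; the Riesz potential of the uniform measure on
  \<open>E\<close> is estimated by the same recursion. On the other hand \<open>B = m\<^sub>n\<^sup>2 \<tau>\<^sub>n\<^sup>t\<close> with \<open>t = 2 / (K + 1)\<close> does not
  depend on \<open>m\<^sub>n\<close>. With \<open>r\<^sub>N = \<tau>\<^sub>0 \<cdots> \<tau>\<^sub>N\<^sub>-\<^sub>1\<close> the covering of \<open>E\<close> by the discs of generation \<open>N\<close> has \<open>h\<close>-sum
  \<open>B\<^sup>N \<epsilon>(r\<^sub>N)\<close>, and this tends to \<open>0\<close> when the \<open>m\<^sub>n\<close> grow fast enough.\<close>

text \<open>The exponent 2/(K+1) comes from a balance. With of order
  \<open>R\<^sup>-\<^sup>2\<close> discs of radius R and image radii \<sigma> of order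
  \<open>R\<^sup>2\<close>, the stretching forces \<tau> to be of order
  \<open>R\<^sup>K\<^sup>+\<^sup>1\<close>, so number times \<open>\<tau>\<^sup>t\<close> is
  constant exactly for t = 2/(K+1). A generation then costs only the factor B > 1, and
  \<open>m\<^sub>n\<close> stays free to be chosen from h: it is taken so large that \<epsilon> at
  the radius of generation N is below \<open>B\<^sup>-\<^sup>2\<^sup>N\<close>. The value 4 of
  \<open>m\<^sub>n\<^sup>2 \<sigma>\<^sub>n\<close> makes the recursion for the Cauchy potential a
  contraction by 1/4; with the value 1 every generation could add the same constant. The same 8 in
  \<open>\<tau>\<^sub>n\<close> yields a contraction by 1/2 for the Riesz potential, whose exponents
  are critical too, so that \<open>m\<^sub>n\<close> cancels again. The delicate point is the
  Sobolev regularity of the limit across E. Since K > 1, large \<open>m\<^sub>n\<close> give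
  \<open>m\<^sub>n\<^sup>2 \<tau>\<^sub>n \<le> 1/2\<close>, so both coordinate projections of E are
  null. Almost every line parallel to an axis therefore misses some generation, and on such a line
  the limit is differentiable off finitely many points.\<close>

section \<open>Injective maps fixing the exterior of the unit disc\<close>

lemma fixes_outside_disc_homeomorphism:
  fixes \<phi> :: "complex \<Rightarrow> complex"
  assumes cont: "continuous_on UNIV \<phi>" and inj: "inj \<phi>" and out: "\<And>z. 1 \<le> norm z \<Longrightarrow> \<phi> z = z"
  shows "\<exists>\<phi>'. homeomorphism UNIV UNIV \<phi> \<phi>'"
proof -
  have op: "open (range \<phi>)"
    using invariance_of_domain[OF cont open_UNIV inj] .
  \<comment> \<open>The first set is compact, so this makes the range closed; being open as well, it
    is the whole plane.\<close>
  have rng: "range \<phi> = \<phi> ` cball 0 1 \<union> {z. 1 \<le> norm z}"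
  proof -
    have "\<phi> z \<in> \<phi> ` cball 0 1 \<union> {z. 1 \<le> norm z}" for z
      by (cases "norm z \<le> 1") (use out[of z] in auto)
    moreover have "z \<in> range \<phi>" if "1 \<le> norm z" for z
      using out[OF that] by (metis rangeI)
    ultimately show ?thesis by auto
  qed
  moreover have "closed (\<phi> ` cball 0 1)"
    by (intro compact_imp_closed compact_continuous_image) (auto intro: continuous_on_subset[OF cont])
  moreover have "closed {z::complex. 1 \<le> norm z}"
    by (intro closed_Collect_le continuous_intros)
  ultimately have "closed (range \<phi>)" by (metis closed_Un)
  with op have surj: "range \<phi> = UNIV"
    using clopen[of "range \<phi>"] by simp
  obtain \<psi> where "homeomorphism UNIV (range \<phi>) \<phi> \<psi>"
    by (rule invariance_of_domain_homeomorphism[OF open_UNIV cont order_refl inj])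
  then show ?thesis unfolding surj by (rule exI[of _ \<psi>])
qed

text \<open>Since \<open>\<phi>\<close> is injective, \<open>\<phi> (z + r e\<^sup>i\<^sup>t) - \<phi> z\<close> avoids \<open>0\<close> throughout a homotopy that moves
  the circle to one on which \<open>\<phi>\<close> is the identity.\<close>

lemma fixes_outside_disc_orientation_preserving:
  fixes \<phi> :: "complex \<Rightarrow> complex"
  assumes cont: "continuous_on UNIV \<phi>" and inj: "inj \<phi>" and out: "\<And>z. 1 \<le> norm z \<Longrightarrow> \<phi> z = z"
  shows "orientation_preserving \<phi>"
  unfolding orientation_preserving_def
proof (intro allI impI)
  fix z :: complex and r :: real assume r: "0 < r"
  define c where "c s = (1 - s) *\<^sub>R z" for s :: real
  define \<rho> where "\<rho> s = (1 - s) * r + s * 2" for s :: real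
  define h where "h = (\<lambda>(s, t). \<phi> (c s + of_real (\<rho> s) * exp (2 * of_real pi * \<i> * of_real t)) - \<phi> (c s))"
  have rpos: "\<rho> s > 0" if "s \<in> {0..1}" for s
  proof (cases "s = 1")
    case False
    then have "(1 - s) * r > 0" "s * 2 \<ge> 0" using that r by auto
    then show ?thesis unfolding \<rho>_def by linarith
  qed (simp add: \<rho>_def)
  have c2: "continuous_on A (\<lambda>x. \<phi> (g x))" if "continuous_on A g" for g :: "'c::topological_space \<Rightarrow> complex" and A
    using continuous_on_compose2[OF cont that] by auto
  have conth: "continuous_on ({0..1} \<times> {0..1}) h"
    unfolding h_def case_prod_unfold c_def \<rho>_def by (intro continuous_intros c2)
  have hne: "h (s, t) \<noteq> 0" if "s \<in> {0..1}" for s t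
    using rpos[OF that] inj by (auto simp: h_def inj_eq)
  have "homotopic_loops (-{0}) (\<lambda>t. h (0, t)) (\<lambda>t. h (1, t))"
    unfolding homotopic_loops
  proof (intro exI[of _ h] conjI ballI)
    show "pathfinish (h \<circ> Pair t) = pathstart (h \<circ> Pair t)" for t
      by (simp add: pathfinish_def pathstart_def h_def)
  qed (use conth hne in auto)
  then have "winding_number (\<lambda>t. h (0, t)) 0 = winding_number (\<lambda>t. h (1, t)) 0"
    by (rule winding_number_homotopic_loops)
  moreover have "(\<lambda>t. h (0, t)) = (\<lambda>t. (\<phi> \<circ> circlepath z r) t - \<phi> z)"
    by (auto simp: h_def c_def \<rho>_def circlepath fun_eq_iff)
  moreover have "(\<lambda>t. h (1, t)) = (\<lambda>t. circlepath 0 2 t - \<phi> 0)"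
    by (auto simp: h_def c_def \<rho>_def circlepath fun_eq_iff norm_mult intro!: out)
  moreover have "winding_number (circlepath 0 2) (\<phi> 0) = 1"
  proof (rule winding_number_circlepath)
    have "norm (\<phi> 0) < 1"
    proof (rule ccontr)
      assume "\<not> norm (\<phi> 0) < 1"
      then have "\<phi> (\<phi> 0) = \<phi> 0" using out by auto
      with inj have "\<phi> 0 = 0" by (simp add: inj_eq)
      then show False using \<open>\<not> norm (\<phi> 0) < 1\<close> by simp
    qed
    then show "cmod (\<phi> 0 - 0) < 2" by simp
  qed
  ultimately show "winding_number (\<phi> \<circ> circlepath z r) (\<phi> z) = 1"
    using winding_number_offset[of "\<phi> \<circ> circlepath z r" "\<phi> z"] winding_number_offset[of "circlepath 0 2" "\<phi> 0"] by simp
qed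

section \<open>Lebesgue measure on the plane\<close>

lemma lborel_Complex:
  "lborel = distr (lborel \<Otimes>\<^sub>M lborel) borel (\<lambda>(s, t). Complex s t)" (is ?th1)
  "lborel = distr (lborel \<Otimes>\<^sub>M lborel) borel (\<lambda>(s, t). Complex t s)" (is ?th2)
proof -
  have m: "(\<lambda>p. Complex (fst p) (snd p)) \<in> borel_measurable (lborel \<Otimes>\<^sub>M lborel)"
    by (auto simp: Complex_eq)
  have v: "(\<lambda>p. Complex (fst p) (snd p)) -` box l u = box (Re l) (Re u) \<times> box (Im l) (Im u)" for l u
    by (auto simp: in_box_complex_iff box_real)
  have "emeasure (distr (lborel \<Otimes>\<^sub>M lborel) borel (\<lambda>p. Complex (fst p) (snd p))) (box l u) = (\<Prod>b\<in>Basis. (u-l)\<bullet>b)"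
    if le: "\<And>b. b\<in>Basis \<Longrightarrow> l\<bullet>b \<le> u\<bullet>b" for l u :: complex
    using le[of 1] le[of \<i>] by (subst emeasure_distr[OF m])
      (auto simp: v space_pair_measure lborel.emeasure_pair_measure_Times box_real Basis_complex_def ennreal_mult[symmetric])
  then show th1: ?th1
    by (auto intro!: lborel_eqI simp: case_prod_unfold)
  show ?th2
    by (subst th1, subst lborel_pair.distr_pair_swap, subst distr_distr)
      (auto simp: case_prod_unfold comp_def Complex_eq)
qed

text \<open>\<open>(u, v)\<close> ranges over both orders of the axes, so that a single integration
  by parts along lines in direction \<open>u\<close> covers both partial derivatives.\<close>

lemma lborel_complex_axes:
  assumes "(u, v) \<in> {(1, \<i>), (\<i>, 1)}"
  shows "lborel = distr (lborel \<Otimes>\<^sub>M lborel) borel (\<lambda>(s, t). of_real s * u + of_real t * v :: complex)"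
  using assms lborel_Complex by (auto simp: Complex_eq mult.commute add.commute)

lemma nn_integral_lborel_rescale:
  fixes f :: "complex \<Rightarrow> ennreal" and c :: complex
  assumes [measurable]: "f \<in> borel_measurable borel" and t: "t > 0"
  shows "(\<integral>\<^sup>+x. f ((x - c) /\<^sub>R t) \<partial>lborel) = ennreal (t\<^sup>2) * (\<integral>\<^sup>+x. f x \<partial>lborel)"
proof -
  have "(\<integral>\<^sup>+x. f ((x - c) /\<^sub>R t) \<partial>lborel)
    = (\<integral>\<^sup>+x. f ((x - c) /\<^sub>R t) \<partial>density (distr lborel borel (\<lambda>x. c + t *\<^sub>R x)) (\<lambda>_. \<bar>t\<bar>^DIM(complex)))"
    using lborel_affine[of t c] t by simp
  also have "\<dots> = (\<integral>\<^sup>+x. ennreal (t\<^sup>2) * f x \<partial>lborel)"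
    using t by (simp add: nn_integral_density nn_integral_distr)
  finally show ?thesis by (simp add: nn_integral_cmult)
qed

lemma emeasure_ball_complex: "0 \<le> r \<Longrightarrow> emeasure lborel (ball (c::complex) r) = ennreal (pi * r\<^sup>2)"
  by (simp add: emeasure_ball unit_ball_vol_2)

text \<open>Dyadic decomposition: between the radii 2^-(k+1) and 2^-k the integrand is at most
  2^(b(k+1)) on an area of at most pi 4^-k, which leaves a geometric series of ratio 2^(b-2) <
  1.\<close>

lemma nn_integral_powr_ball_finite:
  assumes "a < 2"
  shows "(\<integral>\<^sup>+x\<in>ball (0::complex) 1. ennreal (norm x powr - a) \<partial>lborel) < \<infinity>"
proof -
  \<comment> \<open>Raising a negative exponent to 0 only enlarges the integrand on the unit disc,
    and makes it monotone in the norm.\<close>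
  define b where "b = max a 0"
  have b: "0 \<le> b" "b < 2" "a \<le> b" using assms by (auto simp: b_def)
  define g :: "nat \<Rightarrow> complex \<Rightarrow> ennreal" where
    "g k x = ennreal (2 powr (b * (k + 1))) * indicator (ball 0 ((1/2)^k)) x" for k x
  have [measurable]: "g k \<in> borel_measurable borel" for k
    unfolding g_def[abs_def] by (intro borel_measurable_times_ennreal borel_measurable_indicator borel_measurable_const) auto
  have le: "ennreal (norm x powr - a) * indicator (ball (0::complex) 1) x \<le> (\<Sum>k. g k x)" for x
  proof (cases "x \<in> ball 0 1 \<and> x \<noteq> 0")
    case True
    then have x: "norm x < 1" "0 < norm x" by auto
    define n where "n = (LEAST n. (1/2)^n \<le> norm x)"
    have ex: "\<exists>n. (1/2)^n \<le> norm x"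
      using real_arch_pow_inv[of "norm x" "1/2"] x by (auto intro: less_imp_le)
    have n1: "(1/2)^n \<le> norm x" unfolding n_def using LeastI_ex[OF ex] .
    have "n \<noteq> 0" using n1 x by (cases n) auto
    then obtain k where k: "n = Suc k" by (cases n) auto
    have n2: "norm x < (1/2)^k" using not_less_Least[of k "\<lambda>n. (1/2)^n \<le> norm x"] k by (auto simp: n_def)
    have "norm x powr - a \<le> norm x powr - b"
      using x b by (intro powr_mono') auto
    also have "\<dots> \<le> ((1/2)^n) powr - b"
      using n1 x b by (intro powr_mono2') auto
    also have "\<dots> = 2 powr (b * (k + 1))"
    proof -
      have "(1/2::real)^n = 2 powr (- real n)"
        by (simp add: powr_minus powr_realpow power_one_over inverse_eq_divide)
      then show ?thesis by (simp only: powr_powr) (simp add: k algebra_simps)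
    qed
    finally have "ennreal (norm x powr - a) * indicator (ball (0::complex) 1) x \<le> g k x"
      using n2 by (auto simp: g_def indicator_def ennreal_leI)
    also have "\<dots> \<le> (\<Sum>k. g k x)"
      using sum_le_suminf[OF summableI, of "{k}" "\<lambda>k. g k x"] by auto
    finally show ?thesis .
  qed (auto simp: indicator_def)
  have "(\<integral>\<^sup>+x\<in>ball (0::complex) 1. ennreal (norm x powr - a) \<partial>lborel) \<le> (\<integral>\<^sup>+x. (\<Sum>k. g k x) \<partial>lborel)"
    by (intro nn_integral_mono le)
  also have "\<dots> = (\<Sum>k. \<integral>\<^sup>+x. g k x \<partial>lborel)"
    by (rule nn_integral_suminf) simp
  also have "\<dots> = (\<Sum>k. ennreal (2 powr b * pi * (2 powr (b - 2)) ^ k))"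
  proof (intro suminf_cong)
    fix k
    have "(\<integral>\<^sup>+x. g k x \<partial>lborel) = ennreal (2 powr (b * (k + 1))) * ennreal (pi * ((1/2)^k)\<^sup>2)"
      unfolding g_def by (subst nn_integral_cmult_indicator) (auto simp: emeasure_ball_complex)
    also have "\<dots> = ennreal (2 powr (b * (k + 1)) * (pi * ((1/2)^k)\<^sup>2))"
      by (simp add: ennreal_mult)
    also have "2 powr (b * (k + 1)) * (pi * ((1/2)^k)\<^sup>2) = 2 powr b * pi * (2 powr (b - 2)) ^ k"
    proof -
      have "(1/2::real)^k = 2 powr (- real k)"
        by (simp add: powr_minus powr_realpow power_one_over inverse_eq_divide)
      then have "((1/2::real)^k)\<^sup>2 = 2 powr (- 2 * real k)"
        by (simp add: power2_eq_square powr_add[symmetric])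
      then show ?thesis
        by (simp add: powr_power powr_add[symmetric] algebra_simps)
    qed
    finally show "(\<integral>\<^sup>+x. g k x \<partial>lborel) = ennreal (2 powr b * pi * (2 powr (b - 2)) ^ k)" .
  qed
  also have "\<dots> < \<infinity>"
  proof -
    have "2 powr (b - 2) < (1::real)" using b powr_less_mono[of "b - 2" 0 2] by simp
    then have "summable (\<lambda>k. 2 powr b * pi * (2 powr (b - 2)) ^ k)"
      by (intro summable_mult summable_geometric) auto
    then show ?thesis
      by (subst suminf_ennreal2) auto
  qed
  finally show ?thesis .
qed

text \<open>Dyadic annuli outwards: where \<open>max 1 (norm x)\<close> lies between 2^k and 2^(k+1)
  the integrand is at most 2^(-bk) on an area of at most 4 pi 4^k, hence a geometric series of ratio
  2^(2-b) < 1.\<close>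

lemma nn_integral_powr_outside_finite:
  assumes "b > 2"
  shows "(\<integral>\<^sup>+x. ennreal (max 1 (norm (x::complex)) powr - b) \<partial>lborel) < \<infinity>"
proof -
  define g :: "nat \<Rightarrow> complex \<Rightarrow> ennreal" where
    "g k x = ennreal (2 powr (- b * k)) * indicator (ball 0 (2 * 2^k)) x" for k x
  have [measurable]: "g k \<in> borel_measurable borel" for k
    unfolding g_def[abs_def] by (intro borel_measurable_times_ennreal borel_measurable_indicator borel_measurable_const) auto
  have le: "ennreal (max 1 (norm x) powr - b) \<le> (\<Sum>k. g k x)" for x
  proof -
    define y where "y = max 1 (norm x)"
    have y: "y \<ge> 1" "norm x \<le> y" by (auto simp: y_def)
    define n where "n = (LEAST n. y < 2^n)"
    have ex: "\<exists>n. y < 2^n" using real_arch_pow[of 2 y] by auto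
    have n1: "y < 2^n" unfolding n_def using LeastI_ex[OF ex] .
    have "n \<noteq> 0" using n1 y by (cases n) auto
    then obtain k where k: "n = Suc k" by (cases n) auto
    have n2: "2^k \<le> y" using not_less_Least[of k "\<lambda>n. y < 2^n"] k by (auto simp: n_def)
    have "y powr - b \<le> (2^k) powr - b"
      using n2 assms by (intro powr_mono2') auto
    also have "\<dots> = 2 powr (- b * k)"
    proof -
      have "(2::real)^k = 2 powr real k" by (simp add: powr_realpow)
      then show ?thesis by (simp add: powr_powr mult.commute)
    qed
    finally have "ennreal (y powr - b) \<le> g k x"
      using n1 y k by (auto simp: g_def indicator_def ennreal_leI)
    also have "\<dots> \<le> (\<Sum>k. g k x)"
      using sum_le_suminf[OF summableI, of "{k}" "\<lambda>k. g k x"] by auto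
    finally show ?thesis unfolding y_def .
  qed
  have "(\<integral>\<^sup>+x. ennreal (max 1 (norm (x::complex)) powr - b) \<partial>lborel) \<le> (\<integral>\<^sup>+x. (\<Sum>k. g k x) \<partial>lborel)"
    by (intro nn_integral_mono le)
  also have "\<dots> = (\<Sum>k. \<integral>\<^sup>+x. g k x \<partial>lborel)"
    by (rule nn_integral_suminf) simp
  also have "\<dots> = (\<Sum>k. ennreal (4 * pi * (2 powr (2 - b)) ^ k))"
  proof (intro suminf_cong)
    fix k
    have "(\<integral>\<^sup>+x. g k x \<partial>lborel) = ennreal (2 powr (- b * k)) * ennreal (pi * (2 * 2^k)\<^sup>2)"
      unfolding g_def by (subst nn_integral_cmult_indicator) (auto simp: emeasure_ball_complex)
    also have "\<dots> = ennreal (2 powr (- b * k) * (pi * (2 * 2^k)\<^sup>2))"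
      by (simp add: ennreal_mult)
    also have "2 powr (- b * k) * (pi * (2 * 2^k)\<^sup>2) = 4 * pi * (2 powr (2 - b)) ^ k"
    proof -
      have "(2::real)^k = 2 powr real k"
        by (simp add: powr_realpow)
      then have "(2 * 2^k)\<^sup>2 = (4::real) * 2 powr (2 * real k)"
        by (simp add: power2_eq_square powr_add[symmetric])
      then show ?thesis
        by (simp add: powr_power powr_add[symmetric] algebra_simps)
    qed
    finally show "(\<integral>\<^sup>+x. g k x \<partial>lborel) = ennreal (4 * pi * (2 powr (2 - b)) ^ k)" .
  qed
  also have "\<dots> < \<infinity>"
  proof -
    have "2 powr (2 - b) < (1::real)" using assms powr_less_mono[of "2 - b" 0 2] by simp
    then have "summable (\<lambda>k. 4 * pi * (2 powr (2 - b)) ^ k)"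
      by (intro summable_mult summable_geometric) auto
    then show ?thesis
      by (subst suminf_ennreal2) auto
  qed
  finally show ?thesis .
qed

section \<open>Integration by parts along lines\<close>

lemma test_functionD:
  assumes "test_function \<psi>"
  shows "\<psi> differentiable at z" "continuous_on UNIV \<psi>"
    "continuous_on UNIV (partial_x \<psi>)" "continuous_on UNIV (partial_y \<psi>)"
    "\<exists>r>0. \<forall>z. r \<le> norm z \<longrightarrow> \<psi> z = 0 \<and> partial_x \<psi> z = 0 \<and> partial_y \<psi> z = 0"
proof -
  have C1: "C_k (Suc 0) \<psi>" and cpt: "compact (closure {z. \<psi> z \<noteq> 0})"
    using assms unfolding test_function_def by blast+
  show "\<psi> differentiable at z"
    using C1 by (simp add: differentiable_on_def)
  show "continuous_on UNIV \<psi>"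
    using C1 by (auto intro: differentiable_imp_continuous_on)
  show "continuous_on UNIV (partial_x \<psi>)" "continuous_on UNIV (partial_y \<psi>)"
    using C1 by simp_all
  obtain b where b: "\<And>z. z \<in> closure {z. \<psi> z \<noteq> 0} \<Longrightarrow> norm z \<le> b"
    using compact_imp_bounded[OF cpt] by (auto simp: bounded_iff)
  show "\<exists>r>0. \<forall>z. r \<le> norm z \<longrightarrow> \<psi> z = 0 \<and> partial_x \<psi> z = 0 \<and> partial_y \<psi> z = 0"
  proof (intro exI[of _ "\<bar>b\<bar> + 1"] conjI allI impI)
    fix z :: complex assume "\<bar>b\<bar> + 1 \<le> norm z"
    then have z: "z \<in> - closure {z. \<psi> z \<noteq> 0}" using b[of z] by force
    have out: "\<psi> w = 0" if "w \<in> - closure {z. \<psi> z \<noteq> 0}" for w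
    proof -
      have "w \<notin> {z. \<psi> z \<noteq> 0}" using that by (meson ComplD closure_subset subsetD)
      then show ?thesis by simp
    qed
    show "\<psi> z = 0" using out[OF z] .
    have "(\<psi> has_derivative (\<lambda>_. 0)) (at z)"
    proof (rule has_derivative_transform_within_open[OF has_derivative_const _ z])
      show "open (- closure {z. \<psi> z \<noteq> 0})" by (intro open_Compl closed_closure)
      show "0 = \<psi> w" if "w \<in> - closure {z. \<psi> z \<noteq> 0}" for w using out[OF that] ..
    qed
    then have "frechet_derivative \<psi> (at z) = (\<lambda>_. 0)"
      by (metis frechet_derivative_at)
    then show "partial_x \<psi> z = 0" "partial_y \<psi> z = 0" by simp_all
  qed simp
qed

lemma integrable_continuous_compact_support:
  fixes f :: "complex \<Rightarrow> complex"
  assumes "continuous_on UNIV f" "\<And>z. r \<le> norm z \<Longrightarrow> f z = 0"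
  shows "integrable lborel f"
proof -
  have "integrable lborel (\<lambda>x. indicator (cball 0 r) x *\<^sub>R f x)"
    by (intro borel_integrable_compact) (auto intro: continuous_on_subset[OF assms(1)])
  also have "(\<lambda>x. indicator (cball 0 r) x *\<^sub>R f x) = f"
    using assms(2) by (auto simp: fun_eq_iff indicator_def)
  finally show ?thesis .
qed

lemma integrable_scaleR_compact_support:
  fixes f :: "complex \<Rightarrow> complex" and \<psi> :: "complex \<Rightarrow> real"
  assumes cont: "continuous_on UNIV \<psi>" and supp: "\<And>z. r \<le> norm z \<Longrightarrow> \<psi> z = 0"
    and f: "set_integrable lborel (cball 0 r) f" and [measurable]: "f \<in> borel_measurable borel"
  shows "integrable lborel (\<lambda>z. \<psi> z *\<^sub>R f z)"
proof -
  have [measurable]: "\<psi> \<in> borel_measurable borel"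
    using cont by (rule borel_measurable_continuous_onI)
  have "compact (\<psi> ` cball 0 r)"
    by (intro compact_continuous_image continuous_on_subset[OF cont]) auto
  then obtain B where B: "\<And>z. z \<in> cball 0 r \<Longrightarrow> \<bar>\<psi> z\<bar> \<le> B"
    using compact_imp_bounded by (fastforce simp: bounded_iff)
  have "integrable lborel (\<lambda>z. B *\<^sub>R (indicator (cball 0 r) z *\<^sub>R f z))"
    using f unfolding set_integrable_def by (rule integrable_scaleR_right)
  then show ?thesis
  proof (rule Bochner_Integration.integrable_bound)
    show "AE z in lborel. norm (\<psi> z *\<^sub>R f z) \<le> norm (B *\<^sub>R indicat_real (cball 0 r) z *\<^sub>R f z)"
    proof (intro AE_I2)
      fix z :: complex
      show "norm (\<psi> z *\<^sub>R f z) \<le> norm (B *\<^sub>R indicat_real (cball 0 r) z *\<^sub>R f z)"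
      proof (cases "norm z \<le> r")
        case True
        then have "\<bar>\<psi> z\<bar> \<le> \<bar>B\<bar>" using B[of z] by auto
        then show ?thesis using True by (auto simp: indicator_def intro: mult_right_mono)
      qed (use supp[of z] in auto)
    qed
  qed simp
qed

text \<open>On a good line the product of \<open>\<psi>\<close> and \<open>\<phi>\<close> is
  continuous, compactly supported and differentiable off a finite set, so its derivative integrates
  to 0 there; Fubini then gives the claim. Continuity across the finite set, which may vary with the
  line, takes the place of absolute continuity.\<close>

lemma integration_by_parts_along_lines:
  fixes \<phi> f :: "complex \<Rightarrow> complex" and \<psi> :: "complex \<Rightarrow> real"
  assumes \<psi>: "test_function \<psi>" and uv: "(u, v) \<in> {(1, \<i>), (\<i>, 1)}"
    and cont: "continuous_on UNIV \<phi>" and [measurable]: "f \<in> borel_measurable borel"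
    and int: "\<And>r. set_integrable lborel (cball 0 r) f"
    and lines: "AE t in lborel. \<exists>F. finite F \<and> (\<forall>s. s \<notin> F \<longrightarrow>
       ((\<lambda>s. \<phi> (of_real s * u + of_real t * v)) has_vector_derivative f (of_real s * u + of_real t * v)) (at s))"
  shows "(\<integral>z. frechet_derivative \<psi> (at z) u *\<^sub>R \<phi> z \<partial>lebesgue) = - (\<integral>z. \<psi> z *\<^sub>R f z \<partial>lebesgue)"
proof -
  define d where "d z = frechet_derivative \<psi> (at z) u" for z
  have contd: "continuous_on UNIV d" and cont\<psi>: "continuous_on UNIV \<psi>"
    using test_functionD[OF \<psi>] uv by (auto simp: d_def[abs_def])
  obtain r where r: "r > 0" "\<And>z. r \<le> norm z \<Longrightarrow> \<psi> z = 0" "\<And>z. r \<le> norm z \<Longrightarrow> d z = 0"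
    using test_functionD(5)[OF \<psi>] uv unfolding d_def by blast
  have [measurable]: "\<psi> \<in> borel_measurable borel" "d \<in> borel_measurable borel" "\<phi> \<in> borel_measurable borel"
    using cont contd cont\<psi> by (auto intro: borel_measurable_continuous_onI)
  define G where "G z = d z *\<^sub>R \<phi> z + \<psi> z *\<^sub>R f z" for z
  have int1: "integrable lborel (\<lambda>z. d z *\<^sub>R \<phi> z)"
    using r(3) by (intro integrable_continuous_compact_support[where r = r] continuous_intros contd cont) auto
  have int2: "integrable lborel (\<lambda>z. \<psi> z *\<^sub>R f z)"
    using r(2) int by (intro integrable_scaleR_compact_support[where r = r] cont\<psi>) auto
  have intG: "integrable lborel G"
    unfolding G_def using int1 int2 by (rule Bochner_Integration.integrable_add)
  have [measurable]: "G \<in> borel_measurable borel" unfolding G_def by measurable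
  \<comment> \<open>\<open>t\<close> comes first so that Fubini integrates over \<open>s\<close>,
    along each line, before it integrates over the lines.\<close>
  define L where "L = (\<lambda>(t, s). of_real t * v + of_real s * u :: complex)"
  have lb: "lborel = distr (lborel \<Otimes>\<^sub>M lborel) borel L"
    unfolding L_def using uv by (intro lborel_complex_axes) auto
  have Lm[measurable]: "L \<in> borel_measurable (lborel \<Otimes>\<^sub>M lborel)"
    unfolding L_def case_prod_unfold by measurable
  have intL: "integrable (lborel \<Otimes>\<^sub>M lborel) (\<lambda>x. G (L x))"
    using intG by (subst (asm) lb) (simp add: integrable_distr_eq)
  have zero: "(\<integral>s. G (L (t, s)) \<partial>lborel) = 0"
    if ig: "integrable lborel (\<lambda>s. G (L (t, s)))" and F: "finite F"
      and der: "\<And>s. s \<notin> F \<Longrightarrow> ((\<lambda>s. \<phi> (L (t, s))) has_vector_derivative f (L (t, s))) (at s)" for t F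
  proof -
    have "\<bar>s\<bar> \<le> norm (L (t, s))" for s
      using uv abs_Re_le_cmod[of "L (t, s)"] abs_Im_le_cmod[of "L (t, s)"] by (auto simp: L_def)
    then have out: "r \<le> norm (L (t, s))" if "r \<le> \<bar>s\<bar>" for s using that order_trans by blast
    define H where "H s = \<psi> (L (t, s)) *\<^sub>R \<phi> (L (t, s))" for s
    have contL: "continuous_on A (\<lambda>s. L (t, s))" for A
      unfolding L_def by (simp, intro continuous_intros)
    have H': "(H has_vector_derivative G (L (t, s))) (at s)" if "s \<notin> F" for s
    proof -
      have "(\<psi> has_derivative frechet_derivative \<psi> (at (L (t, s)))) (at (L (t, s)))"
        using test_functionD(1)[OF \<psi>] frechet_derivative_works by blast
      moreover have "((\<lambda>s. L (t, s)) has_vector_derivative u) (at s)"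
        unfolding L_def by (auto intro!: derivative_eq_intros)
      ultimately have "((\<lambda>s. \<psi> (L (t, s))) has_vector_derivative d (L (t, s))) (at s)"
        unfolding d_def using vector_derivative_diff_chain_within[of "\<lambda>s. L (t, s)" u s UNIV \<psi>]
        by (auto simp: o_def has_derivative_at_withinI)
      then have "((\<lambda>s. \<psi> (L (t, s))) has_field_derivative d (L (t, s))) (at s)"
        by (simp add: has_real_derivative_iff_has_vector_derivative)
      from has_vector_derivative_scaleR[OF this der[OF that]] show ?thesis
        unfolding H_def[abs_def] G_def by (simp add: add.commute)
    qed
    have "((\<lambda>s. G (L (t, s))) has_integral (H r - H (- r))) {-r..r}"
    proof (rule fundamental_theorem_of_calculus_strong[OF F])
      show "continuous_on {- r..r} H"
        unfolding H_def[abs_def]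
        by (intro continuous_intros continuous_on_compose2[OF cont\<psi> contL] continuous_on_compose2[OF cont contL]) auto
    qed (use r H' in auto)
    moreover have "H r = 0" "H (-r) = 0"
      using out[of r] out[of "-r"] r by (auto simp: H_def)
    ultimately have "((\<lambda>s. G (L (t, s))) has_integral 0) {-r..r}" by simp
    then have "((\<lambda>s. G (L (t, s))) has_integral 0) UNIV"
    proof (rule has_integral_on_superset)
      fix s assume "s \<notin> {-r..r}"
      then have "r \<le> \<bar>s\<bar>" by auto
      then show "G (L (t, s)) = 0" using out r(2,3) by (auto simp: G_def)
    qed auto
    \<comment> \<open>Integrability on this line identifies the gauge integral from the fundamental
      theorem with the Lebesgue integral.\<close>
    moreover have "((\<lambda>s. G (L (t, s))) has_integral (\<integral>s. G (L (t, s)) \<partial>lborel)) UNIV"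
      using ig by (rule has_integral_integral_lborel)
    ultimately show ?thesis by (metis has_integral_unique)
  qed
  have "integral\<^sup>L lborel G = (\<integral>x. G (L x) \<partial>(lborel \<Otimes>\<^sub>M lborel))"
    by (subst lb) (simp add: integral_distr)
  also have "\<dots> = (\<integral>t. (\<integral>s. G (L (t, s)) \<partial>lborel) \<partial>lborel)"
    using lborel_pair.integral_fst'[OF intL] by simp
  also have "\<dots> = (\<integral>t. 0 \<partial>(lborel::real measure))"
  proof (rule integral_cong_AE)
    show "AE t in lborel. (\<integral>s. G (L (t, s)) \<partial>lborel) = 0"
      using lborel_pair.AE_integrable_fst'[OF intL] lines
    proof eventually_elim
      case (elim t)
      then obtain F where "finite F" "\<And>s. s \<notin> F \<Longrightarrow>
       ((\<lambda>s. \<phi> (of_real s * u + of_real t * v)) has_vector_derivative f (of_real s * u + of_real t * v)) (at s)"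
        by blast
      then show ?case using elim(1) by (intro zero[of t F]) (auto simp: L_def add.commute)
    qed
  qed (auto intro!: lborel.borel_measurable_lebesgue_integral)
  finally have "integral\<^sup>L lborel G = 0" by simp
  then have "(\<integral>z. d z *\<^sub>R \<phi> z \<partial>lborel) = - (\<integral>z. \<psi> z *\<^sub>R f z \<partial>lborel)"
    unfolding G_def using int1 int2 by (simp add: eq_neg_iff_add_eq_0)
  then show ?thesis
    unfolding d_def[symmetric] by (simp add: integral_completion)
qed

section \<open>The quasiconformal map\<close>

text \<open>At stage \<open>n\<close> the unit disc contains the discs of radius \<open>R n\<close> about the points of \<open>C n\<close>. In each of
  them the map takes the concentric disc of radius \<open>\<tau> n\<close> to the one of radius \<open>\<sigma> n\<close>, and the next
  stage is inserted there after rescaling.\<close>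

locale cantor_system =
  fixes K :: real and C :: "nat \<Rightarrow> complex set" and R \<sigma> \<tau> :: "nat \<Rightarrow> real"
  assumes K: "K > 1"
    and finite_C: "finite (C n)" and C_nonempty: "C n \<noteq> {}"
    and R_bounds: "0 < R n" "R n \<le> 1/2"
    and \<tau>_pos: "0 < \<tau> n"
    and \<sigma>_eq: "\<sigma> n = R n * (\<tau> n / R n) powr (1 / K)" and \<sigma>_le_half: "2 * \<sigma> n \<le> R n"
    and C_inside: "c \<in> C n \<Longrightarrow> norm c + R n < 1"
    and C_norm: "c \<in> C n \<Longrightarrow> norm c \<le> 3/4"
    and C_separated: "c \<in> C n \<Longrightarrow> c' \<in> C n \<Longrightarrow> c \<noteq> c' \<Longrightarrow> 2 * R n \<le> norm (c - c')"
begin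

lemma \<sigma>_pos: "0 < \<sigma> n"
  using R_bounds(1)[of n] \<tau>_pos[of n] by (simp add: \<sigma>_eq)

lemma \<tau>_less_R: "\<tau> n < R n"
proof (rule ccontr)
  assume "\<not> \<tau> n < R n"
  then have "1 \<le> \<tau> n / R n" using R_bounds(1)[of n] by (simp add: field_simps)
  then have "1 \<le> (\<tau> n / R n) powr (1 / K)" using K by (intro ge_one_powr_ge_zero) auto
  then have "R n \<le> \<sigma> n" using R_bounds(1)[of n] by (simp add: \<sigma>_eq)
  then show False using \<sigma>_le_half[of n] R_bounds(1)[of n] by linarith
qed

lemma \<tau>_le_\<sigma>: "\<tau> n \<le> \<sigma> n"
proof -
  have "(\<tau> n / R n) powr 1 \<le> (\<tau> n / R n) powr (1 / K)"
    using K R_bounds(1)[of n] \<tau>_pos[of n] \<tau>_less_R[of n] by (intro powr_mono') auto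
  then have "\<tau> n / R n \<le> (\<tau> n / R n) powr (1 / K)"
    using R_bounds(1)[of n] \<tau>_pos[of n] by simp
  then show ?thesis using R_bounds(1)[of n] by (simp add: \<sigma>_eq field_simps)
qed

lemma \<tau>_le_half: "2 * \<tau> n \<le> R n"
  using \<tau>_le_\<sigma>[of n] \<sigma>_le_half[of n] by linarith

definition stretch :: "nat \<Rightarrow> complex \<Rightarrow> complex" where
  "stretch n w = (norm w / R n) powr (1 / K - 1) *\<^sub>R w"

definition cell :: "nat \<Rightarrow> (complex \<Rightarrow> complex) \<Rightarrow> complex \<Rightarrow> complex" where
  "cell n g w = (if norm w \<le> \<tau> n then \<sigma> n *\<^sub>R g (w /\<^sub>R \<tau> n) else if norm w \<le> R n then stretch n w else w)"

text \<open>The discs \<open>ball c (R n)\<close>, \<open>c \<in> C n\<close>, are disjoint, so at most one summand is nonzero.\<close>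

definition insert_map :: "nat \<Rightarrow> (complex \<Rightarrow> complex) \<Rightarrow> complex \<Rightarrow> complex" where
  "insert_map n g z = z + (\<Sum>c\<in>C n. cell n g (z - c) - (z - c))"

text \<open>The invariant of the construction: the identity has it, insertion preserves it, and it
  survives uniform limits. Being the identity on the unit circle is what lets the rescaled copy fit
  the stretching around it.\<close>

definition disc_map :: "(complex \<Rightarrow> complex) \<Rightarrow> bool" where
  "disc_map g \<longleftrightarrow> continuous_on UNIV g \<and> (\<forall>z. 1 \<le> norm z \<longrightarrow> g z = z) \<and> (\<forall>z. norm z \<le> 1 \<longrightarrow> norm (g z) \<le> 1)"

lemma norm_stretch: "w \<noteq> 0 \<Longrightarrow> norm (stretch n w) = R n * (norm w / R n) powr (1 / K)"
  using R_bounds(1)[of n] by (simp add: stretch_def powr_diff field_simps)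

lemma cell_outside: "R n \<le> norm w \<Longrightarrow> cell n g w = w"
  using R_bounds(1)[of n] \<tau>_less_R[of n] by (auto simp: cell_def stretch_def)

lemma near_unique:
  assumes "c \<in> C n" "c' \<in> C n" "norm (z - c) < R n" "norm (z - c') \<le> R n"
  shows "c = c'"
proof (rule ccontr)
  assume "c \<noteq> c'"
  then have "2 * R n \<le> norm (c - c')" using C_separated assms by auto
  also have "norm (c - c') \<le> norm (z - c) + norm (z - c')"
    using norm_triangle_ineq4[of "z - c'" "z - c"] by (simp add: algebra_simps)
  finally show False using assms by linarith
qed

lemma sum_near:
  assumes c: "c \<in> C n" "norm (z - c) < R n" and f: "\<And>w. R n \<le> norm w \<Longrightarrow> f w = 0"
  shows "(\<Sum>c\<in>C n. f (z - c)) = f (z - c)"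
proof -
  have "(\<Sum>c\<in>C n. f (z - c)) = (\<Sum>c\<in>{c}. f (z - c))"
  proof (rule sum.mono_neutral_right)
    show "\<forall>i\<in>C n - {c}. f (z - i) = 0"
    proof
      fix i assume "i \<in> C n - {c}"
      then have "R n \<le> norm (z - i)" using near_unique[OF c(1) _ c(2)] by force
      then show "f (z - i) = 0" by (rule f)
    qed
  qed (use c finite_C in auto)
  then show ?thesis by simp
qed

lemma insert_map_near:
  assumes "c \<in> C n" "norm (z - c) < R n"
  shows "insert_map n g z = c + cell n g (z - c)"
  using sum_near[OF assms, of "\<lambda>w. cell n g w - w"] by (simp add: insert_map_def cell_outside)

lemma insert_map_far:
  assumes "\<And>c. c \<in> C n \<Longrightarrow> R n \<le> norm (z - c)"
  shows "insert_map n g z = z"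
  using assms by (simp add: insert_map_def cell_outside)

lemma insert_map_cases [case_names far near]:
  assumes "(\<And>c. c \<in> C n \<Longrightarrow> R n \<le> norm (z - c)) \<Longrightarrow> P"
    and "\<And>c. c \<in> C n \<Longrightarrow> norm (z - c) < R n \<Longrightarrow> P"
  shows P
  using assms by (meson not_less)

lemma norm_stretch_less: "norm w < R n \<Longrightarrow> norm (stretch n w) < R n"
proof (cases "w = 0")
  case False
  assume "norm w < R n"
  then have "(norm w / R n) powr (1 / K) < 1 powr (1 / K)"
    using False K R_bounds(1)[of n] by (intro powr_less_mono2) auto
  then show ?thesis using R_bounds(1)[of n] by (simp add: norm_stretch[OF False])
qed (use R_bounds(1)[of n] in \<open>simp add: stretch_def\<close>)

lemma \<sigma>_less_norm_stretch: "\<tau> n < norm w \<Longrightarrow> \<sigma> n < norm (stretch n w)"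
proof -
  assume w: "\<tau> n < norm w"
  then have "w \<noteq> 0" using \<tau>_pos[of n] by auto
  moreover have "(\<tau> n / R n) powr (1 / K) < (norm w / R n) powr (1 / K)"
    using w K R_bounds(1)[of n] \<tau>_pos[of n] by (intro powr_less_mono2 divide_strict_right_mono) auto
  ultimately show ?thesis using R_bounds(1)[of n] by (simp add: norm_stretch \<sigma>_eq)
qed

lemma norm_cell_inner:
  assumes "disc_map g" "norm w \<le> \<tau> n"
  shows "norm (cell n g w) \<le> \<sigma> n"
proof -
  have "norm (g (w /\<^sub>R \<tau> n)) \<le> 1"
    using assms \<tau>_pos[of n] by (auto simp: disc_map_def divide_simps)
  then show ?thesis using assms \<sigma>_pos[of n] by (simp add: cell_def)
qed

lemma norm_cell_less:
  assumes "disc_map g" "norm w < R n"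
  shows "norm (cell n g w) < R n"
proof (cases "norm w \<le> \<tau> n")
  case True
  then show ?thesis using norm_cell_inner[OF assms(1) True] \<sigma>_le_half[of n] \<sigma>_pos[of n] by linarith
next
  case False
  then show ?thesis using assms norm_stretch_less by (simp add: cell_def)
qed

lemma continuous_cell:
  assumes "disc_map g"
  shows "continuous_on UNIV (cell n g)"
proof -
  have g: "continuous_on UNIV g" "\<And>z. norm z = 1 \<Longrightarrow> g z = z"
    using assms by (auto simp: disc_map_def)
  have 1: "continuous_on ({w. \<tau> n \<le> norm w} \<inter> {w. norm w \<le> R n} \<union> {w. \<tau> n \<le> norm w} \<inter> {w. R n \<le> norm w})
      (\<lambda>w. if norm w \<le> R n then stretch n w else w)"
  proof (rule continuous_on_cases)
    show "continuous_on ({w. \<tau> n \<le> norm w} \<inter> {w. norm w \<le> R n}) (stretch n)"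
      unfolding stretch_def[abs_def] using R_bounds(1)[of n] \<tau>_pos[of n]
      by (intro continuous_intros) auto
  qed (auto intro!: closed_Int closed_Collect_le continuous_intros 
        simp: stretch_def intro: powr_eq_one_iff_gen[THEN iffD2] dest: order_antisym)
  have "{w. \<tau> n \<le> norm w} \<inter> {w. norm w \<le> R n} \<union> {w. \<tau> n \<le> norm w} \<inter> {w. R n \<le> norm w} = {w::complex. \<tau> n \<le> norm w}"
    by auto
  with 1 have 2: "continuous_on {w. \<tau> n \<le> norm w} (\<lambda>w. if norm w \<le> R n then stretch n w else w)"
    by simp
  have "continuous_on ({w. norm w \<le> \<tau> n} \<union> {w. \<tau> n \<le> norm w}) (cell n g)"
    unfolding cell_def[abs_def]
  proof (rule continuous_on_cases)
    show "continuous_on {w. norm w \<le> \<tau> n} (\<lambda>w. \<sigma> n *\<^sub>R g (w /\<^sub>R \<tau> n))"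
      by (intro continuous_intros continuous_on_compose2[OF g(1)]) auto
    show "\<forall>w. w \<in> {w. norm w \<le> \<tau> n} \<and> \<not> norm w \<le> \<tau> n \<or> w \<in> {w. \<tau> n \<le> norm w} \<and> norm w \<le> \<tau> n \<longrightarrow>
        \<sigma> n *\<^sub>R g (w /\<^sub>R \<tau> n) = (if norm w \<le> R n then stretch n w else w)"
    proof (intro allI impI)
      fix w :: complex
      assume "w \<in> {w. norm w \<le> \<tau> n} \<and> \<not> norm w \<le> \<tau> n \<or> w \<in> {w. \<tau> n \<le> norm w} \<and> norm w \<le> \<tau> n"
      then have w: "norm w = \<tau> n" by auto
      then have "g (w /\<^sub>R \<tau> n) = w /\<^sub>R \<tau> n" using \<tau>_pos[of n] by (intro g(2)) auto
      \<comment> \<open>On the inner circle the rescaling factor equals the stretching factor;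
        \<open>\<sigma>_eq\<close> is made for this.\<close>
      moreover have "\<sigma> n * inverse (\<tau> n) = (norm w / R n) powr (1 / K - 1)"
        using w \<tau>_pos[of n] R_bounds(1)[of n] by (simp add: \<sigma>_eq powr_diff field_simps)
      ultimately show "\<sigma> n *\<^sub>R g (w /\<^sub>R \<tau> n) = (if norm w \<le> R n then stretch n w else w)"
        using w \<tau>_less_R[of n] by (simp add: stretch_def)
    qed
  qed (auto intro!: closed_Collect_le continuous_intros 2)
  moreover have "{w. norm w \<le> \<tau> n} \<union> {w. \<tau> n \<le> norm w} = (UNIV :: complex set)" by auto
  ultimately show ?thesis by simp
qed

lemma disc_map_insert_map:
  assumes g: "disc_map g"
  shows "disc_map (insert_map n g)"
  unfolding disc_map_def
proof (intro conjI allI impI)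
  show "continuous_on UNIV (insert_map n g)"
    unfolding insert_map_def[abs_def]
    by (intro continuous_intros continuous_on_compose2[OF continuous_cell[OF g]]) auto
  show "insert_map n g z = z" if "1 \<le> norm z" for z
  proof (rule insert_map_far)
    fix c assume "c \<in> C n"
    then show "R n \<le> norm (z - c)"
      using C_inside[of c n] that norm_triangle_ineq2[of z c] by linarith
  qed
  show "norm (insert_map n g z) \<le> 1" if "norm z \<le> 1" for z
  proof (cases rule: insert_map_cases[of n z])
    case far
    then show ?thesis using that by (simp add: insert_map_far)
  next
    case (near c)
    have "norm (c + cell n g (z - c)) \<le> norm c + R n"
      using norm_cell_less[OF g near(2)] norm_triangle_ineq[of c "cell n g (z - c)"] by linarith
    then show ?thesis using C_inside[OF near(1)] by (simp add: insert_map_near[OF near])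
  qed
qed

text \<open>The two maps differ only in the inner discs, where the difference is scaled by
  \<open>\<sigma> n \<le> 1/2\<close>. This contraction makes the iterates converge
  uniformly.\<close>

lemma insert_map_contraction:
  assumes "\<And>w. norm (g w - g' w) \<le> e"
  shows "norm (insert_map n g z - insert_map n g' z) \<le> e / 2"
proof -
  have e: "0 \<le> e" using assms[of 0] norm_ge_zero order_trans by blast
  show ?thesis
  proof (cases rule: insert_map_cases[of n z])
    case far
    then show ?thesis using e by (simp add: insert_map_far)
  next
    case (near c)
    have "norm (cell n g w - cell n g' w) \<le> e / 2" for w
    proof (cases "norm w \<le> \<tau> n")
      case True
      have "\<sigma> n \<le> 1/2" using \<sigma>_le_half[of n] R_bounds(2)[of n] by linarith
      then have "\<sigma> n * norm (g (w /\<^sub>R \<tau> n) - g' (w /\<^sub>R \<tau> n)) \<le> 1/2 * e"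
        using assms[of "w /\<^sub>R \<tau> n"] \<sigma>_pos[of n] by (intro mult_mono) auto
      then show ?thesis using True \<sigma>_pos[of n]
        by (simp add: cell_def scaleR_diff_right[symmetric] del: scaleR_diff_right)
    qed (use e in \<open>auto simp: cell_def\<close>)
    then show ?thesis by (simp add: insert_map_near[OF near])
  qed
qed

text \<open>The second index is the stage at which the construction starts. The recursion peels off
  the outermost generation, and what sits in its inner discs is the map of stage
  \<open>Suc n\<close>; hence the inductions below run over all \<open>n\<close> at once.\<close>

primrec approx_map :: "nat \<Rightarrow> nat \<Rightarrow> complex \<Rightarrow> complex" where
  "approx_map 0 n = (\<lambda>z. z)"
| "approx_map (Suc N) n = insert_map n (approx_map N (Suc n))"

definition qc_map :: "nat \<Rightarrow> complex \<Rightarrow> complex" where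
  "qc_map n z = lim (\<lambda>N. approx_map N n z)"

lemma disc_map_approx_map: "disc_map (approx_map N n)"
proof (induction N arbitrary: n)
  case 0
  then show ?case by (simp add: disc_map_def)
qed (simp add: disc_map_insert_map)

lemma approx_map_step: "norm (approx_map (Suc N) n z - approx_map N n z) \<le> 2 * (1/2) ^ N"
proof (induction N arbitrary: n z)
  case 0
  show ?case
  proof (cases "norm z \<le> 1")
    case True
    then have "norm (approx_map 1 n z) \<le> 1"
      using disc_map_approx_map[of 1 n] by (auto simp: disc_map_def)
    then show ?thesis using True norm_triangle_ineq4[of "approx_map 1 n z" z] by simp
  next
    case False
    then have "approx_map 1 n z = z"
      using disc_map_approx_map[of 1 n] by (auto simp: disc_map_def)
    then show ?thesis by simp
  qed
next
  case (Suc N)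
  show ?case
    using insert_map_contraction[of "approx_map (Suc N) (Suc n)" "approx_map N (Suc n)", OF Suc] by simp
qed

lemma uniform_limit_approx_map: "uniform_limit UNIV (\<lambda>N. approx_map N n) (qc_map n) sequentially"
proof -
  have "uniform_limit UNIV (\<lambda>N z. \<Sum>k<N. approx_map (Suc k) n z - approx_map k n z)
     (\<lambda>z. \<Sum>k. approx_map (Suc k) n z - approx_map k n z) sequentially"
    by (rule Weierstrass_m_test[of _ _ "\<lambda>N. 2 * (1/2) ^ N"]) (use approx_map_step in \<open>auto intro!: summable_geometric summable_mult\<close>)
  moreover have "(\<Sum>k<N. approx_map (Suc k) n z - approx_map k n z) = approx_map N n z - z" for N z
    using sum_lessThan_telescope[of "\<lambda>k. approx_map k n z" N] by simp
  ultimately have "uniform_limit UNIV (\<lambda>N z. approx_map N n z - z)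
     (\<lambda>z. \<Sum>k. approx_map (Suc k) n z - approx_map k n z) sequentially"
    by simp
  from uniform_limit_add[OF this uniform_limit_const[where c = "\<lambda>z. z"]]
  have u: "uniform_limit UNIV (\<lambda>N. approx_map N n) (\<lambda>z. (\<Sum>k. approx_map (Suc k) n z - approx_map k n z) + z) sequentially"
    by simp
  have "qc_map n z = (\<Sum>k. approx_map (Suc k) n z - approx_map k n z) + z" for z
    using tendsto_uniform_limitI[OF u, of z] unfolding qc_map_def by (intro limI) auto
  then have "qc_map n = (\<lambda>z. (\<Sum>k. approx_map (Suc k) n z - approx_map k n z) + z)" by blast
  with u show ?thesis by simp
qed

lemma approx_map_tendsto: "(\<lambda>N. approx_map N n z) \<longlonglongrightarrow> qc_map n z"
  using tendsto_uniform_limitI[OF uniform_limit_approx_map] by auto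

lemma disc_map_qc_map: "disc_map (qc_map n)"
  unfolding disc_map_def
proof (intro conjI allI impI)
  have a: "continuous_on UNIV (approx_map N n)" "1 \<le> norm z \<Longrightarrow> approx_map N n z = z"
     "norm z \<le> 1 \<Longrightarrow> norm (approx_map N n z) \<le> 1" for N z
    using disc_map_approx_map[of N n] by (auto simp: disc_map_def)
  show "continuous_on UNIV (qc_map n)"
    by (rule uniform_limit_theorem[OF _ uniform_limit_approx_map]) (auto simp: a)
  show "qc_map n z = z" if "1 \<le> norm z" for z
    using LIMSEQ_unique[OF approx_map_tendsto[of n z]] a(2)[OF that] by auto
  show "norm (qc_map n z) \<le> 1" if "norm z \<le> 1" for z
    by (rule LIMSEQ_le_const2[OF tendsto_norm[OF approx_map_tendsto]]) (use a(3)[OF that] in auto)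
qed

lemma qc_map_unfold: "qc_map n = insert_map n (qc_map (Suc n))"
proof
  fix z
  have "(\<lambda>N. cell n (approx_map N (Suc n)) w) \<longlonglongrightarrow> cell n (qc_map (Suc n)) w" for w
    by (auto simp: cell_def intro!: tendsto_intros approx_map_tendsto)
  then have "(\<lambda>N. approx_map (Suc N) n z) \<longlonglongrightarrow> insert_map n (qc_map (Suc n)) z"
    by (auto simp: insert_map_def intro!: tendsto_intros)
  then show "qc_map n z = insert_map n (qc_map (Suc n)) z"
    using LIMSEQ_Suc[OF approx_map_tendsto[of n z]] LIMSEQ_unique by blast
qed

text \<open>An insertion maps each disc of radius \<open>R n\<close> into itself and is the identity
  elsewhere. In the annulus the stretching keeps directions, is strictly increasing in the modulus,
  and stays outside the disc of radius \<open>\<sigma> n\<close> that receives the inner disc. So a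
  collision can only happen inside one inner disc, and there it is a collision of
  \<open>g\<close>.\<close>

lemma insert_map_injective:
  assumes g: "disc_map g" and eq: "insert_map n g x = insert_map n g y" and "x \<noteq> y"
  obtains c where "c \<in> C n" "norm (x - c) \<le> \<tau> n" "norm (y - c) \<le> \<tau> n"
    "g ((x - c) /\<^sub>R \<tau> n) = g ((y - c) /\<^sub>R \<tau> n)"
proof -
  have stay: "norm (insert_map n g z - c) < R n" if "c \<in> C n" "norm (z - c) < R n" for z c
    using norm_cell_less[OF g that(2)] by (simp add: insert_map_near[OF that])
  have both: "norm (y - c) < R n" if c: "c \<in> C n" "norm (x - c) < R n" 
    and eq: "insert_map n g x = insert_map n g y" for x y c
  proof (cases rule: insert_map_cases[of n y])
    case far
    then show ?thesis using stay[OF c] eq by (simp add: insert_map_far)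
  next
    case (near c')
    have "c = c'"
      using near_unique[OF c(1) near(1) stay[OF c]] stay[OF near] eq by simp
    then show ?thesis using near by simp
  qed
  show thesis
  proof (cases rule: insert_map_cases[of n x])
    case far
    then have "insert_map n g x = x" by (simp add: insert_map_far)
    moreover have "insert_map n g y = y"
      using far both[of _ y x] eq by (intro insert_map_far) (metis not_less)
    ultimately show ?thesis using eq \<open>x \<noteq> y\<close> by simp
  next
    case (near c)
    define a b where "a = x - c" and "b = y - c"
    have ab: "norm a < R n" "norm b < R n" using near both[OF near eq] by (auto simp: a_def b_def)
    have cell_eq: "cell n g a = cell n g b"
      using eq insert_map_near[OF near] insert_map_near[OF near(1) both[OF near eq]] by (simp add: a_def b_def)
    have inner: "norm b \<le> \<tau> n" if "norm a \<le> \<tau> n" "norm b < R n" "cell n g a = cell n g b" for a b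
    proof (rule ccontr)
      assume "\<not> norm b \<le> \<tau> n"
      then have "\<sigma> n < norm (cell n g b)"
        using that \<sigma>_less_norm_stretch[of n b] by (simp add: cell_def)
      then show False using norm_cell_inner[OF g that(1)] that by simp
    qed
    show ?thesis
    proof (cases "norm a \<le> \<tau> n")
      case True
      then have "norm b \<le> \<tau> n" using inner ab cell_eq by blast
      with True cell_eq near \<sigma>_pos[of n] show ?thesis
        by (intro that[of c]) (auto simp: a_def b_def cell_def)
    next
      case False
      then have False': "\<not> norm b \<le> \<tau> n" using inner[of b a] ab cell_eq by metis
      have nz: "a \<noteq> 0" "b \<noteq> 0" using False False' \<tau>_pos[of n] by auto
      have st: "stretch n a = stretch n b" using cell_eq False False' ab by (simp add: cell_def)
      then have "(norm a / R n) powr (1 / K) = (norm b / R n) powr (1 / K)"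
        using norm_stretch[OF nz(1), of n] norm_stretch[OF nz(2), of n] R_bounds(1)[of n] by simp
      then have "((norm a / R n) powr (1 / K)) powr K = ((norm b / R n) powr (1 / K)) powr K" by simp
      then have "norm a = norm b" using K R_bounds(1)[of n] by (simp add: powr_powr)
      then have "a = b" using st nz R_bounds(1)[of n] by (simp add: stretch_def)
      then show ?thesis using \<open>x \<noteq> y\<close> by (simp add: a_def b_def)
    qed
  qed
qed

text \<open>Two points with the same image lie in a common inner disc at every generation, and rescaling
  that disc to the unit disc at least doubles their distance.\<close>

lemma inj_qc_map: "inj (qc_map n)"
proof (rule injI, rule ccontr)
  fix x y assume "qc_map n x = qc_map n y" "x \<noteq> y"
  \<comment> \<open>For \<open>k = 0\<close> the points may lie anywhere; from \<open>k = 1\<close>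
    on they are in the unit disc, which bounds their distance by 2 and contradicts the
    doubling.\<close>
  have "\<exists>m x' y'. qc_map m x' = qc_map m y' \<and> 2 ^ k * norm (x - y) \<le> norm (x' - y') \<and> (0 < k \<longrightarrow> norm x' \<le> 1 \<and> norm y' \<le> 1)" for k
  proof (induction k)
    case 0
    then show ?case using \<open>qc_map n x = qc_map n y\<close> by (intro exI[of _ n] exI[of _ x] exI[of _ y]) simp
  next
    case (Suc k)
    then obtain m x' y' where h: "qc_map m x' = qc_map m y'" "2 ^ k * norm (x - y) \<le> norm (x' - y')" by blast
    have "0 < 2 ^ k * norm (x - y)" using \<open>x \<noteq> y\<close> by simp
    then have "x' \<noteq> y'" using h(2) by auto
    moreover have "insert_map m (qc_map (Suc m)) x' = insert_map m (qc_map (Suc m)) y'"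
      using h(1) qc_map_unfold[of m] by metis
    ultimately obtain c where c: "c \<in> C m" "norm (x' - c) \<le> \<tau> m" "norm (y' - c) \<le> \<tau> m"
      "qc_map (Suc m) ((x' - c) /\<^sub>R \<tau> m) = qc_map (Suc m) ((y' - c) /\<^sub>R \<tau> m)"
      using insert_map_injective[OF disc_map_qc_map] by metis
    have \<tau>2: "\<tau> m \<le> 1/2" using \<tau>_le_half[of m] R_bounds(2)[of m] by linarith
    have "(x' - c) /\<^sub>R \<tau> m - (y' - c) /\<^sub>R \<tau> m = (x' - y') /\<^sub>R \<tau> m"
      by (simp flip: scaleR_diff_right)
    then have "norm ((x' - c) /\<^sub>R \<tau> m - (y' - c) /\<^sub>R \<tau> m) = norm (x' - y') / \<tau> m"
      using \<tau>_pos[of m] by (simp add: divide_inverse mult.commute)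
    moreover have "2 * norm (x' - y') \<le> norm (x' - y') / \<tau> m"
      using \<tau>2 \<tau>_pos[of m] mult_right_mono[of "2 * \<tau> m" 1 "norm (x' - y')"] by (simp add: field_simps)
    ultimately have "2 ^ Suc k * norm (x - y) \<le> norm ((x' - c) /\<^sub>R \<tau> m - (y' - c) /\<^sub>R \<tau> m)"
      using h(2) by simp
    moreover have "norm ((z - c) /\<^sub>R \<tau> m) \<le> 1" if "norm (z - c) \<le> \<tau> m" for z
      using that \<tau>_pos[of m] by (simp add: divide_simps)
    ultimately show ?case
      using c by (intro exI[of _ "Suc m"] exI[of _ "(x' - c) /\<^sub>R \<tau> m"] exI[of _ "(y' - c) /\<^sub>R \<tau> m"]) simp
  qed
  then have bd: "2 ^ Suc k * norm (x - y) \<le> 2" for k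
    using norm_triangle_ineq4 by (metis add_mono_thms_linordered_semiring(1) one_add_one order_trans zero_less_Suc)
  obtain k where "2 / norm (x - y) < 2 ^ k"
    using real_arch_pow[of 2 "2 / norm (x - y)"] by auto
  then have "2 < 2 ^ Suc k * norm (x - y)"
    using \<open>x \<noteq> y\<close> by (simp add: field_simps)
  then show False using bd[of k] by linarith
qed

section \<open>The weak gradient\<close>

text \<open>The derivative of \<open>stretch n\<close> at \<open>w\<close> in direction
  \<open>v\<close>: a common factor times the map that multiplies the component of \<open>v\<close>
  along \<open>w\<close> by 1/K and keeps the orthogonal one.\<close>

definition dstretch :: "nat \<Rightarrow> complex \<Rightarrow> complex \<Rightarrow> complex" where
  "dstretch n w v = (norm w / R n) powr (1 / K - 1) *\<^sub>R (v + ((1 / K - 1) * (w \<bullet> v) / (norm w)\<^sup>2) *\<^sub>R w)"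

definition dcell :: "nat \<Rightarrow> (complex \<Rightarrow> complex \<Rightarrow> complex) \<Rightarrow> complex \<Rightarrow> complex \<Rightarrow> complex" where
  "dcell n D w v = (if norm w < \<tau> n then (\<sigma> n / \<tau> n) *\<^sub>R D (w /\<^sub>R \<tau> n) v
     else if norm w < R n then dstretch n w v else v)"

definition dinsert :: "nat \<Rightarrow> (complex \<Rightarrow> complex \<Rightarrow> complex) \<Rightarrow> complex \<Rightarrow> complex \<Rightarrow> complex" where
  "dinsert n D z v = v + (\<Sum>c\<in>C n. dcell n D (z - c) v - v)"

text \<open>Starting the recursion with \<open>0\<close> makes the limit vanish on the Cantor set, so that measurability,
  the energy bound and the dilatation bound all pass to it without exceptional sets.\<close>

primrec approx_grad :: "nat \<Rightarrow> nat \<Rightarrow> complex \<Rightarrow> complex \<Rightarrow> complex" where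
  "approx_grad 0 n = (\<lambda>z v. 0)"
| "approx_grad (Suc N) n = dinsert n (approx_grad N (Suc n))"

definition grad :: "nat \<Rightarrow> complex \<Rightarrow> complex \<Rightarrow> complex" where
  "grad n z v = lim (\<lambda>N. approx_grad N n z v)"

lemma dcell_outside: "R n \<le> norm w \<Longrightarrow> dcell n D w v = v"
  using \<tau>_less_R[of n] by (auto simp: dcell_def)

lemma dinsert_near:
  assumes "c \<in> C n" "norm (z - c) < R n"
  shows "dinsert n D z v = dcell n D (z - c) v"
  using sum_near[OF assms, of "\<lambda>w. dcell n D w v - v"] by (simp add: dinsert_def dcell_outside)

lemma dinsert_far:
  assumes "\<And>c. c \<in> C n \<Longrightarrow> R n \<le> norm (z - c)"
  shows "dinsert n D z v = v"
  using assms by (simp add: dinsert_def dcell_outside)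

text \<open>The start value 0 persists only while the point stays in inner discs. A nonzero value
  was produced by a stretching or by the identity at an earlier generation, which later generations
  do not change. The sequence is thus eventually constant at every point.\<close>

lemma approx_grad_stable: "approx_grad N n z v \<noteq> 0 \<Longrightarrow> approx_grad (Suc N) n z v = approx_grad N n z v"
proof (induction N arbitrary: n z)
  case (Suc N)
  show ?case
  proof (cases rule: insert_map_cases[of n z])
    case far
    then show ?thesis by (simp add: dinsert_far)
  next
    case (near c)
    show ?thesis
    proof (cases "norm (z - c) < \<tau> n")
      case True
      then have "approx_grad N (Suc n) ((z - c) /\<^sub>R \<tau> n) v \<noteq> 0"
        using Suc.prems by (simp add: dinsert_near[OF near] dcell_def)
      from Suc.IH[OF this] True show ?thesis
        by (simp add: dinsert_near[OF near] dcell_def)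
    next
      case False
      then show ?thesis by (simp add: dinsert_near[OF near] dcell_def)
    qed
  qed
qed simp

lemma approx_grad_stable':
  assumes "approx_grad N n z v \<noteq> 0" "N \<le> M"
  shows "approx_grad M n z v = approx_grad N n z v"
  using assms(2)
proof (induction M rule: dec_induct)
  case (step M)
  then show ?case using approx_grad_stable[of M n z v] assms(1) by simp
qed simp

lemma approx_grad_eventually:
  "(\<forall>\<^sub>F N in sequentially. approx_grad N n z v = grad n z v)"
proof (cases "\<exists>N. approx_grad N n z v \<noteq> 0")
  case True
  then obtain N where N: "approx_grad N n z v \<noteq> 0" by blast
  have ev: "\<forall>\<^sub>F M in sequentially. approx_grad M n z v = approx_grad N n z v"
    using approx_grad_stable'[OF N] eventually_sequentially by blast
  then have "grad n z v = approx_grad N n z v"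
    unfolding grad_def by (intro limI tendsto_eventually)
  with ev show ?thesis by simp
next
  case False
  then have "grad n z v = 0" unfolding grad_def by simp
  with False show ?thesis by simp
qed

lemma approx_grad_tendsto: "(\<lambda>N. approx_grad N n z v) \<longlonglongrightarrow> grad n z v"
  using approx_grad_eventually by (rule tendsto_eventually)

lemma grad_unfold: "grad n = dinsert n (grad (Suc n))"
proof (intro ext)
  fix z v
  have "(\<lambda>N. dcell n (approx_grad N (Suc n)) w v) \<longlonglongrightarrow> dcell n (grad (Suc n)) w v" for w
    by (auto simp: dcell_def intro!: tendsto_intros approx_grad_tendsto)
  then have "(\<lambda>N. approx_grad (Suc N) n z v) \<longlonglongrightarrow> dinsert n (grad (Suc n)) z v"
    by (auto simp: dinsert_def intro!: tendsto_intros)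
  then show "grad n z v = dinsert n (grad (Suc n)) z v"
    using LIMSEQ_Suc[OF approx_grad_tendsto[of n z v]] LIMSEQ_unique by blast
qed

lemma grad_outside: "1 \<le> norm z \<Longrightarrow> grad n z v = v"
proof -
  assume z: "1 \<le> norm z"
  have "R n \<le> norm (z - c)" if "c \<in> C n" for c
    using C_inside[OF that] z norm_triangle_ineq2[of z c] by linarith
  then show ?thesis using dinsert_far grad_unfold by metis
qed

lemma dstretch_measurable [measurable]: "(\<lambda>w. dstretch n w v) \<in> borel_measurable borel"
  unfolding dstretch_def by measurable

lemma dcell_measurable:
  assumes [measurable]: "(\<lambda>z. D z v) \<in> borel_measurable borel"
  shows "(\<lambda>w. dcell n D w v) \<in> borel_measurable borel"
  unfolding dcell_def by measurable

lemma dinsert_measurable: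
  assumes "(\<lambda>z. D z v) \<in> borel_measurable borel"
  shows "(\<lambda>w. dinsert n D w v) \<in> borel_measurable borel"
proof -
  have m: "(\<lambda>w. dcell n D w v) \<in> borel_measurable borel"
    using assms by (rule dcell_measurable)
  have [measurable]: "(\<lambda>z. dcell n D (z - c) v) \<in> borel_measurable borel" for c
    by (rule measurable_compose[OF _ m]) measurable
  show ?thesis unfolding dinsert_def by measurable
qed

lemma approx_grad_measurable [measurable]: "(\<lambda>z. approx_grad N n z v) \<in> borel_measurable borel"
  by (induction N arbitrary: n) (auto simp: dinsert_measurable)

lemma grad_measurable [measurable]: "(\<lambda>z. grad n z v) \<in> borel_measurable borel"
  by (rule borel_measurable_LIMSEQ_metric[OF approx_grad_measurable approx_grad_tendsto])

text \<open>\<open>l\<close> bounds the largest directional derivative. In this form the condition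
  is stable under scaling, and \<open>l = 0\<close> admits the zero map, which is the value of
  \<open>grad\<close> on the Cantor set.\<close>

definition bounded_distortion :: "(complex \<Rightarrow> complex) \<Rightarrow> bool" where
  "bounded_distortion f \<longleftrightarrow> linear f \<and> (\<exists>l\<ge>0. \<forall>v. l / K * norm v \<le> norm (f v) \<and> norm (f v) \<le> l * norm v)"

text \<open>The map multiplies the component of \<open>v\<close> along \<open>w\<close> by
  \<open>k\<close>. With \<open>p\<close> the square of that component, the squared norm of the
  image is (norm v)^2 - (1 - k^2) p, and p lies between 0 and (norm v)^2.\<close>

lemma norm_radial_shear:
  fixes w v :: complex
  assumes "w \<noteq> 0" "0 < k" "k \<le> 1"
  shows "k * norm v \<le> norm (v + ((k - 1) * (w \<bullet> v) / (norm w)\<^sup>2) *\<^sub>R w)"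
    and "norm (v + ((k - 1) * (w \<bullet> v) / (norm w)\<^sup>2) *\<^sub>R w) \<le> norm v"
proof -
  define p where "p = (w \<bullet> v)\<^sup>2 / (norm w)\<^sup>2"
  have p: "0 \<le> p" "p \<le> (norm v)\<^sup>2"
  proof -
    have "(w \<bullet> v)\<^sup>2 \<le> (norm w * norm v)\<^sup>2"
      using Cauchy_Schwarz_ineq2[of w v] by (metis abs_ge_zero power2_abs power_mono)
    then show "p \<le> (norm v)\<^sup>2" using assms by (simp add: p_def divide_simps power_mult_distrib mult.commute)
  qed (simp add: p_def)
  have gen: "(norm (v + a *\<^sub>R w))\<^sup>2 = (norm v)\<^sup>2 + 2 * a * (w \<bullet> v) + a\<^sup>2 * (norm w)\<^sup>2" for a
    by (simp only: power2_norm_eq_inner) (simp add: inner_add_left inner_add_right inner_commute power2_eq_square algebra_simps)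
  have "(norm (v + ((k - 1) * (w \<bullet> v) / (norm w)\<^sup>2) *\<^sub>R w))\<^sup>2
     = (norm v)\<^sup>2 + 2 * ((k - 1) * (w \<bullet> v) / (norm w)\<^sup>2) * (w \<bullet> v) + ((k - 1) * (w \<bullet> v) / (norm w)\<^sup>2)\<^sup>2 * (norm w)\<^sup>2"
    by (rule gen)
  also have "\<dots> = (norm v)\<^sup>2 + 2 * (k - 1) * p + (k - 1)\<^sup>2 * p"
    using assms by (simp add: p_def power2_eq_square field_simps)
  also have "\<dots> = (norm v)\<^sup>2 - (1 - k\<^sup>2) * p"
    by (simp add: power2_eq_square algebra_simps)
  finally have eq: "(norm (v + ((k - 1) * (w \<bullet> v) / (norm w)\<^sup>2) *\<^sub>R w))\<^sup>2 = (norm v)\<^sup>2 - (1 - k\<^sup>2) * p" .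
  have k2: "0 \<le> 1 - k\<^sup>2" using assms by (simp add: power_le_one)
  have "(1 - k\<^sup>2) * p \<le> (1 - k\<^sup>2) * (norm v)\<^sup>2" using p k2 by (intro mult_left_mono) auto
  then have "(k * norm v)\<^sup>2 \<le> (norm (v + ((k - 1) * (w \<bullet> v) / (norm w)\<^sup>2) *\<^sub>R w))\<^sup>2"
    unfolding eq by (simp add: power_mult_distrib algebra_simps)
  then show "k * norm v \<le> norm (v + ((k - 1) * (w \<bullet> v) / (norm w)\<^sup>2) *\<^sub>R w)"
    by (rule power2_le_imp_le) simp
  have "(norm (v + ((k - 1) * (w \<bullet> v) / (norm w)\<^sup>2) *\<^sub>R w))\<^sup>2 \<le> (norm v)\<^sup>2"
    unfolding eq using p k2 by simp
  then show "norm (v + ((k - 1) * (w \<bullet> v) / (norm w)\<^sup>2) *\<^sub>R w) \<le> norm v"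
    by (rule power2_le_imp_le) simp
qed

lemma norm_dstretch_le:
  assumes "w \<noteq> 0"
  shows "norm (dstretch n w v) \<le> (norm w / R n) powr (1 / K - 1) * norm v"
  using norm_radial_shear(2)[OF assms, of "1/K" v] K by (simp add: dstretch_def mult_left_mono)

lemma bounded_distortion_dstretch:
  assumes w: "w \<noteq> 0"
  shows "bounded_distortion (dstretch n w)"
  unfolding bounded_distortion_def
proof (intro conjI exI[of _ "(norm w / R n) powr (1 / K - 1)"] allI)
  show "linear (dstretch n w)"
    by (rule linearI) (simp_all add: dstretch_def inner_add_right add_divide_distrib scaleR_add_right scaleR_add_left distrib_left mult_ac)
  show "norm (dstretch n w v) \<le> (norm w / R n) powr (1 / K - 1) * norm v" for v
    using w by (rule norm_dstretch_le)
  show "(norm w / R n) powr (1 / K - 1) / K * norm v \<le> norm (dstretch n w v)" for v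
    using mult_left_mono[OF norm_radial_shear(1)[OF w, of "1/K" v], of "(norm w / R n) powr (1 / K - 1)"] K
    by (simp add: dstretch_def)
qed simp

lemma bounded_distortion_id: "bounded_distortion (\<lambda>v. v)"
  unfolding bounded_distortion_def using K
  by (intro conjI exI[of _ 1] linear_id[unfolded id_def]) (auto simp: divide_le_eq mult_left_mono[of 1 K, simplified])

lemma bounded_distortion_scaleR:
  assumes "bounded_distortion f" "0 \<le> a"
  shows "bounded_distortion (\<lambda>v. a *\<^sub>R f v)"
proof -
  obtain l where l: "l \<ge> 0" "\<And>v. l / K * norm v \<le> norm (f v)" "\<And>v. norm (f v) \<le> l * norm v"
    using assms by (auto simp: bounded_distortion_def)
  show ?thesis
    unfolding bounded_distortion_def
  proof (intro conjI exI[of _ "a * l"] allI)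
    show "linear (\<lambda>v. a *\<^sub>R f v)"
      using assms by (auto simp: bounded_distortion_def intro: linear_compose_scale_right)
    show "a * l / K * norm v \<le> norm (a *\<^sub>R f v)" "norm (a *\<^sub>R f v) \<le> a * l * norm v" for v
      using mult_left_mono[OF l(2)[of v] assms(2)] mult_left_mono[OF l(3)[of v] assms(2)] assms(2) by (simp_all add: mult.assoc)
  qed (use l assms in auto)
qed

lemma bounded_distortion_approx_grad: "bounded_distortion (approx_grad N n z)"
proof (induction N arbitrary: n z)
  case 0
  show ?case by (auto simp: bounded_distortion_def linear_zero intro!: exI[of _ 0])
next
  case (Suc N)
  show ?case
  proof (cases rule: insert_map_cases[of n z])
    case far
    then have "approx_grad (Suc N) n z = (\<lambda>v. v)" by (auto simp: dinsert_far fun_eq_iff)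
    then show ?thesis using bounded_distortion_id by simp
  next
    case (near c)
    have "approx_grad (Suc N) n z = (if norm (z - c) < \<tau> n then (\<lambda>v. (\<sigma> n / \<tau> n) *\<^sub>R approx_grad N (Suc n) ((z - c) /\<^sub>R \<tau> n) v)
       else dstretch n (z - c))"
      using near(2) by (auto simp: dinsert_near[OF near] dcell_def fun_eq_iff)
    moreover have "z - c \<noteq> 0" if "\<not> norm (z - c) < \<tau> n"
      using that \<tau>_pos[of n] by auto
    moreover have "0 \<le> \<sigma> n / \<tau> n" using \<sigma>_pos[of n] \<tau>_pos[of n] by simp
    ultimately show ?thesis
      using bounded_distortion_scaleR[OF Suc.IH] bounded_distortion_dstretch by auto
  qed
qed

text \<open>If one directional derivative is nonzero at stage \<open>N\<close>, then
  \<open>l > 0\<close>, and the lower bound makes all others nonzero at the same stage. So all of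
  them have stabilised there, and the limit is the linear map
  \<open>approx_grad N n z\<close>.\<close>

lemma bounded_distortion_grad: "bounded_distortion (grad n z)"
proof (cases "\<exists>N v. approx_grad N n z v \<noteq> 0")
  case True
  then obtain N v0 where N: "approx_grad N n z v0 \<noteq> 0" by blast
  have lin: "linear (approx_grad N n z)" and "\<exists>l\<ge>0. \<forall>v. l / K * norm v \<le> norm (approx_grad N n z v) \<and> norm (approx_grad N n z v) \<le> l * norm v"
    using bounded_distortion_approx_grad[of N n z] by (auto simp: bounded_distortion_def)
  then obtain l where l: "l \<ge> 0" "\<And>v. l / K * norm v \<le> norm (approx_grad N n z v)" "\<And>v. norm (approx_grad N n z v) \<le> l * norm v"
    by blast
  have "l \<noteq> 0" using l(3)[of v0] N by auto
  then have lpos: "l / K > 0" using l(1) K by simp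
  have "grad n z v = approx_grad N n z v" for v
  proof (cases "v = 0")
    case True
    have "grad n z 0 = 0"
    proof -
      have "approx_grad M n z 0 = 0" for M
        using bounded_distortion_approx_grad[of M n z] linear_0 by (auto simp: bounded_distortion_def)
      then show ?thesis by (simp add: grad_def)
    qed
    then show ?thesis using True lin linear_0 by metis
  next
    case False
    then have "0 < l / K * norm v" using lpos by (intro mult_pos_pos) auto
    then have "approx_grad N n z v \<noteq> 0" using l(2)[of v] by auto
    then have "\<forall>\<^sub>F M in sequentially. approx_grad M n z v = approx_grad N n z v"
      using approx_grad_stable' eventually_sequentially by blast
    then show ?thesis unfolding grad_def by (intro limI tendsto_eventually)
  qed
  then have "grad n z = approx_grad N n z" by blast
  then show ?thesis using bounded_distortion_approx_grad by simp
next
  case False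
  then have "grad n z = (\<lambda>v. 0)" by (auto simp: grad_def fun_eq_iff)
  then show ?thesis by (auto simp: bounded_distortion_def linear_zero intro!: exI[of _ 0])
qed

lemma bounded_distortion_SUP_INF:
  assumes "bounded_distortion f"
  shows "(SUP \<alpha>::real. cmod (cos \<alpha> *\<^sub>R f 1 + sin \<alpha> *\<^sub>R f \<i>)) \<le> K * (INF \<alpha>::real. cmod (cos \<alpha> *\<^sub>R f 1 + sin \<alpha> *\<^sub>R f \<i>))"
proof -
  obtain l where lin: "linear f" and l: "l \<ge> 0" "\<And>v. l / K * norm v \<le> norm (f v)" "\<And>v. norm (f v) \<le> l * norm v"
    using assms by (auto simp: bounded_distortion_def)
  have eq: "cos \<alpha> *\<^sub>R f 1 + sin \<alpha> *\<^sub>R f \<i> = f (cis \<alpha>)" for \<alpha>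
  proof -
    have "cis \<alpha> = cos \<alpha> *\<^sub>R 1 + sin \<alpha> *\<^sub>R \<i>" by (simp add: complex_eq_iff)
    then show ?thesis by (simp only: linear_add[OF lin] linear_scale[OF lin])
  qed
  have "(SUP \<alpha>::real. cmod (cos \<alpha> *\<^sub>R f 1 + sin \<alpha> *\<^sub>R f \<i>)) \<le> l"
    unfolding eq using l(3)[of "cis _"] by (intro cSUP_least) auto
  moreover have "l / K \<le> (INF \<alpha>::real. cmod (cos \<alpha> *\<^sub>R f 1 + sin \<alpha> *\<^sub>R f \<i>))"
    unfolding eq using l(2)[of "cis _"] by (intro cINF_greatest) auto
  ultimately show ?thesis using K by (simp add: field_simps)
qed

end

text \<open>\<open>card_R\<close> says that the discs of a stage fill a fixed share of the area,
  which controls the energy and compares sums over centres with integrals.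
  \<open>card_\<tau>\<close> halves the projections of the Cantor set at each generation.\<close>

locale dense_cantor_system = cantor_system +
  assumes card_R: "real (card (C n)) * (R n)\<^sup>2 = 1/4"
    and card_\<tau>: "real (card (C n)) * \<tau> n \<le> 1/2"
begin

lemma card_\<sigma>: "real (card (C n)) * (\<sigma> n)\<^sup>2 \<le> 1/16"
proof -
  have "(2 * \<sigma> n)\<^sup>2 \<le> (R n)\<^sup>2"
    using \<sigma>_pos[of n] \<sigma>_le_half[of n] by (intro power_mono) auto
  then have "real (card (C n)) * (2 * \<sigma> n)\<^sup>2 \<le> real (card (C n)) * (R n)\<^sup>2"
    by (intro mult_left_mono) auto
  then show ?thesis using card_R[of n] by simp
qed

abbreviation energy :: "(complex \<Rightarrow> complex \<Rightarrow> complex) \<Rightarrow> complex \<Rightarrow> ennreal" where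
  "energy D v \<equiv> \<integral>\<^sup>+z. ennreal ((norm (D z v))\<^sup>2) * indicator (ball 0 1) z \<partial>lborel"

text \<open>The Dirichlet energy scales well: in an inner disc the squared gradient gains
  (\<sigma>/\<tau>)^2 and the area \<tau>^2, so all inner discs together contribute at most 1/16 of
  the previous bound, by \<open>card_\<sigma>\<close>. The annuli contribute at most
  \<open>j / 4\<close> by \<open>card_R\<close>, and the undisturbed part at most pi.\<close>

lemma approx_grad_energy:
  assumes v: "norm v = 1"
  shows "\<exists>B. \<forall>N n. energy (approx_grad N n) v \<le> ennreal B"
proof -
  define g where "g x = ennreal (norm x powr - (2 - 2 / K)) * indicator (ball 0 1) x" for x :: complex
  have gm[measurable]: "g \<in> borel_measurable borel"
    unfolding g_def[abs_def] by (intro borel_measurable_times_ennreal borel_measurable_indicator) auto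
  have "(\<integral>\<^sup>+x. g x \<partial>lborel) < \<infinity>"
    unfolding g_def using K by (intro nn_integral_powr_ball_finite) auto
  then obtain j where j: "0 \<le> j" "(\<integral>\<^sup>+x. g x \<partial>lborel) = ennreal j"
    by (cases "\<integral>\<^sup>+x. g x \<partial>lborel") auto
  \<comment> \<open>Chosen so that pi + j/4 + B/16 is at most B, which closes the recursion.\<close>
  define B where "B = 2 * (pi + j / 4)"
  have B: "0 \<le> B" using j by (simp add: B_def)
  have B2: "pi + j / 4 = B / 2" by (simp add: B_def)
  have "energy (approx_grad N n) v \<le> ennreal B" for N n
  proof (induction N arbitrary: n)
    case 0
    show ?case using B by simp
  next
    case (Suc N)
    define f where "f x = ennreal ((norm (approx_grad N (Suc n) x v))\<^sup>2) * indicator (ball 0 1) x" for x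
    have fm[measurable]: "f \<in> borel_measurable borel"
      unfolding f_def[abs_def] by (intro borel_measurable_times_ennreal borel_measurable_indicator) auto
    have le: "ennreal ((norm (approx_grad (Suc N) n z v))\<^sup>2) * indicator (ball 0 1) z
        \<le> indicator (ball 0 1) z + (\<Sum>c\<in>C n. ennreal ((\<sigma> n / \<tau> n)\<^sup>2) * f ((z - c) /\<^sub>R \<tau> n) + g ((z - c) /\<^sub>R R n))"
      (is "?l z \<le> ?i z + (\<Sum>c\<in>C n. ?s c z)") for z
    proof (cases rule: insert_map_cases[of n z])
      case far
      then show ?thesis using v by (simp add: dinsert_far)
    next
      case (near c)
      have "?l z \<le> ?s c z"
      proof (cases "norm (z - c) < \<tau> n")
        case True
        then have "(z - c) /\<^sub>R \<tau> n \<in> ball 0 1" using \<tau>_pos[of n] by (simp add: divide_simps)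
        then have "ennreal ((\<sigma> n / \<tau> n)\<^sup>2) * f ((z - c) /\<^sub>R \<tau> n) = ennreal ((norm (approx_grad (Suc N) n z v))\<^sup>2)"
          using True by (simp add: f_def dinsert_near[OF near] dcell_def power_mult_distrib ennreal_mult[symmetric] power_divide)
        then show ?thesis by (auto simp: indicator_def intro: add_increasing2)
      next
        case False
        then have nz: "z - c \<noteq> 0" using \<tau>_pos[of n] by auto
        have "(norm (dstretch n (z - c) v))\<^sup>2 \<le> ((norm (z - c) / R n) powr (1 / K - 1))\<^sup>2"
          using norm_dstretch_le[OF nz, of n v] v by (intro power_mono) auto
        also have "\<dots> = (norm ((z - c) /\<^sub>R R n)) powr - (2 - 2 / K)"
          using R_bounds(1)[of n] by (simp add: power2_eq_square powr_add[symmetric] divide_inverse mult.commute)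
        finally have "ennreal ((norm (approx_grad (Suc N) n z v))\<^sup>2) \<le> ennreal ((norm ((z - c) /\<^sub>R R n)) powr - (2 - 2 / K))"
          using False near by (intro ennreal_leI) (simp add: dinsert_near[OF near] dcell_def)
        also have "\<dots> = g ((z - c) /\<^sub>R R n)"
        proof -
          have "(z - c) /\<^sub>R R n \<in> ball 0 1"
            using near(2) R_bounds(1)[of n] by (simp add: divide_simps)
          then show ?thesis by (simp add: g_def)
        qed
        finally show ?thesis by (auto simp: indicator_def intro: add_increasing)
      qed
      also have "?s c z \<le> (\<Sum>c\<in>C n. ?s c z)"
        using near(1) finite_C by (intro member_le_sum) auto
      finally show ?thesis by (auto intro: add_increasing)
    qed
    have "(\<integral>\<^sup>+z. ?l z \<partial>lborel) \<le> (\<integral>\<^sup>+z. ?i z + (\<Sum>c\<in>C n. ?s c z) \<partial>lborel)"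
      by (intro nn_integral_mono le)
    also have "\<dots> = (\<integral>\<^sup>+z. ?i z \<partial>lborel) + (\<Sum>c\<in>C n. \<integral>\<^sup>+z. ?s c z \<partial>lborel)"
      by (subst nn_integral_add) (auto simp: nn_integral_sum intro!: borel_measurable_indicator)
    also have "(\<integral>\<^sup>+z. ?i z \<partial>lborel) = ennreal pi"
      by (simp add: emeasure_ball_complex)
    also have "(\<integral>\<^sup>+z. ?s c z \<partial>lborel) \<le> ennreal ((\<sigma> n)\<^sup>2 * B + (R n)\<^sup>2 * j)" for c
    proof -
      have "(\<integral>\<^sup>+z. ?s c z \<partial>lborel) = ennreal ((\<sigma> n / \<tau> n)\<^sup>2) * (ennreal ((\<tau> n)\<^sup>2) * (\<integral>\<^sup>+x. f x \<partial>lborel)) + ennreal ((R n)\<^sup>2) * ennreal j"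
        by (subst nn_integral_add)
          (auto simp: nn_integral_cmult nn_integral_lborel_rescale[OF fm \<tau>_pos] nn_integral_lborel_rescale[OF gm R_bounds(1)] j)
      also have "\<dots> \<le> ennreal ((\<sigma> n / \<tau> n)\<^sup>2) * (ennreal ((\<tau> n)\<^sup>2) * ennreal B) + ennreal ((R n)\<^sup>2) * ennreal j"
        using Suc.IH[of "Suc n"] by (intro add_right_mono mult_left_mono) (auto simp: f_def)
      also have "\<dots> = ennreal ((\<sigma> n)\<^sup>2 * B + (R n)\<^sup>2 * j)"
        using B j \<tau>_pos[of n] by (simp add: ennreal_mult[symmetric] ennreal_plus[symmetric] power_divide del: ennreal_plus)
      finally show ?thesis .
    qed
    then have "(\<Sum>c\<in>C n. \<integral>\<^sup>+z. ?s c z \<partial>lborel) \<le> (\<Sum>c\<in>C n. ennreal ((\<sigma> n)\<^sup>2 * B + (R n)\<^sup>2 * j))"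
      by (rule sum_mono)
    also have "\<dots> = ennreal (real (card (C n)) * ((\<sigma> n)\<^sup>2 * B + (R n)\<^sup>2 * j))"
      using B j by (simp add: ennreal_mult ennreal_of_nat_eq_real_of_nat)
    also have "ennreal pi + \<dots> = ennreal (pi + real (card (C n)) * ((\<sigma> n)\<^sup>2 * B + (R n)\<^sup>2 * j))"
      using B j by (intro ennreal_plus[symmetric]) auto
    also have "\<dots> \<le> ennreal B"
    proof (rule ennreal_leI)
      have "real (card (C n)) * ((\<sigma> n)\<^sup>2 * B + (R n)\<^sup>2 * j) = (real (card (C n)) * (\<sigma> n)\<^sup>2) * B + (real (card (C n)) * (R n)\<^sup>2) * j"
        by (simp add: algebra_simps)
      also have "\<dots> \<le> 1/16 * B + 1/4 * j"
        using mult_right_mono[OF card_\<sigma>[of n] B] by (simp add: card_R)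
      finally have "real (card (C n)) * ((\<sigma> n)\<^sup>2 * B + (R n)\<^sup>2 * j) \<le> 1/16 * B + 1/4 * j" .
      then show "pi + real (card (C n)) * ((\<sigma> n)\<^sup>2 * B + (R n)\<^sup>2 * j) \<le> B"
      proof -
        have "1/16 * B + 1/4 * j \<le> B - pi"
          using B B2 by linarith
        with \<open>real (card (C n)) * ((\<sigma> n)\<^sup>2 * B + (R n)\<^sup>2 * j) \<le> 1/16 * B + 1/4 * j\<close>
        show ?thesis by linarith
      qed
    qed
    finally show ?case by simp
  qed
  then show ?thesis by blast
qed

text \<open>Fatou's lemma, applied to integrands that are eventually constant at every
  point.\<close>

lemma grad_energy:
  assumes v: "norm v = 1"
  shows "energy (grad n) v < \<infinity>"
proof -
  obtain B where B: "\<And>N n. energy (approx_grad N n) v \<le> ennreal B"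
    using approx_grad_energy[OF v] by blast
  have "ennreal ((norm (grad n z v))\<^sup>2) * indicator (ball 0 1) z
     = liminf (\<lambda>N. ennreal ((norm (approx_grad N n z v))\<^sup>2) * indicator (ball 0 1) z)" for z
  proof (rule lim_imp_Liminf[symmetric])
    show "(\<lambda>N. ennreal ((norm (approx_grad N n z v))\<^sup>2) * indicator (ball 0 1) z) \<longlonglongrightarrow> ennreal ((norm (grad n z v))\<^sup>2) * indicator (ball 0 1) z"
      by (rule tendsto_eventually) (use approx_grad_eventually[of n z v] in \<open>auto elim: eventually_mono\<close>)
  qed simp
  then have "energy (grad n) v
      = (\<integral>\<^sup>+z. liminf (\<lambda>N. ennreal ((norm (approx_grad N n z v))\<^sup>2) * indicator (ball 0 1) z) \<partial>lborel)"
    by simp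
  also have "\<dots> \<le> liminf (\<lambda>N. energy (approx_grad N n) v)"
    by (rule nn_integral_liminf) (auto intro!: borel_measurable_times_ennreal borel_measurable_indicator)
  also have "\<dots> \<le> ennreal B"
    by (intro Liminf_le) (auto simp: B)
  also have "\<dots> < \<infinity>" by simp
  finally show ?thesis .
qed

lemma grad_square_integrable:
  assumes v: "norm v = 1" and S: "compact S"
  shows "set_integrable lborel S (\<lambda>z. (norm (grad n z v))\<^sup>2)"
  unfolding set_integrable_def
proof (rule integrableI_nonneg)
  have [measurable]: "S \<in> sets borel" using S by (simp add: borel_compact)
  show "(\<lambda>z. indicat_real S z *\<^sub>R (norm (grad n z v))\<^sup>2) \<in> borel_measurable lborel" by measurable
  have "(\<integral>\<^sup>+z. ennreal (indicat_real S z *\<^sub>R (norm (grad n z v))\<^sup>2) \<partial>lborel)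
      \<le> (\<integral>\<^sup>+z. indicator S z + ennreal ((norm (grad n z v))\<^sup>2) * indicator (ball 0 1) z \<partial>lborel)"
  proof (rule nn_integral_mono)
    fix z
    show "ennreal (indicat_real S z *\<^sub>R (norm (grad n z v))\<^sup>2) \<le> indicator S z + ennreal ((norm (grad n z v))\<^sup>2) * indicator (ball 0 1) z"
    proof (cases "norm z < 1")
      case False
      then show ?thesis using v by (simp add: grad_outside indicator_def)
    qed (auto simp: indicator_def intro: add_increasing)
  qed
  also have "\<dots> = emeasure lborel S + energy (grad n) v"
    by (subst nn_integral_add) (auto intro!: borel_measurable_times_ennreal borel_measurable_indicator)
  also have "\<dots> < \<infinity>"
    using grad_energy[OF v] emeasure_compact_finite[OF S] by simp
  finally show "(\<integral>\<^sup>+z. ennreal (indicat_real S z *\<^sub>R (norm (grad n z v))\<^sup>2) \<partial>lborel) < \<infinity>" .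
qed simp

lemma grad_integrable:
  assumes v: "norm v = 1" and S: "compact S"
  shows "set_integrable lborel S (\<lambda>z. grad n z v)"
proof -
  have [measurable]: "S \<in> sets borel" using S by (simp add: borel_compact)
  have "integrable lborel (\<lambda>z. indicat_real S z + indicat_real S z *\<^sub>R (norm (grad n z v))\<^sup>2)"
    using grad_square_integrable[OF v S, of n] emeasure_compact_finite[OF S] S
    by (intro Bochner_Integration.integrable_add) (auto simp: set_integrable_def)
  then show ?thesis
    unfolding set_integrable_def
  proof (rule Bochner_Integration.integrable_bound)
    have "x \<le> 1 + x\<^sup>2" if "0 \<le> x" for x :: real
      using power2_diff[of x 1] zero_le_power2[of "x - 1"] zero_le_power2[of x] that
      by (cases "x \<le> 1") (auto simp: power2_eq_square mult_le_cancel_left1 intro: add_increasing)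
    then show "AE z in lborel. norm (indicat_real S z *\<^sub>R grad n z v) \<le> norm (indicat_real S z + indicat_real S z *\<^sub>R (norm (grad n z v))\<^sup>2)"
      by (intro AE_I2) (auto simp: indicator_def)
  qed measurable
qed

lemma L2_locI:
  assumes f: "f \<in> borel_measurable borel" and S: "\<And>S. compact S \<Longrightarrow> set_integrable lborel S (\<lambda>z. (norm (f z))\<^sup>2)"
  shows "L2_loc f"
  unfolding L2_loc_def
proof (intro conjI allI impI)
  show "f \<in> borel_measurable lebesgue"
    using f by (intro measurable_completion) simp
  fix S :: "complex set" assume "compact S"
  then have [measurable]: "S \<in> sets borel" by (simp add: borel_compact)
  show "set_integrable lebesgue S (\<lambda>z. (cmod (f z))\<^sup>2)"
    using S[OF \<open>compact S\<close>] f unfolding set_integrable_def by (subst integrable_completion) auto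
qed

lemma L2_loc_grad: "norm v = 1 \<Longrightarrow> L2_loc (\<lambda>z. grad n z v)"
  by (intro L2_locI grad_measurable grad_square_integrable)

lemma L2_loc_continuous:
  assumes "continuous_on UNIV f"
  shows "L2_loc f"
proof (rule L2_locI)
  show "f \<in> borel_measurable borel"
    using assms by (rule borel_measurable_continuous_onI)
  show "set_integrable lborel S (\<lambda>z. (norm (f z))\<^sup>2)" if "compact S" for S
    unfolding set_integrable_def
    by (intro borel_integrable_compact that continuous_intros continuous_on_subset[OF assms]) auto
qed

end

section \<open>Differentiability of the limit map along almost every line\<close>

lemma finite_line_sphere:
  fixes u b :: complex
  assumes "norm u = 1"
  shows "finite {s::real. norm (of_real s * u + b) = \<rho>}"
proof (cases "\<exists>s0. norm (of_real s0 * u + b) = \<rho>")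
  case True
  then obtain s0 where s0: "norm (of_real s0 * u + b) = \<rho>" by blast
  have sq: "(norm (of_real s * u + b))\<^sup>2 = s\<^sup>2 + 2 * s * (u \<bullet> b) + (norm b)\<^sup>2" for s
  proof -
    have "(norm (s *\<^sub>R u + b))\<^sup>2 = s\<^sup>2 * (norm u)\<^sup>2 + 2 * s * (u \<bullet> b) + (norm b)\<^sup>2"
      by (simp only: power2_norm_eq_inner) (simp add: inner_add_left inner_add_right inner_commute power2_eq_square)
    then show ?thesis using assms by (simp add: scaleR_conv_of_real)
  qed
  have "s = s0 \<or> s = - s0 - 2 * (u \<bullet> b)" if "norm (of_real s * u + b) = \<rho>" for s
  proof -
    have "s\<^sup>2 + 2 * s * (u \<bullet> b) = s0\<^sup>2 + 2 * s0 * (u \<bullet> b)"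
      using sq[of s] sq[of s0] that s0 by simp
    then have "(s - s0) * (s + s0 + 2 * (u \<bullet> b)) = 0"
      by (simp add: power2_eq_square algebra_simps)
    then show ?thesis by auto
  qed
  then have "{s. norm (of_real s * u + b) = \<rho>} \<subseteq> {s0, - s0 - 2 * (u \<bullet> b)}" by blast
  then show ?thesis by (rule finite_subset) simp
qed simp

context cantor_system
begin

primrec generation :: "nat \<Rightarrow> nat \<Rightarrow> complex set" where
  "generation 0 n = cball 0 1"
| "generation (Suc N) n = (\<Union>c\<in>C n. (\<lambda>w. c + \<tau> n *\<^sub>R w) ` generation N (Suc n))"

lemma compact_generation: "compact (generation N n)"
proof (induction N arbitrary: n)
  case (Suc N)
  have "compact ((\<lambda>w. c + \<tau> n *\<^sub>R w) ` generation N (Suc n))" for c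
    by (intro compact_continuous_image continuous_intros Suc)
  then show ?case using finite_C by (auto intro: compact_UN)
qed simp

lemma stretch_has_vector_derivative:
  assumes "(\<gamma> has_vector_derivative u) (at s)" and nz: "\<gamma> s \<noteq> 0"
  shows "((\<lambda>s. stretch n (\<gamma> s)) has_vector_derivative dstretch n (\<gamma> s) u) (at s)"
proof -
  define N where "N s = norm (\<gamma> s)" for s
  have N: "N s > 0" using nz by (simp add: N_def)
  have "((\<lambda>s. norm (\<gamma> s)) has_derivative (\<lambda>y. (y *\<^sub>R u) \<bullet> sgn (\<gamma> s))) (at s)"
    using has_derivative_compose[OF assms(1)[unfolded has_vector_derivative_def] has_derivative_norm[OF nz]]
    by (simp add: inner_commute)
  then have "(N has_real_derivative (\<gamma> s \<bullet> u) / N s) (at s)"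
    unfolding N_def[abs_def] has_field_derivative_def
    by (rule has_derivative_eq_rhs) (auto simp: sgn_div_norm inner_commute divide_inverse mult_ac)
  then have "((\<lambda>s. (N s / R n) powr (1 / K - 1)) has_real_derivative
       (1 / K - 1) * (N s / R n) powr (1 / K - 1 - 1) * ((\<gamma> s \<bullet> u) / N s / R n)) (at s)"
    using N R_bounds(1)[of n] by (intro DERIV_chain2[OF has_real_derivative_powr DERIV_cdivide]) auto
  from has_vector_derivative_scaleR[OF this assms(1)]
  have "((\<lambda>s. stretch n (\<gamma> s)) has_vector_derivative
     (N s / R n) powr (1 / K - 1) *\<^sub>R u + ((1 / K - 1) * (N s / R n) powr (1 / K - 1 - 1) * ((\<gamma> s \<bullet> u) / N s / R n)) *\<^sub>R \<gamma> s) (at s)"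
    by (simp add: stretch_def[abs_def] N_def)
  moreover have "(1 / K - 1) * (N s / R n) powr (1 / K - 1 - 1) * ((\<gamma> s \<bullet> u) / N s / R n)
      = (N s / R n) powr (1 / K - 1) * ((1 / K - 1) * (\<gamma> s \<bullet> u) / (N s)\<^sup>2)"
  proof -
    have "(N s / R n) powr (1 / K - 1 - 1) = (N s / R n) powr (1 / K - 1) / (N s / R n)"
      by (subst powr_diff) (use N R_bounds(1)[of n] in simp)
    then show ?thesis
      using N R_bounds(1)[of n] unfolding power2_eq_square by (simp only:) (simp add: field_simps)
  qed
  ultimately show ?thesis
    by (simp add: dstretch_def N_def[symmetric] scaleR_add_right mult.assoc)
qed

text \<open>A line that misses generation \<open>N\<close> meets only \<open>N\<close> levels of
  circles before the map is explicit on it. Rescaling an inner disc turns the line into one that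
  misses generation \<open>N - 1\<close> of the next stage; at the bottom it misses the closed unit
  disc, where the map is the identity. Each level adds finitely many exceptional points, the
  intersections with its circles.\<close>

lemma qc_map_line_derivative:
  assumes u: "norm u = 1" and miss: "\<And>s. of_real s * u + a \<notin> generation N n"
  shows "\<exists>F. finite F \<and> (\<forall>s. s \<notin> F \<longrightarrow>
     ((\<lambda>s. qc_map n (of_real s * u + a)) has_vector_derivative grad n (of_real s * u + a) u) (at s))"
  using miss
proof (induction N arbitrary: n a)
  case 0
  then have out: "1 \<le> norm (of_real s * u + a)" for s by (auto simp: not_le intro: less_imp_le)
  then have "qc_map n (of_real s * u + a) = of_real s * u + a" "grad n (of_real s * u + a) u = u" for s
    using disc_map_qc_map[of n] grad_outside by (auto simp: disc_map_def)
  then show ?case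
    by (intro exI[of _ "{}"]) (auto intro!: derivative_eq_intros)
next
  case (Suc N)
  have "\<exists>F. finite F \<and> (\<forall>s. s \<notin> F \<longrightarrow>
     ((\<lambda>s. qc_map (Suc n) (of_real s * u + (a - c) /\<^sub>R \<tau> n)) has_vector_derivative
        grad (Suc n) (of_real s * u + (a - c) /\<^sub>R \<tau> n) u) (at s))" if c: "c \<in> C n" for c
  proof (rule Suc.IH)
    fix s
    have "c + \<tau> n *\<^sub>R (of_real s * u + (a - c) /\<^sub>R \<tau> n) = of_real (\<tau> n * s) * u + a"
      using \<tau>_pos[of n] by (simp add: scaleR_add_right scaleR_conv_of_real algebra_simps)
    moreover have "c + \<tau> n *\<^sub>R w \<in> generation (Suc N) n" if "w \<in> generation N (Suc n)" for w
      using c that by auto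
    ultimately show "of_real s * u + (a - c) /\<^sub>R \<tau> n \<notin> generation N (Suc n)"
      using Suc.prems[of "\<tau> n * s"] by metis
  qed
  then obtain F where F: "\<And>c. c \<in> C n \<Longrightarrow> finite (F c)" and der: "\<And>c s. c \<in> C n \<Longrightarrow> s \<notin> F c \<Longrightarrow>
     ((\<lambda>s. qc_map (Suc n) (of_real s * u + (a - c) /\<^sub>R \<tau> n)) has_vector_derivative
        grad (Suc n) (of_real s * u + (a - c) /\<^sub>R \<tau> n) u) (at s)"
    by metis
  define G where "G = (\<Union>c\<in>C n. (\<lambda>s. \<tau> n * s) ` F c \<union> {s. norm (of_real s * u + (a - c)) = \<tau> n} \<union> {s. norm (of_real s * u + (a - c)) = R n})"
  have "finite G" unfolding G_def using finite_C F finite_line_sphere[OF u] by auto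
  moreover have "((\<lambda>s. qc_map n (of_real s * u + a)) has_vector_derivative grad n (of_real s * u + a) u) (at s)"
    if s: "s \<notin> G" for s
  proof -
    have line: "((\<lambda>s. of_real s * u + b) has_vector_derivative u) (at s)" for b and s :: real
      by (auto intro!: derivative_eq_intros)
    have cell: "((\<lambda>s. cell n (qc_map (Suc n)) (of_real s * u + (a - c))) has_vector_derivative
        dcell n (grad (Suc n)) (of_real s * u + (a - c)) u) (at s)" if c: "c \<in> C n" for c
    proof -
      define \<gamma> where "\<gamma> s = of_real s * u + (a - c)" for s :: real
      have cont: "continuous_on UNIV \<gamma>" unfolding \<gamma>_def[abs_def] by (intro continuous_intros)
      have \<gamma>': "(\<gamma> has_vector_derivative u) (at s)" unfolding \<gamma>_def[abs_def] by (rule line)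
      have ne: "norm (\<gamma> s) \<noteq> \<tau> n" "norm (\<gamma> s) \<noteq> R n" "s \<notin> (\<lambda>s. \<tau> n * s) ` F c"
        using s c by (auto simp: G_def \<gamma>_def)
      consider "norm (\<gamma> s) < \<tau> n" | "\<tau> n < norm (\<gamma> s)" "norm (\<gamma> s) < R n" | "R n < norm (\<gamma> s)"
        using ne by linarith
      then have "((\<lambda>s. cell n (qc_map (Suc n)) (\<gamma> s)) has_vector_derivative dcell n (grad (Suc n)) (\<gamma> s) u) (at s)"
      proof cases
        case 1
        \<comment> \<open>The rescaled line is traversed at parameter \<open>s / \<tau> n\<close>;
          the chain rule factor \<open>1 / \<tau> n\<close> turns \<open>\<sigma> n\<close> into the
          factor of \<open>dcell\<close>.\<close>
        have scale: "of_real (s / \<tau> n) * u + (a - c) /\<^sub>R \<tau> n = \<gamma> s /\<^sub>R \<tau> n" for s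
          by (simp add: \<gamma>_def scaleR_conv_of_real algebra_simps divide_inverse)
        have "s / \<tau> n \<notin> F c"
        proof
          assume "s / \<tau> n \<in> F c"
          then have "\<tau> n * (s / \<tau> n) \<in> (\<lambda>s. \<tau> n * s) ` F c" by (rule imageI)
          then show False using ne(3) \<tau>_pos[of n] by simp
        qed
        from der[OF c this]
        have "((\<lambda>s. qc_map (Suc n) (of_real s * u + (a - c) /\<^sub>R \<tau> n)) has_vector_derivative
           grad (Suc n) (\<gamma> s /\<^sub>R \<tau> n) u) (at (s / \<tau> n))"
          by (simp only: scale)
        moreover have "((\<lambda>s. s / \<tau> n) has_vector_derivative (1 / \<tau> n)) (at s)"
          by (auto intro!: derivative_eq_intros simp: divide_inverse)
        ultimately have "(((\<lambda>s. qc_map (Suc n) (of_real s * u + (a - c) /\<^sub>R \<tau> n)) \<circ> (\<lambda>s. s / \<tau> n))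
            has_vector_derivative (1 / \<tau> n) *\<^sub>R grad (Suc n) (\<gamma> s /\<^sub>R \<tau> n) u) (at s)"
          by (intro vector_diff_chain_at)
        then have "((\<lambda>s. qc_map (Suc n) (\<gamma> s /\<^sub>R \<tau> n)) has_vector_derivative (1 / \<tau> n) *\<^sub>R grad (Suc n) (\<gamma> s /\<^sub>R \<tau> n) u) (at s)"
          unfolding o_def scale .
        then have "((\<lambda>s. \<sigma> n *\<^sub>R qc_map (Suc n) (\<gamma> s /\<^sub>R \<tau> n)) has_vector_derivative \<sigma> n *\<^sub>R (1 / \<tau> n) *\<^sub>R grad (Suc n) (\<gamma> s /\<^sub>R \<tau> n) u) (at s)"
          by (intro bounded_linear.has_vector_derivative[OF bounded_linear_scaleR_right])
        moreover have "dcell n (grad (Suc n)) (\<gamma> s) u = \<sigma> n *\<^sub>R (1 / \<tau> n) *\<^sub>R grad (Suc n) (\<gamma> s /\<^sub>R \<tau> n) u"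
          using 1 by (simp add: dcell_def)
        ultimately have "((\<lambda>s. \<sigma> n *\<^sub>R qc_map (Suc n) (\<gamma> s /\<^sub>R \<tau> n)) has_vector_derivative dcell n (grad (Suc n)) (\<gamma> s) u) (at s)"
          by simp
        then show ?thesis
        proof (rule has_vector_derivative_transform_within_open)
          show "open {s. norm (\<gamma> s) < \<tau> n}" by (intro open_Collect_less continuous_intros cont)
        qed (use 1 in \<open>auto simp: cell_def\<close>)
      next
        case 2
        then have "\<gamma> s \<noteq> 0" using \<tau>_pos[of n] by auto
        from stretch_has_vector_derivative[OF \<gamma>' this, of n]
        have "((\<lambda>s. stretch n (\<gamma> s)) has_vector_derivative dcell n (grad (Suc n)) (\<gamma> s) u) (at s)"
          using 2 by (simp add: dcell_def)
        then show ?thesis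
        proof (rule has_vector_derivative_transform_within_open)
          show "open ({s. norm (\<gamma> s) < R n} \<inter> {s. \<tau> n < norm (\<gamma> s)})"
            by (intro open_Int open_Collect_less continuous_intros cont)
        qed (use 2 in \<open>auto simp: cell_def\<close>)
      next
        case 3
        then have "(\<gamma> has_vector_derivative dcell n (grad (Suc n)) (\<gamma> s) u) (at s)"
          using \<gamma>' by (simp add: dcell_outside)
        then show ?thesis
        proof (rule has_vector_derivative_transform_within_open)
          show "open {s. R n < norm (\<gamma> s)}" by (intro open_Collect_less continuous_intros cont)
        qed (use 3 in \<open>auto simp: cell_outside\<close>)
      qed
      then show ?thesis by (simp add: \<gamma>_def)
    qed
    \<comment> \<open>Map and gradient are finite sums over all discs, so the derivative is taken
      termwise, without asking which disc contains the point.\<close>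
    have "((\<lambda>s. (of_real s * u + a) + (\<Sum>c\<in>C n. cell n (qc_map (Suc n)) (of_real s * u + (a - c)) - (of_real s * u + (a - c))))
       has_vector_derivative u + (\<Sum>c\<in>C n. dcell n (grad (Suc n)) (of_real s * u + (a - c)) u - u)) (at s)"
      by (intro has_vector_derivative_add has_vector_derivative_sum has_vector_derivative_diff line cell)
    then show ?thesis
      by (subst qc_map_unfold, subst grad_unfold) (simp add: insert_map_def dinsert_def add_diff_eq)
  qed
  ultimately show ?case by blast
qed

end

context dense_cantor_system
begin

text \<open>The projection of a generation is a union of \<open>card (C n)\<close> copies, scaled by
  \<open>\<tau> n\<close>, of the projection of the next stage, and \<open>card_\<tau>\<close> makes
  the total length at most half. The start value 2 is the length of [-1, 1].\<close>

lemma projection_generation: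
  fixes p :: "complex \<Rightarrow> real"
  assumes p: "bounded_linear p"  "\<And>z. norm (p z) \<le> norm z"
  shows "emeasure lebesgue (p ` generation N n) \<le> ennreal (2 * (1/2) ^ N)"
proof (induction N arbitrary: n)
  case 0
  have "p ` cball 0 1 \<subseteq> {-1..1}"
  proof
    fix x assume "x \<in> p ` cball 0 1"
    then obtain z where "norm z \<le> 1" "x = p z" by auto
    then show "x \<in> {-1..1}" using p(2)[of z] by (auto simp: abs_le_iff)
  qed
  then have "emeasure lebesgue (p ` cball 0 1) \<le> emeasure lebesgue {-1..1::real}"
    by (intro emeasure_mono) auto
  then show ?case by simp
next
  case (Suc N)
  have lin: "p (c + \<tau> n *\<^sub>R w) = \<tau> n *\<^sub>R p w + p c" for c w
    using p(1) by (simp add: linear_add linear_scale bounded_linear.linear)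
  have img: "p ` generation (Suc N) n = (\<Union>c\<in>C n. (\<lambda>x. \<tau> n *\<^sub>R x + p c) ` (p ` generation N (Suc n)))"
    by (simp add: image_UN image_image lin)
  have cpt: "compact (p ` generation N (Suc n))"
    by (intro compact_continuous_image compact_generation linear_continuous_on p(1))
  have "emeasure lebesgue (p ` generation (Suc N) n)
      \<le> (\<Sum>c\<in>C n. emeasure lebesgue ((\<lambda>x. \<tau> n *\<^sub>R x + p c) ` (p ` generation N (Suc n))))"
    unfolding img using finite_C
  proof (rule emeasure_subadditive_finite, intro image_subsetI)
    fix c
    have "compact ((\<lambda>x. \<tau> n *\<^sub>R x + p c) ` (p ` generation N (Suc n)))"
      by (intro compact_continuous_image cpt continuous_intros)
    then show "(\<lambda>x. \<tau> n *\<^sub>R x + p c) ` (p ` generation N (Suc n)) \<in> sets lebesgue"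
      by (simp add: lmeasurable_compact fmeasurableD)
  qed
  also have "\<dots> = (\<Sum>c\<in>C n. ennreal (\<tau> n) * emeasure lebesgue (p ` generation N (Suc n)))"
  proof (rule sum.cong)
    fix c
    show "emeasure lebesgue ((\<lambda>x. \<tau> n *\<^sub>R x + p c) ` (p ` generation N (Suc n)))
        = ennreal (\<tau> n) * emeasure lebesgue (p ` generation N (Suc n))"
      using emeasure_lebesgue_affine[of "\<tau> n" "p c" "p ` generation N (Suc n)"] \<tau>_pos[of n] by (simp add: add.commute)
  qed simp
  also have "\<dots> \<le> (\<Sum>c\<in>C n. ennreal (\<tau> n) * ennreal (2 * (1/2) ^ N))"
    by (intro sum_mono mult_left_mono Suc) auto
  also have "\<dots> = ennreal ((real (card (C n)) * \<tau> n) * (2 * (1/2) ^ N))"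
    using \<tau>_pos[of n] by (simp add: ennreal_mult[symmetric] ennreal_of_nat_eq_real_of_nat mult.assoc)
  also have "\<dots> \<le> ennreal (1/2 * (2 * (1/2) ^ N))"
    by (intro ennreal_leI mult_right_mono card_\<tau>) auto
  finally show ?case by simp
qed

lemma AE_line_misses_generation:
  fixes p :: "complex \<Rightarrow> real"
  assumes "bounded_linear p"  "\<And>z. norm (p z) \<le> norm z"
  shows "AE t in lborel. \<exists>N. t \<notin> p ` generation N n"
proof -
  have meas: "p ` generation N n \<in> sets borel" for N
    by (intro borel_compact compact_continuous_image compact_generation linear_continuous_on assms(1))
  have null: "(\<Inter>N. p ` generation N n) \<in> null_sets lborel"
  proof (rule null_setsI)
    show "(\<Inter>N. p ` generation N n) \<in> sets lborel" using meas by auto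
    have "emeasure lborel (\<Inter>N. p ` generation N n) \<le> ennreal (2 * (1/2) ^ N)" for N
    proof -
      have "emeasure lborel (\<Inter>N. p ` generation N n) \<le> emeasure lborel (p ` generation N n)"
        using meas by (intro emeasure_mono) auto
      also have "\<dots> = emeasure lebesgue (p ` generation N n)" using meas by simp
      finally show ?thesis using projection_generation[OF assms, of N n] by simp
    qed
    moreover have "(\<lambda>N. ennreal (2 * (1/2) ^ N)) \<longlonglongrightarrow> ennreal 0"
      by (intro tendsto_ennrealI tendsto_mult_right_zero LIMSEQ_realpow_zero) auto
    ultimately have "emeasure lborel (\<Inter>N. p ` generation N n) \<le> ennreal 0"
      by (intro LIMSEQ_le_const[of _ "ennreal 0"]) auto
    then show "emeasure lborel (\<Inter>N. p ` generation N n) = 0" by simp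
  qed
  show ?thesis
    using AE_not_in[OF null] by eventually_elim auto
qed

theorem quasiconformal_qc_map: "quasiconformal K (qc_map n)"
proof -
  have q: "continuous_on UNIV (qc_map n)" "\<And>z. 1 \<le> norm z \<Longrightarrow> qc_map n z = z"
    using disc_map_qc_map[of n] by (auto simp: disc_map_def)
  have parts: "(\<integral>z. frechet_derivative \<psi> (at z) u *\<^sub>R qc_map n z \<partial>lebesgue) = - (\<integral>z. \<psi> z *\<^sub>R grad n z u \<partial>lebesgue)"
    if \<psi>: "test_function \<psi>" and uv: "(u, v) \<in> {(1, \<i>), (\<i>, 1)}" and p: "bounded_linear p" "\<And>z. norm (p z) \<le> norm z"
      "\<And>s t. p (of_real s * u + of_real t * v) = t" for \<psi> u v and p :: "complex \<Rightarrow> real"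
  proof (rule integration_by_parts_along_lines[OF \<psi> uv q(1)])
    have u: "norm u = 1" using uv by auto
    show "set_integrable lborel (cball 0 r) (\<lambda>z. grad n z u)" for r
      using u by (intro grad_integrable) auto
    show "AE t in lborel. \<exists>F. finite F \<and> (\<forall>s. s \<notin> F \<longrightarrow>
       ((\<lambda>s. qc_map n (of_real s * u + of_real t * v)) has_vector_derivative grad n (of_real s * u + of_real t * v) u) (at s))"
      using AE_line_misses_generation[OF p(1,2), of n]
    proof eventually_elim
      case (elim t)
      then obtain N where "t \<notin> p ` generation N n" by blast
      then have "of_real s * u + of_real t * v \<notin> generation N n" for s
        using p(3)[of s t] by (metis imageI)
      then show ?case by (rule qc_map_line_derivative[OF u])
    qed
  qed simp
  have W: "W12_loc_gradient (qc_map n) (\<lambda>z. grad n z 1) (\<lambda>z. grad n z \<i>)"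
    unfolding W12_loc_gradient_def weak_partials_def
    \<comment> \<open>Lines in direction 1 are labelled by their imaginary part, lines in direction
      \<i> by their real part.\<close>
    using parts[where u = 1 and v = \<i> and p = Im] parts[where u = \<i> and v = 1 and p = Re]
    by (auto simp: L2_loc_continuous[OF q(1)] L2_loc_grad bounded_linear_Re bounded_linear_Im abs_Re_le_cmod abs_Im_le_cmod)
  have D: "AE z in lebesgue. (SUP \<alpha>::real. cmod (cos \<alpha> *\<^sub>R grad n z 1 + sin \<alpha> *\<^sub>R grad n z \<i>))
          \<le> K * (INF \<alpha>::real. cmod (cos \<alpha> *\<^sub>R grad n z 1 + sin \<alpha> *\<^sub>R grad n z \<i>))"
    by (intro AE_I2 bounded_distortion_SUP_INF bounded_distortion_grad)
  from W D show ?thesis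
    unfolding quasiconformal_def
    using fixes_outside_disc_homeomorphism[OF q(1) inj_qc_map q(2)]
      fixes_outside_disc_orientation_preserving[OF q(1) inj_qc_map q(2)] by blast
qed

end

section \<open>The uniform measure on the Cantor set\<close>

text \<open>Splitting off the first coordinate of an infinite product whose factors may vary with
  the index. A product measure is determined by its cylinders, and the preimage of a cylinder is a
  rectangle: first factor times a cylinder of the shifted product.\<close>

lemma PiM_case_nat:
  fixes M :: "nat \<Rightarrow> 'a measure"
  assumes M: "\<And>i. prob_space (M i)"
  shows "case_prod case_nat \<in> measurable (M 0 \<Otimes>\<^sub>M PiM UNIV (\<lambda>k. M (Suc k))) (PiM UNIV M)" (is ?meas)
    and "distr (M 0 \<Otimes>\<^sub>M PiM UNIV (\<lambda>k. M (Suc k))) (PiM UNIV M) (case_prod case_nat) = PiM UNIV M" (is "?D = _")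
proof -
  let ?S = "PiM UNIV (\<lambda>k. M (Suc k))"
  have "(\<lambda>x i. case_nat (fst x) (snd x) i) \<in> measurable (M 0 \<Otimes>\<^sub>M ?S) (PiM UNIV M)"
  proof (rule measurable_PiM_single')
    show "(\<lambda>x. case_nat (fst x) (snd x) i) \<in> measurable (M 0 \<Otimes>\<^sub>M ?S) (M i)" for i
    proof (cases i)
      case (Suc k)
      then show ?thesis
        by (auto intro!: measurable_compose[OF measurable_snd measurable_component_singleton])
    qed auto
    show "(\<lambda>x i. case_nat (fst x) (snd x) i) \<in> space (M 0 \<Otimes>\<^sub>M ?S) \<rightarrow> (\<Pi>\<^sub>E i\<in>UNIV. space (M i))"
      by (auto simp: space_pair_measure space_PiM PiE_iff split: nat.split)
  qed
  then show m: ?meas by (simp add: case_prod_unfold)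
  interpret product_prob_space M UNIV
    by (intro product_prob_spaceI M)
  interpret S: product_prob_space "\<lambda>k. M (Suc k)" UNIV
    by (intro product_prob_spaceI M)
  show "?D = PiM UNIV M"
  proof (rule PiM_eq)
    fix J E assume J: "finite J" "J \<subseteq> UNIV" "\<And>j. j \<in> J \<Longrightarrow> E j \<in> sets (M j)"
    let ?X = "prod_emb UNIV M J (\<Pi>\<^sub>E j\<in>J. E j)"
    have "\<And>j x. j \<in> J \<Longrightarrow> x \<in> E j \<Longrightarrow> x \<in> space (M j)"
      using J(3)[THEN sets.sets_into_space] by (auto simp: subset_eq)
    with J have eq: "case_prod case_nat -` ?X \<inter> space (M 0 \<Otimes>\<^sub>M ?S) = (if 0 \<in> J then E 0 else space (M 0)) \<times>
      (prod_emb UNIV (\<lambda>k. M (Suc k)) (Suc -` J) (\<Pi>\<^sub>E j\<in>Suc -` J. E (Suc j)))" (is "_ = ?E \<times> ?F")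
      by (auto simp: space_pair_measure space_PiM PiE_iff prod_emb_def all_conj_distrib
         split: nat.split nat.split_asm)
    have "emeasure ?D ?X = emeasure (M 0 \<Otimes>\<^sub>M ?S) (?E \<times> ?F)"
      using J by (subst emeasure_distr[OF m]) (auto intro!: sets_PiM_I simp: eq)
    also have "\<dots> = emeasure (M 0) ?E * emeasure ?S ?F"
      using J by (intro S.P.emeasure_pair_measure_Times) (auto intro!: sets_PiM_I finite_vimageI)
    also have "emeasure ?S ?F = (\<Prod>j\<in>Suc -` J. emeasure (M (Suc j)) (E (Suc j)))"
      using J by (intro S.emeasure_PiM_emb) (simp_all add: finite_vimageI)
    also have "\<dots> = (\<Prod>j\<in>J - {0}. emeasure (M j) (E j))"
    proof (rule prod.reindex_cong[of Suc, symmetric])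
      have "\<exists>m. Suc m \<in> J \<and> j = Suc m" if "j \<in> J" "j \<noteq> 0" for j
        using that by (cases j) auto
      then show "J - {0} = Suc ` (Suc -` J)" by (auto simp: image_iff)
    qed auto
    also have "emeasure (M 0) ?E * (\<Prod>j\<in>J - {0}. emeasure (M j) (E j)) = (\<Prod>j\<in>J. emeasure (M j) (E j))"
      using J by (auto simp: M.emeasure_space_1 prod.remove)
    finally show "emeasure ?D ?X = (\<Prod>j\<in>J. emeasure (M j) (E j))" .
  qed simp
qed

context cantor_system
begin

text \<open>Independent uniform choices of one centre per stage, starting with stage
  \<open>n\<close>. Pushed forward by \<open>point\<close> below, this is the uniform measure on the
  Cantor set; working on the code space serves E and its image with the same measure.\<close>

definition digits :: "nat \<Rightarrow> (nat \<Rightarrow> complex) measure" where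
  "digits n = PiM UNIV (\<lambda>k. uniform_count_measure (C (n + k)))"

lemma prob_space_uniform_C: "prob_space (uniform_count_measure (C n))"
  by (intro prob_space_uniform_count_measure finite_C C_nonempty)

lemma prob_space_digits: "prob_space (digits n)"
  unfolding digits_def by (intro prob_space_PiM prob_space_uniform_C)

lemma space_digits: "space (digits n) = {\<omega>. \<forall>k. \<omega> k \<in> C (n + k)}"
  by (auto simp: digits_def space_PiM space_uniform_count_measure PiE_iff)

lemma measurable_digit [measurable]: "(\<lambda>\<omega>. \<omega> k) \<in> borel_measurable (digits n)"
proof (rule measurable_compose)
  show "(\<lambda>\<omega>. \<omega> k) \<in> measurable (digits n) (uniform_count_measure (C (n + k)))"
    unfolding digits_def by (rule measurable_component_singleton) simp
  show "(\<lambda>x. x) \<in> borel_measurable (uniform_count_measure (C (n + k)))"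
    by (simp add: measurable_def space_uniform_count_measure sets_uniform_count_measure)
qed

text \<open>Conditioning on the first digit; every recursion for a potential rests on this.\<close>

lemma nn_integral_digits_unfold:
  assumes f: "f \<in> borel_measurable (digits n)"
  shows "(\<integral>\<^sup>+\<omega>. f \<omega> \<partial>digits n) = (\<Sum>c\<in>C n. ennreal (1 / card (C n)) * (\<integral>\<^sup>+\<omega>. f (case_nat c \<omega>) \<partial>digits (Suc n)))"
proof -
  note PM = PiM_case_nat[of "\<lambda>k. uniform_count_measure (C (n + k))", OF prob_space_uniform_C, simplified]
  interpret S: prob_space "digits (Suc n)" by (rule prob_space_digits)
  have m: "case_prod case_nat \<in> measurable (uniform_count_measure (C n) \<Otimes>\<^sub>M digits (Suc n)) (digits n)"
    and d: "digits n = distr (uniform_count_measure (C n) \<Otimes>\<^sub>M digits (Suc n)) (digits n) (case_prod case_nat)"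
    using PM by (simp_all add: digits_def)
  have "(\<integral>\<^sup>+\<omega>. f \<omega> \<partial>digits n) = (\<integral>\<^sup>+x. f (case_prod case_nat x) \<partial>(uniform_count_measure (C n) \<Otimes>\<^sub>M digits (Suc n)))"
    by (subst d) (rule nn_integral_distr[OF m], simp add: f)
  also have "\<dots> = (\<integral>\<^sup>+c. (\<integral>\<^sup>+\<omega>. f (case_nat c \<omega>) \<partial>digits (Suc n)) \<partial>uniform_count_measure (C n))"
    using S.nn_integral_fst[OF measurable_compose[OF m f]] by simp
  also have "\<dots> = (\<Sum>c\<in>C n. ennreal (1 / card (C n)) * (\<integral>\<^sup>+\<omega>. f (case_nat c \<omega>) \<partial>digits (Suc n)))"
    unfolding uniform_count_measure_def by (simp add: nn_integral_point_measure_finite finite_C)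
  finally show ?thesis .
qed

end

text \<open>The scale \<open>l\<close> will be \<open>\<tau>\<close> for the set E and
  \<open>\<sigma>\<close> for its image, so that the potential estimates are made once for both. The
  condition \<open>2 * l n \<le> R n\<close> puts a point outside a disc of radius
  \<open>R n\<close> at distance at least 2 from its centre after rescaling.\<close>

locale cantor_scale = dense_cantor_system +
  fixes l :: "nat \<Rightarrow> real"
  assumes l_pos: "0 < l n" and l_le_half: "2 * l n \<le> R n"
begin

definition rad :: "nat \<Rightarrow> nat \<Rightarrow> real" where
  "rad N n = (\<Prod>j<N. l (n + j))"

definition point :: "nat \<Rightarrow> (nat \<Rightarrow> complex) \<Rightarrow> complex" where
  "point n \<omega> = (\<Sum>k. rad k n *\<^sub>R \<omega> k)"

lemma rad_0 [simp]: "rad 0 n = 1"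
  by (simp add: rad_def)

lemma rad_Suc: "rad (Suc N) n = l n * rad N (Suc n)"
  unfolding rad_def prod.lessThan_Suc_shift by simp

lemma rad_pos: "0 < rad N n"
  by (simp add: rad_def prod_pos l_pos)

lemma l_le_quarter: "l n \<le> 1/4"
  using l_le_half[of n] R_bounds(2)[of n] by linarith

lemma rad_le: "rad N n \<le> (1/4) ^ N"
proof (induction N arbitrary: n)
  case (Suc N)
  have "l n * rad N (Suc n) \<le> 1/4 * (1/4) ^ N"
    using Suc[of "Suc n"] l_le_quarter[of n] l_pos[of n] rad_pos[of N "Suc n"] by (intro mult_mono) auto
  then show ?case by (simp add: rad_Suc)
qed simp

lemma rad_tendsto_0: "(\<lambda>N. rad N n) \<longlonglongrightarrow> 0"
  by (rule tendsto_sandwich[of "\<lambda>_. 0" _ _ "\<lambda>N. (1/4) ^ N"])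
     (auto simp: rad_le intro!: always_eventually less_imp_le[OF rad_pos] LIMSEQ_realpow_zero)

text \<open>The constants are matched: the series of the bounds (1/4)^k * (3/4) sums to 1, which
  keeps every coded point in the closed unit disc.\<close>

lemma norm_digit_le:
  assumes "\<omega> \<in> space (digits n)"
  shows "norm (rad k n *\<^sub>R \<omega> k) \<le> (1/4) ^ k * (3/4)"
proof -
  have "norm (\<omega> k) \<le> 3/4" using assms C_norm[of "\<omega> k" "n + k"] by (auto simp: space_digits)
  then have "rad k n * norm (\<omega> k) \<le> (1/4) ^ k * (3/4)"
    using rad_pos[of k n] rad_le[of k n] by (intro mult_mono) auto
  then show ?thesis using rad_pos[of k n] by simp
qed

lemma summable_digits:
  assumes "\<omega> \<in> space (digits n)"
  shows "summable (\<lambda>k. rad k n *\<^sub>R \<omega> k)" "norm (point n \<omega>) \<le> 1"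
proof -
  have s: "summable (\<lambda>k. (1/4) ^ k * (3/4) :: real)"
    by (intro summable_mult2 summable_geometric) auto
  show "summable (\<lambda>k. rad k n *\<^sub>R \<omega> k)"
    by (rule summable_comparison_test'[OF s]) (rule norm_digit_le[OF assms])
  have "norm (point n \<omega>) \<le> (\<Sum>k. (1/4) ^ k * (3/4))"
    unfolding point_def by (rule norm_suminf_le[OF norm_digit_le[OF assms] s])
  also have "\<dots> = 1" by (subst suminf_mult2[symmetric]) (auto simp: suminf_geometric)
  finally show "norm (point n \<omega>) \<le> 1" .
qed

lemma space_digits_prepend:
  assumes "c \<in> C n" "\<omega> \<in> space (digits (Suc n))"
  shows "case_nat c \<omega> \<in> space (digits n)"
  using assms by (auto simp: space_digits split: nat.split)

lemma point_prepend:
  assumes "c \<in> C n" "\<omega> \<in> space (digits (Suc n))"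
  shows "point n (case_nat c \<omega>) = c + l n *\<^sub>R point (Suc n) \<omega>"
proof -
  have s: "summable (\<lambda>k. rad k n *\<^sub>R case_nat c \<omega> k)"
    using space_digits_prepend[OF assms] by (rule summable_digits)
  have "point n (case_nat c \<omega>) = c + (\<Sum>k. rad (Suc k) n *\<^sub>R \<omega> k)"
    using suminf_split_head[OF s] by (simp add: point_def algebra_simps)
  also have "(\<Sum>k. rad (Suc k) n *\<^sub>R \<omega> k) = (\<Sum>k. l n *\<^sub>R rad k (Suc n) *\<^sub>R \<omega> k)"
    by (simp add: rad_Suc)
  also have "\<dots> = l n *\<^sub>R point (Suc n) \<omega>"
    unfolding point_def by (rule suminf_scaleR_right[OF summable_digits(1)[OF assms(2)], symmetric])
  finally show ?thesis .
qed

lemma point_unfold: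
  assumes "\<omega> \<in> space (digits n)"
  obtains c \<omega>' where "c \<in> C n" "\<omega>' \<in> space (digits (Suc n))" "\<omega> = case_nat c \<omega>'"
    "point n \<omega> = c + l n *\<^sub>R point (Suc n) \<omega>'"
proof
  have sp: "\<And>k. \<omega> k \<in> C (n + k)" using assms by (simp add: space_digits)
  show c: "\<omega> 0 \<in> C n" using sp[of 0] by simp
  show o: "(\<lambda>k. \<omega> (Suc k)) \<in> space (digits (Suc n))" using sp[of "Suc _"] by (simp add: space_digits)
  show eq: "\<omega> = case_nat (\<omega> 0) (\<lambda>k. \<omega> (Suc k))" by (auto split: nat.split)
  show "point n \<omega> = \<omega> 0 + l n *\<^sub>R point (Suc n) (\<lambda>k. \<omega> (Suc k))"
    using point_prepend[OF c o] eq by metis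
qed

lemma measurable_point [measurable]: "point n \<in> borel_measurable (digits n)"
proof -
  have "(\<lambda>\<omega>. \<Sum>k. rad k n *\<^sub>R \<omega> k) \<in> borel_measurable (digits n)"
    by (rule borel_measurable_suminf) measurable
  then show ?thesis by (simp add: point_def[abs_def])
qed

end

section \<open>Potentials\<close>

context dense_cantor_system
begin

text \<open>For \<open>norm (x - c) \<ge> R n\<close> the summand is at most \<open>2 powr a\<close> times the mean of
  \<open>norm (x - w) powr - a\<close> over the disc \<open>ball c (R n)\<close>, and these discs are disjoint.\<close>

lemma far_centres_sum_bounded:
  assumes a: "0 \<le> a" "a < 2"
  shows "\<exists>G\<ge>0. \<forall>n x. (\<Sum>c\<in>{c\<in>C n. R n \<le> norm (x - c)}. 1 / card (C n) * norm (x - c) powr - a) \<le> G"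
proof -
  define g where "g x = ennreal (norm x powr - a) * indicator (ball 0 1) x" for x :: complex
  have gm[measurable]: "g \<in> borel_measurable borel"
    unfolding g_def[abs_def] by (intro borel_measurable_times_ennreal borel_measurable_indicator) auto
  have "(\<integral>\<^sup>+x. g x \<partial>lborel) < \<infinity>"
    unfolding g_def using a by (intro nn_integral_powr_ball_finite) auto
  then obtain j where j: "0 \<le> j" "(\<integral>\<^sup>+x. g x \<partial>lborel) = ennreal j"
    by (cases "\<integral>\<^sup>+x. g x \<partial>lborel") auto
  define G where "G = 2 powr a * (4 * (pi + j) / pi)"
  have "(\<Sum>c\<in>{c\<in>C n. R n \<le> norm (x - c)}. 1 / card (C n) * norm (x - c) powr - a) \<le> G" for n x
  proof -
    define F where "F = {c\<in>C n. R n \<le> norm (x - c)}"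
    have finF: "finite F" unfolding F_def using finite_C by simp
    have R: "0 < R n" by (rule R_bounds)
    have im[measurable]: "(indicator (ball c r) :: complex \<Rightarrow> ennreal) \<in> borel_measurable borel" for c and r :: real
      by (intro borel_measurable_indicator) auto
    have "(\<Sum>c\<in>F. ennreal (norm (x - c) powr - a) * ennreal (pi * (R n)\<^sup>2))
        = (\<integral>\<^sup>+w. (\<Sum>c\<in>F. ennreal (norm (x - c) powr - a) * indicator (ball c (R n)) w) \<partial>lborel)"
      using R by (subst nn_integral_sum) (auto simp: nn_integral_cmult_indicator emeasure_ball_complex)
    \<comment> \<open>The discs lie in the unit disc. There the kernel is at most 1 at distance at
      least 1 from \<open>x\<close>, and is \<open>g\<close> nearer to \<open>x\<close>. Dividing by
      1 gives the translate the form of \<open>nn_integral_lborel_rescale\<close>.\<close>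
    also have "\<dots> \<le> (\<integral>\<^sup>+w. ennreal (2 powr a) * (indicator (ball 0 1) w + g ((w - x) /\<^sub>R 1)) \<partial>lborel)"
    proof (rule nn_integral_mono)
      fix w
      show "(\<Sum>c\<in>F. ennreal (norm (x - c) powr - a) * indicator (ball c (R n)) w) \<le> ennreal (2 powr a) * (indicator (ball 0 1) w + g ((w - x) /\<^sub>R 1))"
      proof (cases "\<exists>c\<in>F. norm (w - c) < R n")
        case True
        then obtain c where c: "c \<in> F" "norm (w - c) < R n" by blast
        have cC: "c \<in> C n" "R n \<le> norm (x - c)" using c by (auto simp: F_def)
        have "(\<Sum>c\<in>F. ennreal (norm (x - c) powr - a) * indicator (ball c (R n)) w)
            = (\<Sum>c\<in>{c}. ennreal (norm (x - c) powr - a) * indicator (ball c (R n)) w)"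
        proof (rule sum.mono_neutral_right)
          show "\<forall>i\<in>F - {c}. ennreal (norm (x - i) powr - a) * indicator (ball i (R n)) w = 0"
          proof
            fix i assume "i \<in> F - {c}"
            then have "\<not> norm (w - i) < R n" using near_unique[of c n i w] cC c by (auto simp: F_def)
            then show "ennreal (norm (x - i) powr - a) * indicator (ball i (R n)) w = 0"
              by (simp add: dist_norm norm_minus_commute)
          qed
        qed (use c finF in auto)
        also have "\<dots> = ennreal (norm (x - c) powr - a)"
          using c by (simp add: dist_norm norm_minus_commute)
        also have "\<dots> \<le> ennreal (2 powr a * norm (w - x) powr - a)"
        proof (rule ennreal_leI)
          have tri: "norm (x - w) \<le> norm (x - c) + norm (w - c)"
            using norm_triangle_ineq4[of "x - c" "w - c"] by simp
          have le: "norm (w - x) \<le> 2 * norm (x - c)"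
            using tri c cC by (simp add: norm_minus_commute)
          have "norm (x - c) \<le> norm (w - x) + norm (w - c)"
            using norm_triangle_ineq4[of "w - c" "w - x"] by simp
          then have pos: "0 < norm (w - x)" using c cC by linarith
          have pc: "0 < norm (x - c)" using cC R by linarith
          have "(2 * norm (x - c)) powr - a \<le> norm (w - x) powr - a"
            using le pos a by (intro powr_mono2') auto
          then have "2 powr a * (2 powr - a * norm (x - c) powr - a) \<le> 2 powr a * norm (w - x) powr - a"
            by (intro mult_left_mono) (auto simp: powr_mult)
          also have "2 powr a * (2 powr - a * norm (x - c) powr - a) = norm (x - c) powr - a"
            by (simp add: powr_minus)
          finally show "norm (x - c) powr - a \<le> 2 powr a * norm (w - x) powr - a" .
        qed
        also have "\<dots> = ennreal (2 powr a) * ennreal (norm (w - x) powr - a)" by (simp add: ennreal_mult)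
        also have "\<dots> \<le> ennreal (2 powr a) * (indicator (ball 0 1) w + g ((w - x) /\<^sub>R 1))"
        proof (rule mult_left_mono)
          have "norm w \<le> norm (w - c) + norm c" using norm_triangle_ineq[of "w - c" c] by simp
          then have w: "norm w < 1" using C_inside[OF cC(1)] c by linarith
          show "ennreal (norm (w - x) powr - a) \<le> indicator (ball 0 1) w + g ((w - x) /\<^sub>R 1)"
          proof (cases "norm (w - x) < 1")
            case True
            then show ?thesis by (auto simp: g_def intro: add_increasing)
          next
            case False
            then have "norm (w - x) powr - a \<le> 1 powr - a"
              using a by (intro powr_mono2') auto
            then have "ennreal (norm (w - x) powr - a) \<le> 1" by simp
            then show ?thesis using w by (auto intro: add_increasing2)
          qed
        qed simp
        finally show ?thesis .
      next
        case False
        then have "(\<Sum>c\<in>F. ennreal (norm (x - c) powr - a) * indicator (ball c (R n)) w) = 0"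
          by (intro sum.neutral) (auto simp: dist_norm norm_minus_commute indicator_def)
        then show ?thesis by simp
      qed
    qed
    also have "\<dots> = ennreal (2 powr a) * (ennreal pi + ennreal j)"
      using nn_integral_lborel_rescale[OF gm, of 1 x] j
      by (subst nn_integral_cmult, simp, subst nn_integral_add) (auto simp: emeasure_ball_complex)
    also have "\<dots> = ennreal (2 powr a * (pi + j))"
      using j by (simp add: ennreal_mult flip: ennreal_plus)
    finally have "ennreal (\<Sum>c\<in>F. norm (x - c) powr - a * (pi * (R n)\<^sup>2)) \<le> ennreal (2 powr a * (pi + j))"
      by (simp add: ennreal_mult[symmetric] sum_ennreal)
    then have "(\<Sum>c\<in>F. norm (x - c) powr - a * (pi * (R n)\<^sup>2)) \<le> 2 powr a * (pi + j)"
      using j by (simp add: ennreal_le_iff)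
    then have le: "(\<Sum>c\<in>F. norm (x - c) powr - a) * (pi * (R n)\<^sup>2) \<le> 2 powr a * (pi + j)"
      by (simp add: sum_distrib_right)
    \<comment> \<open>The uniform weights are, up to the factor 4 / pi, the areas of the
      discs.\<close>
    have M: "1 / real (card (C n)) = 4 * (R n)\<^sup>2"
      using card_R[of n] by (cases "card (C n) = 0") (simp_all add: field_simps)
    have "(\<Sum>c\<in>F. 1 / card (C n) * norm (x - c) powr - a) = 4 / pi * ((\<Sum>c\<in>F. norm (x - c) powr - a) * (pi * (R n)\<^sup>2))"
      unfolding M by (simp add: sum_distrib_left[symmetric])
    also have "\<dots> \<le> 4 / pi * (2 powr a * (pi + j))"
      using le by (intro mult_left_mono) auto
    also have "\<dots> = G" by (simp add: G_def)
    finally show ?thesis unfolding F_def .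
  qed
  moreover have "0 \<le> G" using j by (simp add: G_def)
  ultimately show ?thesis by blast
qed

end

context cantor_scale
begin

abbreviation weight :: "real \<Rightarrow> nat \<Rightarrow> real" where
  "weight a n \<equiv> 1 / real (card (C n)) * l n powr - a"

abbreviation kernel :: "real \<Rightarrow> real \<Rightarrow> nat \<Rightarrow> complex \<Rightarrow> (nat \<Rightarrow> complex) \<Rightarrow> ennreal" where
  "kernel a r n x \<omega> \<equiv> ennreal (max r (norm (x - point n \<omega>)) powr - a)"

text \<open>Truncating the kernel at the radius of the \<open>N\<close>-th generation keeps the potential finite and makes it
  exactly self-similar.\<close>

definition pot :: "real \<Rightarrow> nat \<Rightarrow> nat \<Rightarrow> complex \<Rightarrow> ennreal" where
  "pot a N n x = (\<integral>\<^sup>+\<omega>. kernel a (rad N n) n x \<omega> \<partial>digits n)"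

abbreviation near_pot :: "real \<Rightarrow> nat \<Rightarrow> nat \<Rightarrow> complex \<Rightarrow> ennreal" where
  "near_pot a N n x \<equiv> \<Sum>c\<in>C n. ennreal (weight a n) * (pot a N (Suc n) ((x - c) /\<^sub>R l n) * indicator (ball c (R n)) x)"

lemma measurable_kernel:
  "(\<lambda>\<omega>. kernel a r n x \<omega>) \<in> borel_measurable (digits n)"
  by measurable

lemma measurable_pot [measurable]: "pot a N n \<in> borel_measurable borel"
proof -
  interpret prob_space "digits n" by (rule prob_space_digits)
  show ?thesis unfolding pot_def[abs_def] by measurable
qed

lemma pot_unfold:
  assumes "0 \<le> a"
  shows "pot a (Suc N) n x = (\<Sum>c\<in>C n. ennreal (weight a n) * pot a N (Suc n) ((x - c) /\<^sub>R l n))"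
  unfolding pot_def
proof (subst nn_integral_digits_unfold[OF measurable_kernel], rule sum.cong[OF refl])
  fix c assume c: "c \<in> C n"
  have "(\<integral>\<^sup>+\<omega>. kernel a (rad (Suc N) n) n x (case_nat c \<omega>) \<partial>digits (Suc n))
      = (\<integral>\<^sup>+\<omega>. ennreal (l n powr - a) * kernel a (rad N (Suc n)) (Suc n) ((x - c) /\<^sub>R l n) \<omega> \<partial>digits (Suc n))"
  proof (rule nn_integral_cong)
    fix \<omega> assume w: "\<omega> \<in> space (digits (Suc n))"
    have "x - point n (case_nat c \<omega>) = l n *\<^sub>R ((x - c) /\<^sub>R l n - point (Suc n) \<omega>)"
      using l_pos[of n] by (simp add: point_prepend[OF c w] scaleR_diff_right)
    then have "max (rad (Suc N) n) (norm (x - point n (case_nat c \<omega>))) = l n * max (rad N (Suc n)) (norm ((x - c) /\<^sub>R l n - point (Suc n) \<omega>))"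
      using l_pos[of n] by (simp add: rad_Suc max_mult_distrib_left)
    then show "kernel a (rad (Suc N) n) n x (case_nat c \<omega>)
        = ennreal (l n powr - a) * kernel a (rad N (Suc n)) (Suc n) ((x - c) /\<^sub>R l n) \<omega>"
      using l_pos[of n] by (simp add: powr_mult ennreal_mult)
  qed
  also have "\<dots> = ennreal (l n powr - a) * (\<integral>\<^sup>+\<omega>. kernel a (rad N (Suc n)) (Suc n) ((x - c) /\<^sub>R l n) \<omega> \<partial>digits (Suc n))"
    by (rule nn_integral_cmult[OF measurable_kernel])
  finally have eq: "(\<integral>\<^sup>+\<omega>. kernel a (rad (Suc N) n) n x (case_nat c \<omega>) \<partial>digits (Suc n))
      = ennreal (l n powr - a) * (\<integral>\<^sup>+\<omega>. kernel a (rad N (Suc n)) (Suc n) ((x - c) /\<^sub>R l n) \<omega> \<partial>digits (Suc n))" .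
  show "ennreal (1 / card (C n)) * (\<integral>\<^sup>+\<omega>. kernel a (rad (Suc N) n) n x (case_nat c \<omega>) \<partial>digits (Suc n))
    = ennreal (weight a n) * (\<integral>\<^sup>+\<omega>. kernel a (rad N (Suc n)) (Suc n) ((x - c) /\<^sub>R l n) \<omega> \<partial>digits (Suc n))"
  proof -
    have "ennreal (weight a n) = ennreal (1 / card (C n)) * ennreal (l n powr - a)"
      by (rule ennreal_mult) auto
    then show ?thesis
      by (simp only: eq mult.assoc)
  qed
qed

lemma pot_le:
  assumes "\<And>\<omega>. \<omega> \<in> space (digits n) \<Longrightarrow> max (rad N n) (norm (x - point n \<omega>)) powr - a \<le> B"
  shows "pot a N n x \<le> ennreal B"
proof -
  interpret prob_space "digits n" by (rule prob_space_digits)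
  have "pot a N n x \<le> (\<integral>\<^sup>+\<omega>. ennreal B \<partial>digits n)"
    unfolding pot_def using assms by (intro nn_integral_mono ennreal_leI) auto
  then show ?thesis by (simp add: emeasure_space_1)
qed

lemma pot_far:
  assumes "0 \<le> a" "2 \<le> norm x"
  shows "pot a N n x \<le> ennreal (2 powr a * norm x powr - a)"
proof (rule pot_le)
  fix \<omega> assume "\<omega> \<in> space (digits n)"
  then have "norm (point n \<omega>) \<le> 1" by (rule summable_digits)
  then have "norm x / 2 \<le> norm (x - point n \<omega>)"
    using assms(2) norm_triangle_ineq2[of x "point n \<omega>"] by linarith
  then have "norm x / 2 \<le> max (rad N n) (norm (x - point n \<omega>))" by (rule max.coboundedI2)
  then have "max (rad N n) (norm (x - point n \<omega>)) powr - a \<le> (norm x / 2) powr - a"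
    using assms by (intro powr_mono2') linarith+
  also have "\<dots> = 2 powr a * norm x powr - a"
  proof -
    have "(norm x / 2) powr - a = norm x powr - a / 2 powr - a"
      by (rule powr_divide)
    also have "\<dots> = 2 powr a * norm x powr - a"
      by (simp add: powr_minus divide_inverse)
    finally show ?thesis .
  qed
  finally show "max (rad N n) (norm (x - point n \<omega>)) powr - a \<le> 2 powr a * norm x powr - a" .
qed

lemma pot_0_le_1: "0 \<le> a \<Longrightarrow> pot a 0 n x \<le> 1"
proof -
  assume "0 \<le> a"
  then have "max 1 y powr - a \<le> 1" for y :: real
    using powr_mono2'[of "-a" 1 "max 1 y"] by simp
  then show ?thesis using pot_le[of n 0 x a 1] by simp
qed

text \<open>Seen from a disc that does not contain \<open>x\<close>, the rescaled point has modulus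
  at least 2, so \<open>pot_far\<close> compares its contribution with that of a point mass at the
  centre, and \<open>far_centres_sum_bounded\<close> adds these up to a constant. What remains is at
  most one term, from the disc around \<open>x\<close>.\<close>

lemma pot_step:
  assumes "0 \<le> a" "a < 2"
  shows "\<exists>G\<ge>0. \<forall>N n x. pot a (Suc N) n x \<le> ennreal G + near_pot a N n x"
proof -
  obtain G where G: "G \<ge> 0" "\<And>n x. (\<Sum>c\<in>{c\<in>C n. R n \<le> norm (x - c)}. 1 / card (C n) * norm (x - c) powr - a) \<le> G"
    using far_centres_sum_bounded[OF assms] by blast
  have "pot a (Suc N) n x \<le> ennreal (2 powr a * G) + near_pot a N n x" for N n x
  proof -
    define F where "F = {c\<in>C n. R n \<le> norm (x - c)}"
    have finF: "finite F" unfolding F_def using finite_C by simp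
    define t where "t c = ennreal (weight a n) * pot a N (Suc n) ((x - c) /\<^sub>R l n)" for c
    have "t c \<le> ennreal (2 powr a * (1 / card (C n) * norm (x - c) powr - a))" if c: "c \<in> F" for c
    proof -
      have far: "2 \<le> norm ((x - c) /\<^sub>R l n)"
      proof -
        have "2 * l n \<le> norm (x - c)" using c l_le_half[of n] by (auto simp: F_def)
        then have "2 \<le> norm (x - c) / l n" using l_pos[of n] by (simp add: le_divide_eq)
        then show ?thesis using l_pos[of n] by (simp add: divide_inverse mult.commute)
      qed
      have "t c \<le> ennreal (weight a n) * ennreal (2 powr a * norm ((x - c) /\<^sub>R l n) powr - a)"
        unfolding t_def by (intro mult_left_mono pot_far assms far) auto
      also have "\<dots> = ennreal (weight a n * (2 powr a * norm ((x - c) /\<^sub>R l n) powr - a))"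
        by (rule ennreal_mult[symmetric]) auto
      also have "weight a n * (2 powr a * norm ((x - c) /\<^sub>R l n) powr - a)
          = 2 powr a * (1 / card (C n) * norm (x - c) powr - a)"
        using l_pos[of n] by (simp add: powr_mult powr_minus inverse_powr)
      finally show ?thesis .
    qed
    then have "(\<Sum>c\<in>F. t c) \<le> (\<Sum>c\<in>F. ennreal (2 powr a * (1 / card (C n) * norm (x - c) powr - a)))"
      by (rule sum_mono)
    also have "\<dots> = ennreal (2 powr a * (\<Sum>c\<in>F. 1 / card (C n) * norm (x - c) powr - a))"
      by (subst sum_ennreal) (auto simp: sum_distrib_left)
    also have "\<dots> \<le> ennreal (2 powr a * G)"
      using G(2)[where n = n and x = x] unfolding F_def by (intro ennreal_leI mult_left_mono) auto
    finally have 1: "(\<Sum>c\<in>F. t c) \<le> ennreal (2 powr a * G)" .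
    have 2: "(\<Sum>c\<in>C n - F. t c) = (\<Sum>c\<in>C n. t c * indicator (ball c (R n)) x)"
      by (rule sum.mono_neutral_cong_left)
        (use finite_C in \<open>auto simp: F_def dist_norm norm_minus_commute\<close>)
    have "pot a (Suc N) n x = (\<Sum>c\<in>C n. t c)"
      unfolding t_def by (rule pot_unfold) fact
    also have "\<dots> = (\<Sum>c\<in>F. t c) + (\<Sum>c\<in>C n - F. t c)"
      by (subst sum.subset_diff[of F "C n"]) (auto simp: finite_C F_def add.commute)
    also have "\<dots> \<le> ennreal (2 powr a * G) + (\<Sum>c\<in>C n. t c * indicator (ball c (R n)) x)"
      unfolding 2 using 1 by (rule add_right_mono)
    finally show ?thesis by (simp add: t_def mult.assoc)
  qed
  moreover have "0 \<le> 2 powr a * G" using G by simp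
  ultimately show ?thesis by blast
qed

lemma near_sum_cases:
  obtains "(\<Sum>c\<in>C n. k * (f ((x - c) /\<^sub>R l n) * indicator (ball c (R n)) x)) = (0::ennreal)"
  | c where "c \<in> C n" "(\<Sum>c\<in>C n. k * (f ((x - c) /\<^sub>R l n) * indicator (ball c (R n)) x)) = k * f ((x - c) /\<^sub>R l n)"
proof (cases rule: insert_map_cases[of n x])
  case far
  then show ?thesis
    by (intro that(1) sum.neutral) (auto simp: dist_norm norm_minus_commute indicator_def not_less)
next
  case (near c)
  have ind: "(indicator (ball c (R n)) x :: ennreal) = indicator (ball 0 (R n)) (x - c)" for c
    by (simp add: indicator_def dist_norm norm_minus_commute)
  have "(\<Sum>c\<in>C n. k * (f ((x - c) /\<^sub>R l n) * indicator (ball 0 (R n)) (x - c)))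
    = k * (f ((x - c) /\<^sub>R l n) * indicator (ball 0 (R n)) (x - c))"
    by (rule sum_near[OF near, where f = "\<lambda>w. k * (f (w /\<^sub>R l n) * indicator (ball 0 (R n)) w)"])
       (auto simp: indicator_def)
  also have "\<dots> = k * f ((x - c) /\<^sub>R l n)" using near by (simp add: indicator_def)
  finally show ?thesis by (intro that(2)[OF near(1)]) (simp only: ind)
qed

text \<open>The truncated kernels converge to the true kernel at every point, with the value
  \<infinity> on the diagonal because the truncation radii tend to 0; the rest is Fatou's
  lemma.\<close>

lemma kernel_le_liminf_pot:
  assumes a: "0 < a"
  shows "(\<integral>\<^sup>+\<omega>. 1 / ennreal (norm (x - point n \<omega>) powr a) \<partial>digits n) \<le> liminf (\<lambda>N. pot a N n x)"
proof -
  have "1 / ennreal (norm y powr a) \<le> liminf (\<lambda>N. ennreal (max (rad N n) (norm y) powr - a))" for y :: complex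
  proof (cases "y = 0")
    case True
    have "filterlim (\<lambda>N. rad N n powr - a) at_top sequentially"
    proof (rule filterlim_compose[of "\<lambda>r. r powr - a" _ "at_right 0"])
      show "filterlim (\<lambda>r::real. r powr - a) at_top (at_right 0)"
        using a by real_asymp
      show "filterlim (\<lambda>N. rad N n) (at_right 0) sequentially"
        using rad_tendsto_0[of n] rad_pos[of _ n, THEN less_imp_neq, symmetric] rad_pos[of _ n]
        by (auto simp: filterlim_at)
    qed
    then have "(\<lambda>N. ennreal (rad N n powr - a)) \<longlonglongrightarrow> top"
      by (simp only: ennreal_tendsto_top_eq_at_top)
    then have "liminf (\<lambda>N. ennreal (max (rad N n) (norm y) powr - a)) = top"
      using True by (intro lim_imp_Liminf) (auto simp: max_absorb1[OF less_imp_le[OF rad_pos]])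
    then show ?thesis by simp
  next
    case False
    have "\<forall>\<^sub>F N in sequentially. rad N n < norm y"
      using order_tendstoD(2)[OF rad_tendsto_0] False by auto
    then have "\<forall>\<^sub>F N in sequentially. ennreal (max (rad N n) (norm y) powr - a) = ennreal (norm y powr - a)"
      by eventually_elim (simp add: max_def)
    then have "liminf (\<lambda>N. ennreal (max (rad N n) (norm y) powr - a)) = ennreal (norm y powr - a)"
      by (intro lim_imp_Liminf tendsto_eventually) auto
    moreover have "1 / ennreal (norm y powr a) = ennreal (norm y powr - a)"
      using False by (simp add: powr_minus_divide divide_ennreal flip: ennreal_1)
    ultimately show ?thesis by simp
  qed
  then have "(\<integral>\<^sup>+\<omega>. 1 / ennreal (norm (x - point n \<omega>) powr a) \<partial>digits n)
      \<le> (\<integral>\<^sup>+\<omega>. liminf (\<lambda>N. kernel a (rad N n) n x \<omega>) \<partial>digits n)"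
    by (intro nn_integral_mono) 
  also have "\<dots> \<le> liminf (\<lambda>N. pot a N n x)"
    unfolding pot_def by (intro nn_integral_liminf measurable_kernel)
  finally show ?thesis .
qed

end

section \<open>Powers of extended nonnegative reals\<close>

lemma ennreal_powr_ennreal: "0 \<le> r \<Longrightarrow> ennreal_powr (ennreal r) q = ennreal (r powr q)"
  by (simp add: ennreal_powr_def)

lemma ennreal_powr_mono: "u \<le> v \<Longrightarrow> 0 \<le> q \<Longrightarrow> ennreal_powr u q \<le> ennreal_powr v q"
  by (cases u; cases v) (auto simp: ennreal_powr_def top_unique intro!: ennreal_leI powr_mono2)

lemma ennreal_powr_mult:
  assumes "0 < c"
  shows "ennreal_powr (ennreal c * u) q = ennreal (c powr q) * ennreal_powr u q"
proof (cases u)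
  case (real r)
  then show ?thesis using assms
    by (simp add: ennreal_mult[symmetric] ennreal_powr_ennreal powr_mult)
next
  case top
  then show ?thesis using assms by (simp add: ennreal_powr_def ennreal_mult_top)
qed

text \<open>From \<open>u + v \<le> 2 * max u v\<close>; the constant 8 is 2^3. In the application q
  = 2 + 1/K, which is below 3 for every K > 1.\<close>

lemma ennreal_powr_add_le:
  assumes "0 \<le> q" "q \<le> 3"
  shows "ennreal_powr (u + v) q \<le> 8 * (ennreal_powr u q + ennreal_powr v q)"
proof -
  have "u + v \<le> ennreal 2 * max u v"
    using add_mono[of u "max u v" v "max u v"] by (simp flip: mult_2)
  then have "ennreal_powr (u + v) q \<le> ennreal (2 powr q) * ennreal_powr (max u v) q"
    using ennreal_powr_mono[of "u + v" "ennreal 2 * max u v" q] ennreal_powr_mult[of 2 "max u v" q] assms by simp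
  also have "\<dots> \<le> ennreal 8 * (ennreal_powr u q + ennreal_powr v q)"
  proof (rule mult_mono)
    have "2 powr q \<le> 2 powr (3::real)" using assms by (intro powr_mono) auto
    then show "ennreal (2 powr q) \<le> ennreal 8" by (intro ennreal_leI) simp
    show "ennreal_powr (max u v) q \<le> ennreal_powr u q + ennreal_powr v q"
      by (cases "u \<le> v") (auto simp: max_def intro: add_increasing add_increasing2)
  qed auto
  finally show ?thesis by simp
qed

lemma ennreal_powr_measurable [measurable]: "(\<lambda>u. ennreal_powr u q) \<in> borel_measurable borel"
  unfolding ennreal_powr_def by measurable

text \<open>A lower limit is characterised by the numbers that lie eventually below the sequence,
  and y < w^q is equivalent to y^(1/q) < w.\<close>

lemma ennreal_powr_liminf_le:
  assumes q: "0 < q"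
  shows "ennreal_powr (liminf u) q \<le> liminf (\<lambda>N. ennreal_powr (u N) q)"
  unfolding le_Liminf_iff
proof (intro allI impI)
  fix y assume y: "y < ennreal_powr (liminf u) q"
  then obtain r where r: "y = ennreal r" "0 \<le> r" by (cases y) auto
  have key: "y < ennreal_powr w q \<longleftrightarrow> ennreal (r powr (1 / q)) < w" for w
  proof (cases w)
    case (real s)
    have "r < s powr q \<longleftrightarrow> r powr (1 / q) < s"
    proof
      assume "r < s powr q"
      then have "r powr (1 / q) < (s powr q) powr (1 / q)"
        using q r by (intro powr_less_mono2) auto
      then show "r powr (1 / q) < s" using q real by (simp add: powr_powr)
    next
      assume "r powr (1 / q) < s"
      then have "(r powr (1 / q)) powr q < s powr q"
        using q by (intro powr_less_mono2) auto
      then show "r < s powr q" using q r by (simp add: powr_powr)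
    qed
    then show ?thesis using real r by (simp add: ennreal_powr_ennreal ennreal_less_iff)
  next
    case top
    then show ?thesis using r by (simp add: ennreal_powr_def)
  qed
  have "ennreal (r powr (1 / q)) < liminf u" using y key by simp
  then have "\<forall>\<^sub>F N in sequentially. ennreal (r powr (1 / q)) < u N"
    using le_Liminf_iff[of "liminf u" sequentially u] by simp
  then show "\<forall>\<^sub>F N in sequentially. y < ennreal_powr (u N) q" unfolding key .
qed

lemma (in prob_space) norm_expectation_le:
  fixes f :: "'a \<Rightarrow> complex"
  assumes [measurable]: "f \<in> borel_measurable M" and le: "\<And>x. x \<in> space M \<Longrightarrow> norm (f x) \<le> B"
  shows "norm (expectation f) \<le> B"
proof -
  have "integrable M f" using le by (intro integrable_const_bound[where B = B]) auto
  then have "norm (expectation f) \<le> expectation (\<lambda>x. B)"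
    using le by (intro order_trans[OF integral_norm_bound] integral_mono) auto
  then show ?thesis by (simp add: prob_space)
qed

section \<open>Bounded Cauchy potentials and positive analytic capacity\<close>

context cantor_scale
begin

text \<open>The hypothesis gives the one remaining disc of \<open>pot_step\<close> a weight of at
  most 1/4, so the bound obeys a recursion of the form G + A/4.\<close>

lemma pot_1_bounded:
  assumes l: "\<And>n. 4 \<le> real (card (C n)) * l n"
  shows "\<exists>A\<ge>0. \<forall>N n x. pot 1 N n x \<le> ennreal A"
proof -
  obtain G where G: "G \<ge> 0" "\<And>N n x. pot 1 (Suc N) n x \<le> ennreal G + near_pot 1 N n x"
    using pot_step[of 1] by auto
  \<comment> \<open>The 1 covers the start of the induction, and G + A/4 is at most A.\<close>
  define A where "A = 1 + 2 * G"
  have "pot 1 N n x \<le> ennreal A" for N n x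
  proof (induction N arbitrary: n x)
    case 0
    have "pot 1 0 n x \<le> 1" by (rule pot_0_le_1) simp
    also have "1 \<le> ennreal A" using G by (simp add: A_def)
    finally show ?case .
  next
    case (Suc N)
    have pos: "0 < real (card (C n))" using finite_C C_nonempty by (simp add: card_gt_0_iff)
    have coef: "weight 1 n \<le> 1/4"
      using l[of n] l_pos[of n] pos by (simp add: powr_minus divide_simps)
    have le: "ennreal (weight 1 n) * pot 1 N (Suc n) y \<le> ennreal (1/4 * A)" for y
    proof -
      have "ennreal (weight 1 n) * pot 1 N (Suc n) y \<le> ennreal (1/4) * ennreal A"
        by (intro mult_mono ennreal_leI coef Suc) auto
      also have "\<dots> = ennreal (1/4 * A)" by (rule ennreal_mult[symmetric]) (use G in \<open>auto simp: A_def\<close>)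
      finally show ?thesis .
    qed
    have "near_pot 1 N n x \<le> ennreal (1/4 * A)"
      by (rule near_sum_cases[where n = n and k = "ennreal (weight 1 n)" and f = "pot 1 N (Suc n)" and x = x]) (simp_all only: le zero_le)
    then have "pot 1 (Suc N) n x \<le> ennreal G + ennreal (1/4 * A)"
      using G(2)[of N n x] by (meson add_left_mono order_trans)
    also have "\<dots> = ennreal (G + 1/4 * A)" using G by (intro ennreal_plus[symmetric]) (auto simp: A_def)
    also have "\<dots> \<le> ennreal A" using G by (intro ennreal_leI) (simp add: A_def)
    finally show ?case .
  qed
  moreover have "0 \<le> A" using G by (simp add: A_def)
  ultimately show ?thesis by blast
qed

text \<open>The competitor is the Cauchy transform of the uniform measure, normalised by its
  supremum bound. It is bounded because its modulus is at most the potential with kernel 1/|z|, and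
  its derivative at infinity is the normalised total mass, which is not 0.\<close>

lemma analytic_capacity_pos:
  assumes l: "\<And>n. 4 \<le> real (card (C n)) * l n"
    and F: "closed F" "\<And>\<omega>. \<omega> \<in> space (digits n) \<Longrightarrow> point n \<omega> \<in> F"
  shows "analytic_capacity F > 0"
proof -
  interpret P: prob_space "digits n" by (rule prob_space_digits)
  obtain A where A: "A \<ge> 0" "\<And>N n x. pot 1 N n x \<le> ennreal A"
    using pot_1_bounded[OF l] by blast
  have pt: "\<omega> \<in> space (digits n) \<Longrightarrow> norm (point n \<omega>) \<le> 1" for \<omega>
    by (rule summable_digits)
  define g where "g z = (\<integral>\<omega>. 1 / (z - point n \<omega>) \<partial>digits n)" for z
  define g' where "g' z = (\<integral>\<omega>. 1 / (z - point n \<omega>)\<^sup>2 \<partial>digits n)" for z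
  have d: "\<exists>\<delta>>0. \<forall>\<omega>\<in>space (digits n). \<delta> \<le> norm (z - point n \<omega>)" if "z \<notin> F" for z
  proof -
    from separate_point_closed[OF F(1) that]
    obtain \<delta> where "\<delta> > 0" "\<And>y. y \<in> F \<Longrightarrow> \<delta> \<le> dist z y"
      by blast
    then show ?thesis using F(2) by (intro exI[of _ \<delta>]) (auto simp: dist_norm)
  qed
  have int: "integrable (digits n) (\<lambda>\<omega>. 1 / (z - point n \<omega>) ^ k)" if \<delta>: "\<delta> > 0" "\<And>\<omega>. \<omega>\<in>space (digits n) \<Longrightarrow> \<delta> \<le> norm (z - point n \<omega>)" for z \<delta> k
  proof (rule P.integrable_const_bound)
    show "AE \<omega> in digits n. norm (1 / (z - point n \<omega>) ^ k) \<le> 1 / \<delta> ^ k"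
      using \<delta> by (intro AE_I2) (auto simp: norm_divide norm_power intro!: frac_le power_mono)
  qed measurable
  have bound: "norm (g z) \<le> A" if z: "z \<notin> F" for z
  proof -
    obtain \<delta> where \<delta>: "\<delta> > 0" "\<And>\<omega>. \<omega>\<in>space (digits n) \<Longrightarrow> \<delta> \<le> norm (z - point n \<omega>)" using d[OF z] by blast
    have "ennreal (norm (g z)) \<le> (\<integral>\<^sup>+\<omega>. norm (1 / (z - point n \<omega>)) \<partial>digits n)"
      unfolding g_def using int[OF \<delta>, of 1] by (intro integral_norm_bound_ennreal) simp
    also have "\<dots> = (\<integral>\<^sup>+\<omega>. 1 / ennreal (norm (z - point n \<omega>) powr 1) \<partial>digits n)"
    proof (rule nn_integral_cong)
      fix \<omega> assume "\<omega> \<in> space (digits n)"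
      then have "0 < norm (z - point n \<omega>)" using \<delta> by (meson less_le_trans)
      then show "ennreal (norm (1 / (z - point n \<omega>))) = 1 / ennreal (norm (z - point n \<omega>) powr 1)"
        by (simp add: norm_divide divide_ennreal flip: ennreal_1)
    qed
    also have "\<dots> \<le> liminf (\<lambda>N. pot 1 N n z)"
      by (rule kernel_le_liminf_pot) simp
    also have "\<dots> \<le> ennreal A"
      by (rule Liminf_le) (simp_all add: A)
    finally show ?thesis using A by (simp add: ennreal_le_iff)
  qed
  have "(g has_field_derivative - g' z) (at z)" if z: "z \<notin> F" for z
  proof -
    obtain \<delta> where \<delta>: "\<delta> > 0" "\<And>\<omega>. \<omega>\<in>space (digits n) \<Longrightarrow> \<delta> \<le> norm (z - point n \<omega>)" using d[OF z] by blast
    have est: "norm ((g (z + h) - g z) / h - - g' z) \<le> norm h * (2 / \<delta> ^ 3)"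
      if h: "h \<noteq> 0" "norm h < \<delta> / 2" for h
    proof -
      have \<delta>h: "\<delta> / 2 \<le> norm (z + h - point n \<omega>)" if "\<omega>\<in>space (digits n)" for \<omega>
        using \<delta>(2)[OF that] h norm_triangle_ineq2[of "z - point n \<omega>" "- h"] by (simp add: algebra_simps)
      have \<delta>2: "\<delta> / 2 > 0" using \<delta> by simp
      \<comment> \<open>The exact remainder of the difference quotient; it is of order |h| because
        the coded points stay at distance \<open>\<delta> / 2\<close> from
        \<open>z + h\<close>.\<close>
      let ?T = "\<lambda>\<omega>. h * (1 / (z - point n \<omega>)\<^sup>2 * (1 / (z + h - point n \<omega>)))"
      have "(g (z + h) - g z) / h - - g' z
          = (\<integral>\<omega>. (1 / (z + h - point n \<omega>) - 1 / (z - point n \<omega>)) / h + 1 / (z - point n \<omega>)\<^sup>2 \<partial>digits n)"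
        using int[OF \<delta>2 \<delta>h, of 1] int[OF \<delta>, of 1] int[OF \<delta>, of 2] by (simp add: g_def g'_def)
      also have "\<dots> = (\<integral>\<omega>. ?T \<omega> \<partial>digits n)"
      proof (rule Bochner_Integration.integral_cong)
        fix \<omega> assume \<omega>: "\<omega> \<in> space (digits n)"
        define x y where "x = z - point n \<omega>" and "y = z + h - point n \<omega>"
        have "y \<noteq> 0" using \<delta>h[OF \<omega>] \<delta>(1) by (auto simp: y_def)
        moreover have yx: "y = x + h" by (simp add: x_def y_def)
        ultimately have xy: "x \<noteq> 0" "x + h \<noteq> 0" "y = x + h" using \<delta>(2)[OF \<omega>] \<delta>(1) by (auto simp: x_def)
        have "1 / (x + h) - 1 / x = - h / (x * (x + h))"
          using xy by (simp add: field_simps)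
        then have "(1 / y - 1 / x) / h = - h / (x * (x + h)) / h"
          by (simp only: xy(3))
        then have "(1 / y - 1 / x) / h = - (1 / (x * (x + h)))"
          using h by simp
        moreover have "- (1 / (x * (x + h))) + 1 / x\<^sup>2 = h * (1 / x\<^sup>2 * (1 / (x + h)))"
        proof -
          have "- (1 / (x * t)) + 1 / x\<^sup>2 = (t - x) * (1 / x\<^sup>2 * (1 / t))" if "t \<noteq> 0" for t
            using that xy(1) by (simp add: field_simps power2_eq_square)
          from this[OF xy(2)] show ?thesis by simp
        qed
        ultimately have "(1 / y - 1 / x) / h + 1 / x\<^sup>2 = h * (1 / x\<^sup>2 * (1 / y))"
          using xy by simp
        then show "(1 / (z + h - point n \<omega>) - 1 / (z - point n \<omega>)) / h + 1 / (z - point n \<omega>)\<^sup>2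
           = ?T \<omega>" by (simp add: x_def y_def)
      qed simp
      also have "norm \<dots> \<le> norm h * (1 / \<delta>\<^sup>2 * (2 / \<delta>))"
      proof -
        have b: "norm (?T \<omega>) \<le> norm h * (1 / \<delta>\<^sup>2 * (2 / \<delta>))"
          if \<omega>: "\<omega> \<in> space (digits n)" for \<omega>
        proof -
          have "1 / (norm (z - point n \<omega>))\<^sup>2 \<le> 1 / \<delta>\<^sup>2"
            using \<delta>(2)[OF \<omega>] \<delta>(1) by (intro divide_left_mono power_mono mult_pos_pos zero_less_power) linarith+
          moreover have "1 / norm (z + h - point n \<omega>) \<le> 1 / (\<delta> / 2)"
            using \<delta>h[OF \<omega>] \<delta>2 by (intro divide_left_mono mult_pos_pos) linarith+
          ultimately show ?thesis unfolding norm_mult norm_divide norm_power norm_one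
            using \<delta>(1) by (intro mult_left_mono mult_mono) auto
        qed
        show "norm (\<integral>\<omega>. ?T \<omega> \<partial>digits n) \<le> norm h * (1 / \<delta>\<^sup>2 * (2 / \<delta>))"
          using b by (intro P.norm_expectation_le) auto
      qed
      also have "\<dots> = norm h * (2 / \<delta> ^ 3)" by (simp add: power2_eq_square power3_eq_cube)
      finally show ?thesis .
    qed
    show ?thesis
      unfolding DERIV_def
    proof (rule LIM_zero_cancel, rule Lim_null_comparison)
      have "\<forall>\<^sub>F h in at 0. h \<noteq> 0 \<and> norm (h::complex) < \<delta> / 2"
        using \<delta>(1) by (auto simp: eventually_at dist_norm intro!: exI[of _ "\<delta>/2"])
      then show "\<forall>\<^sub>F h in at 0. norm ((g (z + h) - g z) / h - - g' z) \<le> norm h * (2 / \<delta> ^ 3)"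
        by eventually_elim (use est in auto)
      show "((\<lambda>h. norm h * (2 / \<delta> ^ 3)) \<longlongrightarrow> 0) (at (0::complex))"
        by (rule tendsto_eq_intros refl | simp)+
    qed
  qed
  then have holo: "g holomorphic_on - F"
    unfolding holomorphic_on_open[OF open_Compl[OF F(1)]] by blast
  \<comment> \<open>z g(z) - 1 is the mean of p / (z - p) over coded points p in the closed unit
    disc. This yields both the value 0 of \<open>g\<close> at infinity and its derivative
    there.\<close>
  have est: "norm (z * g z - 1) \<le> 1 / (norm z - 1)" if z: "1 < norm z" for z
  proof -
    have dz: "norm z - 1 > 0" "\<And>\<omega>. \<omega> \<in> space (digits n) \<Longrightarrow> norm z - 1 \<le> norm (z - point n \<omega>)"
    proof -
      fix \<omega> assume "\<omega> \<in> space (digits n)"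
      then show "norm z - 1 \<le> norm (z - point n \<omega>)"
        using pt[of \<omega>] norm_triangle_ineq2[of z "point n \<omega>"] by linarith
    qed (use z in simp)
    have "z * g z - 1 = (\<integral>\<omega>. z * (1 / (z - point n \<omega>)) - 1 \<partial>digits n)"
    proof -
      have i: "integrable (digits n) (\<lambda>\<omega>. 1 / (z - point n \<omega>))" using int[OF dz, of 1] by simp
      have "(\<integral>\<omega>. z * (1 / (z - point n \<omega>)) - 1 \<partial>digits n) = (\<integral>\<omega>. z * (1 / (z - point n \<omega>)) \<partial>digits n) - (\<integral>\<omega>. 1 \<partial>digits n)"
        by (intro Bochner_Integration.integral_diff integrable_mult_right i) simp
      also have "(\<integral>\<omega>. z * (1 / (z - point n \<omega>)) \<partial>digits n) = z * g z"
        unfolding g_def by (rule integral_mult_right_zero)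
      finally show ?thesis by (simp add: P.prob_space)
    qed
    also have "norm \<dots> \<le> 1 / (norm z - 1)"
    proof (rule P.norm_expectation_le)
      fix \<omega> assume \<omega>: "\<omega> \<in> space (digits n)"
      have "z - point n \<omega> \<noteq> 0" using dz(1) dz(2)[OF \<omega>] by auto
      then have "z * (1 / (z - point n \<omega>)) - 1 = point n \<omega> / (z - point n \<omega>)" by (simp add: field_simps)
      then have "norm (z * (1 / (z - point n \<omega>)) - 1) = norm (point n \<omega>) / norm (z - point n \<omega>)" by (simp add: norm_divide)
      also have "\<dots> \<le> 1 / (norm z - 1)"
        using pt[OF \<omega>] dz(1) dz(2)[OF \<omega>] by (intro frac_le) auto
      finally show "norm (z * (1 / (z - point n \<omega>)) - 1) \<le> 1 / (norm z - 1)" .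
    qed measurable
    finally show ?thesis .
  qed
  have lim1: "((\<lambda>z. z * g z) \<longlongrightarrow> 1) at_infinity"
  proof (rule LIM_zero_cancel, rule Lim_null_comparison)
    show "\<forall>\<^sub>F z in at_infinity. norm (z * g z - 1) \<le> 1 / (norm z - 1)"
      unfolding eventually_at_infinity using est by (intro exI[of _ 2]) auto
    have "((\<lambda>x::real. 1 / (x - 1)) \<longlongrightarrow> 0) at_top" by real_asymp
    then show "((\<lambda>z::complex. 1 / (norm z - 1)) \<longlongrightarrow> 0) at_infinity"
      by (rule filterlim_compose[OF _ filterlim_norm_at_top])
  qed
  have lim0: "(g \<longlongrightarrow> 0) at_infinity"
  proof -
    have "((\<lambda>z. z * g z * inverse z) \<longlongrightarrow> 1 * 0) at_infinity"
      by (intro tendsto_mult lim1 tendsto_inverse_0)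
    moreover have "\<forall>\<^sub>F z in at_infinity. z * g z * inverse z = g z"
      unfolding eventually_at_infinity
    proof (intro exI[of _ 1] allI impI)
      fix z :: complex assume "1 \<le> norm z"
      then have "z \<noteq> 0" by auto
      then show "z * g z * inverse z = g z" by simp
    qed
    ultimately show ?thesis by (simp add: tendsto_cong)
  qed
  \<comment> \<open>The bound \<open>A\<close> is only known to be nonnegative, so
    \<open>A + 1\<close> makes the division safe.\<close>
  define f where "f z = g z / of_real (A + 1)" for z
  have nz: "complex_of_real (A + 1) \<noteq> 0"
    using A(1) by (simp del: of_real_add)
  have ntriv: "(at_infinity :: complex filter) \<noteq> bot"
    using trivial_limit_at_infinity by blast
  have "(f \<longlongrightarrow> 0 / of_real (A + 1)) at_infinity"
    unfolding f_def[abs_def] by (intro tendsto_divide lim0 tendsto_const nz)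
  then have "Lim at_infinity f = 0" using ntriv by (intro tendsto_Lim) auto
  then have "deriv_at_infinity f = Lim at_infinity (\<lambda>z. z * g z / of_real (A + 1))"
    by (simp add: deriv_at_infinity_def f_def)
  also have "\<dots> = 1 / of_real (A + 1)"
    by (intro tendsto_Lim ntriv tendsto_divide lim1 tendsto_const nz)
  finally have "norm (deriv_at_infinity f) = 1 / (A + 1)"
    using A by (simp add: norm_divide del: of_real_add)
  then have pos: "0 < ennreal (norm (deriv_at_infinity f))" using A by simp
  have "f \<in> {f. f holomorphic_on - F \<and> (\<forall>z\<in>- F. cmod (f z) \<le> 1)}"
  proof safe
    show "f holomorphic_on - F" unfolding f_def[abs_def]
      by (intro holomorphic_intros holo nz)
    show "norm (f z) \<le> 1" if "z \<notin> F" for z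
      using bound[OF that] A by (simp add: f_def norm_divide divide_le_eq del: of_real_add)
  qed
  then have "ennreal (norm (deriv_at_infinity f)) \<le> analytic_capacity F"
    unfolding analytic_capacity_def by (rule SUP_upper)
  with pos show ?thesis by (rule less_le_trans)
qed

section \<open>Integrability of powers of the potential and positive Riesz capacity\<close>

abbreviation outer :: "real \<Rightarrow> real \<Rightarrow> real \<Rightarrow> complex \<Rightarrow> ennreal" where
  "outer a q G x \<equiv> ennreal G * indicator (ball 0 2) x + ennreal (2 powr (a * q)) * ennreal (max 1 (norm x) powr - (a * q))"

lemma measurable_ennreal_powr_pot: "(\<lambda>x. ennreal_powr (pot a N n x) q) \<in> borel_measurable borel"
  by (rule measurable_compose[OF measurable_pot ennreal_powr_measurable])

lemma ennreal_powr_pot_far: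
  assumes "0 \<le> a" "0 \<le> q" "2 \<le> norm x"
  shows "ennreal_powr (pot a N n x) q \<le> ennreal (2 powr (a * q)) * ennreal (max 1 (norm x) powr - (a * q))"
proof -
  have "ennreal_powr (pot a N n x) q \<le> ennreal_powr (ennreal (2 powr a * norm x powr - a)) q"
    using assms by (intro ennreal_powr_mono pot_far) auto
  also have "\<dots> = ennreal (2 powr (a * q) * norm x powr - (a * q))"
    by (simp add: ennreal_powr_ennreal powr_mult powr_powr)
  also have "\<dots> = ennreal (2 powr (a * q)) * ennreal (max 1 (norm x) powr - (a * q))"
    using assms(3) by (simp add: ennreal_mult max_def)
  finally show ?thesis .
qed

text \<open>At most one summand of \<open>near_pot\<close> is nonzero, so its q-th power is the
  power of a single term and no factor depending on \<open>card (C n)\<close> is lost. Only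
  afterwards is it enlarged to a sum over all centres, which integrates termwise. Where
  \<open>norm x\<close> is at least 2, the decay of the potential bounds it directly.\<close>

lemma ennreal_powr_pot_step:
  assumes a: "0 < a" "a < 2" and q: "1 < q" "q \<le> 3"
  shows "\<exists>G\<ge>0. \<forall>N n x. ennreal_powr (pot a (Suc N) n x) q \<le> outer a q G x +
     (\<Sum>c\<in>C n. ennreal (8 * (weight a n) powr q) * ennreal_powr (pot a N (Suc n) ((x - c) /\<^sub>R l n)) q)"
proof -
  obtain G where G: "G \<ge> 0" "\<And>N n x. pot a (Suc N) n x \<le> ennreal G + near_pot a N n x"
    using pot_step[of a] a by auto
  define G' where "G' = 8 * G powr q"
  have "ennreal_powr (pot a (Suc N) n x) q \<le> outer a q G' x +
     (\<Sum>c\<in>C n. ennreal (8 * (weight a n) powr q) * ennreal_powr (pot a N (Suc n) ((x - c) /\<^sub>R l n)) q)"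
    (is "?P \<le> ?A + ?B + (\<Sum>c\<in>C n. ?S c)") for N n x
  proof (cases "2 \<le> norm x")
    case True
    then have "?P \<le> ?B" using a q by (intro ennreal_powr_pot_far) auto
    then show ?thesis by (meson add_increasing add_increasing2 zero_le)
  next
    case False
    define k where "k = weight a n"
    have k: "0 < k" using finite_C C_nonempty l_pos[of n] by (simp add: k_def card_gt_0_iff)
    define Y where "Y = (\<Sum>c\<in>C n. ennreal k * (pot a N (Suc n) ((x - c) /\<^sub>R l n) * indicator (ball c (R n)) x))"
    have "ennreal_powr Y q
      \<le> (\<Sum>c\<in>C n. ennreal (k powr q) * ennreal_powr (pot a N (Suc n) ((x - c) /\<^sub>R l n)) q)"
    proof (cases rule: near_sum_cases[where n = n and k = "ennreal k" and f = "pot a N (Suc n)" and x = x])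
      case (2 c)
      show ?thesis unfolding Y_def 2(2) ennreal_powr_mult[OF k]
        using 2(1) finite_C by (intro member_le_sum) auto
    qed (simp add: Y_def ennreal_powr_def)
    moreover have "?P \<le> ennreal_powr (ennreal G + Y) q"
      using G(2) q unfolding Y_def k_def by (intro ennreal_powr_mono) auto
    moreover have "\<dots> \<le> 8 * (ennreal_powr (ennreal G) q + ennreal_powr Y q)"
      using q by (intro ennreal_powr_add_le) auto
    ultimately have "?P \<le> 8 * (ennreal (G powr q) + (\<Sum>c\<in>C n. ennreal (k powr q) * ennreal_powr (pot a N (Suc n) ((x - c) /\<^sub>R l n)) q))"
      unfolding ennreal_powr_ennreal[OF G(1)] by (meson add_left_mono mult_left_mono order_trans zero_le)
    also have "\<dots> = ?A + (\<Sum>c\<in>C n. ?S c)"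
    proof -
      have "ennreal G' = 8 * ennreal (G powr q)" "ennreal (8 * k powr q) = 8 * ennreal (k powr q)"
        by (simp_all add: G'_def ennreal_mult)
      moreover have "?S c = 8 * (ennreal (k powr q) * ennreal_powr (pot a N (Suc n) ((x - c) /\<^sub>R l n)) q)" for c
        unfolding k_def[symmetric] \<open>ennreal (8 * k powr q) = _\<close> by (rule mult.assoc)
      ultimately show ?thesis using False
        by (simp only: distrib_left sum_distrib_left) simp
    qed
    also have "\<dots> \<le> ?A + ?B + (\<Sum>c\<in>C n. ?S c)"
      by (intro add_mono order_refl) (auto intro: add_increasing2)
    finally show ?thesis .
  qed
  moreover have "0 \<le> G'" by (simp add: G'_def)
  ultimately show ?thesis by blast
qed

text \<open>Integration over a rescaled disc brings a factor \<open>(l n)\<^sup>2\<close>, so the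
  sum of \<open>pot_step\<close> type carries in all the coefficient 8 card^(1-q) l^(2-aq), where
  card is the number of centres and l the scale of the stage. By hypothesis this is at most 8/16 =
  1/2, and D + 2D/2 = 2D closes the induction. The condition \<open>2 < a * q\<close> makes the tail
  of \<open>outer\<close> integrable.\<close>

lemma ennreal_powr_pot_integral_bounded:
  assumes a: "0 < a" "a < 2" and q: "1 < q" "q \<le> 3" and aq: "2 < a * q"
    and l: "\<And>n. real (card (C n)) powr (1 - q) * l n powr (2 - a * q) \<le> 1/16"
  shows "\<exists>B\<ge>0. \<forall>N n. (\<integral>\<^sup>+x. ennreal_powr (pot a N n x) q \<partial>lborel) \<le> ennreal B"
proof -
  obtain G where G: "G \<ge> 0" "\<And>N n x. ennreal_powr (pot a (Suc N) n x) q \<le> outer a q G x +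
     (\<Sum>c\<in>C n. ennreal (8 * (weight a n) powr q) * ennreal_powr (pot a N (Suc n) ((x - c) /\<^sub>R l n)) q)"
    using ennreal_powr_pot_step[OF a q] by blast
  let ?J = "\<integral>\<^sup>+x. ennreal (max 1 (norm (x::complex)) powr - (a * q)) \<partial>lborel"
  have "?J < \<infinity>"
    using aq by (rule nn_integral_powr_outside_finite)
  then obtain j where j: "0 \<le> j" "?J = ennreal j"
    by (cases ?J) auto
  \<comment> \<open>\<open>G + 1\<close> dominates both constants that occur on the disc of radius
    2: \<open>G\<close> in the step, and 1 at the start, where the potential is at most 1.\<close>
  define D where "D = (G + 1) * (pi * 4) + 2 powr (a * q) * j"
  have D: "0 \<le> D" using G j by (simp add: D_def)
  have Im: "(\<lambda>x. ennreal G * indicator (ball 0 2) x) \<in> borel_measurable borel" for G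
    by (intro borel_measurable_times_ennreal borel_measurable_indicator) auto
  have I: "(\<integral>\<^sup>+x. outer a q G' x \<partial>lborel) \<le> ennreal D"
    if G': "0 \<le> G'" "G' \<le> G + 1" for G'
  proof -
    have "(\<integral>\<^sup>+x. outer a q G' x \<partial>lborel)
      = ennreal G' * ennreal (pi * 4) + ennreal (2 powr (a * q)) * ennreal j"
      by (subst nn_integral_add) (auto simp: Im nn_integral_cmult_indicator emeasure_ball_complex nn_integral_cmult j)
    also have "\<dots> = ennreal (G' * (pi * 4) + 2 powr (a * q) * j)"
      using G' j by (subst ennreal_plus) (auto simp: ennreal_mult)
    also have "\<dots> \<le> ennreal D"
      unfolding D_def using G' by (intro ennreal_leI add_right_mono mult_right_mono) auto
    finally show ?thesis .
  qed
  have "(\<integral>\<^sup>+x. ennreal_powr (pot a N n x) q \<partial>lborel) \<le> ennreal (2 * D)" for N n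
  proof (induction N arbitrary: n)
    case 0
    have "ennreal_powr (pot a 0 n x) q \<le> outer a q 1 x" for x
    proof (cases "2 \<le> norm x")
      case True
      then show ?thesis using a q by (intro add_increasing ennreal_powr_pot_far) auto
    next
      case False
      have "ennreal_powr (pot a 0 n x) q \<le> ennreal_powr (ennreal 1) q"
        using a q pot_0_le_1[of a n x] by (intro ennreal_powr_mono) auto
      then show ?thesis using False by (auto simp: ennreal_powr_ennreal simp del: ennreal_1 intro: add_increasing2)
    qed
    then have "(\<integral>\<^sup>+x. ennreal_powr (pot a 0 n x) q \<partial>lborel) \<le> ennreal D"
      by (rule order_trans[OF nn_integral_mono I]) (use G(1) in auto)
    also have "\<dots> \<le> ennreal (2 * D)" using D by (intro ennreal_leI) simp
    finally show ?case .
  next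
    case (Suc N)
    define k where "k = 8 * (weight a n) powr q"
    have f: "(\<lambda>x. ennreal_powr (pot a N (Suc n) x) q) \<in> borel_measurable borel"
      by (rule measurable_ennreal_powr_pot)
    have fc[measurable]: "(\<lambda>x. ennreal_powr (pot a N (Suc n) ((x - c) /\<^sub>R l n)) q) \<in> borel_measurable borel" for c
      by (rule measurable_compose[OF _ f]) measurable
    have S: "(\<integral>\<^sup>+x. ennreal k * ennreal_powr (pot a N (Suc n) ((x - c) /\<^sub>R l n)) q \<partial>lborel) \<le> ennreal (k * ((l n)\<^sup>2 * (2 * D)))" for c
    proof -
      have "(\<integral>\<^sup>+x. ennreal k * ennreal_powr (pot a N (Suc n) ((x - c) /\<^sub>R l n)) q \<partial>lborel)
        = ennreal k * (ennreal ((l n)\<^sup>2) * (\<integral>\<^sup>+x. ennreal_powr (pot a N (Suc n) x) q \<partial>lborel))"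
        by (subst nn_integral_cmult) (auto simp: nn_integral_lborel_rescale[OF f l_pos])
      also have "\<dots> \<le> ennreal k * (ennreal ((l n)\<^sup>2) * ennreal (2 * D))"
        by (intro mult_left_mono Suc) auto
      also have "\<dots> = ennreal (k * ((l n)\<^sup>2 * (2 * D)))"
      proof -
        have k: "0 \<le> k" by (simp add: k_def)
        have "ennreal ((l n)\<^sup>2) * ennreal (2 * D) = ennreal ((l n)\<^sup>2 * (2 * D))"
          using D by (intro ennreal_mult[symmetric]) auto
        moreover have "ennreal k * ennreal ((l n)\<^sup>2 * (2 * D)) = ennreal (k * ((l n)\<^sup>2 * (2 * D)))"
          using D k by (intro ennreal_mult[symmetric]) auto
        ultimately show ?thesis by (simp only:)
      qed
      finally show ?thesis .
    qed
    have "(\<integral>\<^sup>+x. ennreal_powr (pot a (Suc N) n x) q \<partial>lborel) \<le>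
      (\<integral>\<^sup>+x. outer a q G x
         + (\<Sum>c\<in>C n. ennreal k * ennreal_powr (pot a N (Suc n) ((x - c) /\<^sub>R l n)) q) \<partial>lborel)"
      unfolding k_def by (intro nn_integral_mono G(2))
    also have "\<dots> = (\<integral>\<^sup>+x. outer a q G x \<partial>lborel)
         + (\<Sum>c\<in>C n. \<integral>\<^sup>+x. ennreal k * ennreal_powr (pot a N (Suc n) ((x - c) /\<^sub>R l n)) q \<partial>lborel)"
      by (subst nn_integral_add) (auto simp: nn_integral_sum intro!: borel_measurable_add Im)
    also have "\<dots> \<le> ennreal D + (\<Sum>c\<in>C n. ennreal (k * ((l n)\<^sup>2 * (2 * D))))"
      by (intro add_mono I sum_mono S) (use G in auto)
    also have "\<dots> = ennreal D + ennreal (real (card (C n)) * (k * ((l n)\<^sup>2 * (2 * D))))"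
      using D by (simp add: ennreal_mult ennreal_of_nat_eq_real_of_nat k_def)
    also have "\<dots> = ennreal (D + real (card (C n)) * (k * ((l n)\<^sup>2 * (2 * D))))"
      using D by (intro ennreal_plus[symmetric]) (auto simp: k_def)
    also have "\<dots> \<le> ennreal (2 * D)"
    proof (rule ennreal_leI)
      have M: "0 < real (card (C n))" using finite_C C_nonempty by (simp add: card_gt_0_iff)
      have "real (card (C n)) * (k * ((l n)\<^sup>2 * (2 * D))) = (real (card (C n)) * (1 / card (C n)) powr q * (l n powr - (a * q) * (l n)\<^sup>2)) * (16 * D)"
      proof -
        have "(weight a n) powr q = (1 / card (C n)) powr q * (l n powr - a) powr q"
          by (rule powr_mult)
        then have "k = 8 * ((1 / card (C n)) powr q * l n powr - (a * q))"
          by (simp only: k_def powr_powr mult_minus_left)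
        then show ?thesis by (simp only: mult_ac)
      qed
      also have "real (card (C n)) * (1 / card (C n)) powr q = real (card (C n)) powr (1 - q)"
        using M by (simp add: powr_diff powr_divide)
      also have "l n powr - (a * q) * (l n)\<^sup>2 = l n powr (2 - a * q)"
        using l_pos[of n] by (simp add: powr_diff powr_minus powr_numeral divide_inverse)
      also have "(real (card (C n)) powr (1 - q) * l n powr (2 - a * q)) * (16 * D) \<le> 1/16 * (16 * D)"
        using D by (intro mult_right_mono l) auto
      finally show "D + real (card (C n)) * (k * ((l n)\<^sup>2 * (2 * D))) \<le> 2 * D" by simp
    qed
    finally show ?case .
  qed
  then show ?thesis using D by (intro exI[of _ "2 * D"]) auto
qed

text \<open>The competitor is a multiple \<open>\<kappa>\<close> of the uniform measure. Its
  potential is linear in \<open>\<kappa>\<close>, so the integral of the q-th power is at most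
  \<open>\<kappa> powr q * B\<close>; the choice of \<open>\<kappa>\<close> makes this B/(B+1), with
  a positive \<open>\<kappa>\<close> also when B = 0.\<close>

lemma riesz_capacity_pos:
  assumes \<alpha>: "0 < \<alpha>" "\<alpha> < 2" and p: "1 < p" and q: "p / (p - 1) \<le> 3" and aq: "2 < (2 - \<alpha>) * (p / (p - 1))"
    and l: "\<And>n. real (card (C n)) powr (1 - p / (p - 1)) * l n powr (2 - (2 - \<alpha>) * (p / (p - 1))) \<le> 1/16"
    and F: "closed F" "\<And>\<omega>. \<omega> \<in> space (digits n) \<Longrightarrow> point n \<omega> \<in> F"
  shows "riesz_capacity \<alpha> p F > 0"
proof -
  interpret P: prob_space "digits n" by (rule prob_space_digits)
  define q where "q = p / (p - 1)"
  define a where "a = 2 - \<alpha>"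
  have q1: "1 < q" using p by (simp add: q_def)
  obtain B where B: "0 \<le> B" "\<And>N n. (\<integral>\<^sup>+x. ennreal_powr (pot a N n x) q \<partial>lborel) \<le> ennreal B"
    using ennreal_powr_pot_integral_bounded[of a q] \<alpha> q1 q aq l unfolding q_def a_def by auto
  define U where "U x = (\<integral>\<^sup>+\<omega>. 1 / ennreal (norm (x - point n \<omega>) powr a) \<partial>digits n)" for x
  have U: "(\<integral>\<^sup>+x. ennreal_powr (U x) q \<partial>lborel) \<le> ennreal B"
  proof -
    have "(\<integral>\<^sup>+x. ennreal_powr (U x) q \<partial>lborel) \<le> (\<integral>\<^sup>+x. liminf (\<lambda>N. ennreal_powr (pot a N n x) q) \<partial>lborel)"
    proof (rule nn_integral_mono)
      fix x
      have "ennreal_powr (U x) q \<le> ennreal_powr (liminf (\<lambda>N. pot a N n x)) q"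
        unfolding U_def using \<alpha> q1 by (intro ennreal_powr_mono kernel_le_liminf_pot) (auto simp: a_def)
      also have "\<dots> \<le> liminf (\<lambda>N. ennreal_powr (pot a N n x) q)"
        using q1 by (intro ennreal_powr_liminf_le) simp
      finally show "ennreal_powr (U x) q \<le> liminf (\<lambda>N. ennreal_powr (pot a N n x) q)" .
    qed
    also have "\<dots> \<le> liminf (\<lambda>N. \<integral>\<^sup>+x. ennreal_powr (pot a N n x) q \<partial>lborel)"
      by (intro nn_integral_liminf) (simp add: measurable_ennreal_powr_pot)
    also have "\<dots> \<le> ennreal B"
      by (intro Liminf_le) (simp_all add: B)
    finally show ?thesis .
  qed
  define \<kappa> where "\<kappa> = (1 / (B + 1)) powr (1 / q)"
  have \<kappa>: "0 < \<kappa>" "\<kappa> powr q = 1 / (B + 1)"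
    using B(1) q1 by (simp_all add: \<kappa>_def powr_powr)
  define \<mu> where "\<mu> = scale_measure (ennreal \<kappa>) (distr (digits n) borel (point n))"
  have pm: "point n \<in> measurable (digits n) borel" by measurable
  have F_borel: "F \<in> sets borel" using F(1) by simp
  have em: "emeasure \<mu> S = ennreal \<kappa> * emeasure (digits n) (point n -` S \<inter> space (digits n))" if "S \<in> sets borel" for S
    using that by (simp add: \<mu>_def emeasure_distr[OF pm])
  have "point n -` F \<inter> space (digits n) = space (digits n)" using F(2) by auto
  then have \<mu>F: "emeasure \<mu> F = ennreal \<kappa>" using em[OF F_borel] by (simp add: P.emeasure_space_1)
  have "point n -` (- F) \<inter> space (digits n) = {}" using F(2) by auto
  then have \<mu>F': "emeasure \<mu> (- F) = 0" using em[of "- F"] F_borel by simp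
  have pot\<mu>: "riesz_potential \<alpha> \<mu> x = ennreal \<kappa> * U x" for x
  proof -
    have m: "(\<lambda>y. 1 / ennreal (cmod (x - y) powr (2 - \<alpha>))) \<in> borel_measurable borel" by measurable
    have "riesz_potential \<alpha> \<mu> x = ennreal \<kappa> * (\<integral>\<^sup>+ y. 1 / ennreal (cmod (x - y) powr (2 - \<alpha>)) \<partial>distr (digits n) borel (point n))"
      unfolding riesz_potential_def \<mu>_def by (rule nn_integral_scale_measure) (simp add: m)
    then show ?thesis using m by (simp add: nn_integral_distr[OF pm] U_def a_def)
  qed
  have "Lp_norm q (riesz_potential \<alpha> \<mu>) \<le> 1"
  proof -
    have "(\<integral>\<^sup>+x. ennreal_powr (riesz_potential \<alpha> \<mu> x) q \<partial>lebesgue) = (\<integral>\<^sup>+x. ennreal (\<kappa> powr q) * ennreal_powr (U x) q \<partial>lborel)"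
      by (simp add: nn_integral_completion pot\<mu> ennreal_powr_mult[OF \<kappa>(1)])
    also have "\<dots> \<le> ennreal (\<kappa> powr q) * ennreal B"
    proof (subst nn_integral_cmult)
      show "(\<lambda>x. ennreal_powr (U x) q) \<in> borel_measurable lborel"
        unfolding U_def by measurable
    qed (intro mult_left_mono U, simp)
    also have "\<dots> = ennreal (1 / (B + 1) * B)" unfolding \<kappa>(2) using B by (intro ennreal_mult[symmetric]) auto
    also have "\<dots> \<le> ennreal 1" using B by (intro ennreal_leI) (simp add: divide_le_eq)
    finally have "Lp_norm q (riesz_potential \<alpha> \<mu>) \<le> ennreal_powr (ennreal 1) (1 / q)"
      unfolding Lp_norm_def using q1 by (intro ennreal_powr_mono) auto
    also have "\<dots> = 1" by (simp add: ennreal_powr_ennreal del: ennreal_1)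
    finally show ?thesis .
  qed
  then have "\<mu> \<in> {\<mu>. sets \<mu> = sets borel \<and> emeasure \<mu> (- F) = 0 \<and> Lp_norm (p / (p - 1)) (riesz_potential \<alpha> \<mu>) \<le> 1}"
    using \<mu>F' by (simp add: \<mu>_def q_def)
  then have "ennreal_powr (emeasure \<mu> F) p \<le> riesz_capacity \<alpha> p F"
    unfolding riesz_capacity_def by (rule SUP_upper)
  moreover have "0 < ennreal_powr (emeasure \<mu> F) p"
    unfolding \<mu>F using \<kappa>(1) by (simp add: ennreal_powr_ennreal)
  ultimately show ?thesis by simp
qed

end

section \<open>The Cantor set and its image\<close>

context dense_cantor_system
begin

sublocale source: cantor_scale K C R \<sigma> \<tau> \<tau>
  by unfold_locales (rule \<tau>_pos \<tau>_le_half)+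

sublocale target: cantor_scale K C R \<sigma> \<tau> \<sigma>
  by unfold_locales (rule \<sigma>_pos \<sigma>_le_half)+

definition cantor_set :: "complex set" where
  "cantor_set = (\<Inter>N. generation N 0)"

text \<open>The map preserves codes: both sides satisfy the same recursion in the first digit, and
  each generation scales their difference by \<open>\<sigma> n \<le> 1/2\<close>, so it
  vanishes.\<close>

lemma qc_map_source_point:
  assumes "\<omega> \<in> space (digits n)"
  shows "qc_map n (source.point n \<omega>) = target.point n \<omega>"
proof -
  have "norm (qc_map n (source.point n \<omega>) - target.point n \<omega>) \<le> 2 * (1/2) ^ k" for k
    using assms
  proof (induction k arbitrary: n \<omega>)
    case 0
    have "norm (qc_map n (source.point n \<omega>)) \<le> 1"
      using disc_map_qc_map[of n] source.summable_digits(2)[OF 0] by (simp add: disc_map_def)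
    then show ?case
      using target.summable_digits(2)[OF 0] norm_triangle_ineq4[of "qc_map n (source.point n \<omega>)" "target.point n \<omega>"]
      by simp
  next
    case (Suc k)
    obtain c \<omega>' where c: "c \<in> C n" "\<omega>' \<in> space (digits (Suc n))" "\<omega> = case_nat c \<omega>'"
      using source.point_unfold[OF Suc.prems] by metis
    let ?x = "source.point (Suc n) \<omega>'"
    have x: "norm ?x \<le> 1" by (rule source.summable_digits(2)[OF c(2)])
    have inner: "norm (source.point n \<omega> - c) \<le> \<tau> n"
      using x \<tau>_pos[of n] by (simp add: c(3) source.point_prepend[OF c(1,2)] mult_left_le)
    then have near: "norm (source.point n \<omega> - c) < R n" using \<tau>_less_R[of n] by linarith
    have "qc_map n (source.point n \<omega>) = c + cell n (qc_map (Suc n)) (source.point n \<omega> - c)"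
      by (subst qc_map_unfold) (rule insert_map_near[OF c(1) near])
    also have "cell n (qc_map (Suc n)) (source.point n \<omega> - c) = \<sigma> n *\<^sub>R qc_map (Suc n) ?x"
      using inner \<tau>_pos[of n] by (simp add: cell_def c(3) source.point_prepend[OF c(1,2)])
    finally have "qc_map n (source.point n \<omega>) - target.point n \<omega> = \<sigma> n *\<^sub>R (qc_map (Suc n) ?x - target.point (Suc n) \<omega>')"
      by (simp add: c(3) target.point_prepend[OF c(1,2)] scaleR_diff_right)
    then have "norm (qc_map n (source.point n \<omega>) - target.point n \<omega>) = \<sigma> n * norm (qc_map (Suc n) ?x - target.point (Suc n) \<omega>')"
      using \<sigma>_pos[of n] by simp
    also have "\<dots> \<le> 1/2 * (2 * (1/2) ^ k)"
      using Suc.IH[OF c(2)] \<sigma>_pos[of n] \<sigma>_le_half[of n] R_bounds(2)[of n] by (intro mult_mono) auto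
    finally show ?case by simp
  qed
  moreover have "(\<lambda>k. 2 * (1/2) ^ k :: real) \<longlonglongrightarrow> 0"
    by (intro tendsto_mult_right_zero LIMSEQ_realpow_zero) auto
  ultimately have "norm (qc_map n (source.point n \<omega>) - target.point n \<omega>) \<le> 0"
    by (intro LIMSEQ_le_const[of "\<lambda>k. 2 * (1/2) ^ k"]) blast+
  then show ?thesis by simp
qed

lemma source_point_in_generation:
  assumes "\<omega> \<in> space (digits n)"
  shows "source.point n \<omega> \<in> generation N n"
  using assms
proof (induction N arbitrary: n \<omega>)
  case 0
  then show ?case using source.summable_digits(2)[OF 0] by simp
next
  case (Suc N)
  obtain c \<omega>' where c: "c \<in> C n" "\<omega>' \<in> space (digits (Suc n))" "source.point n \<omega> = c + \<tau> n *\<^sub>R source.point (Suc n) \<omega>'"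
    using source.point_unfold[OF Suc.prems] by metis
  then show ?case using Suc.IH[OF c(2)] by auto
qed

text \<open>One generation is given up so that open discs of the exact radius suffice.\<close>

lemma generation_cover:
  "\<exists>S. finite S \<and> card S \<le> (\<Prod>j<N. card (C (n + j))) \<and> generation (Suc N) n \<subseteq> (\<Union>p\<in>S. ball p (source.rad N n))"
proof (induction N arbitrary: n)
  case 0
  have "generation 1 n \<subseteq> ball 0 1"
  proof
    fix z assume "z \<in> generation 1 n"
    then obtain c w where cw: "c \<in> C n" "norm w \<le> 1" "z = c + \<tau> n *\<^sub>R w" by auto
    have "norm z \<le> norm c + \<tau> n * norm w"
      using norm_triangle_ineq[of c "\<tau> n *\<^sub>R w"] \<tau>_pos[of n] cw(3) by simp
    also have "\<dots> \<le> norm c + \<tau> n" using cw(2) \<tau>_pos[of n] by (simp add: mult_left_le)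
    also have "\<dots> < 1" using C_inside[OF cw(1)] \<tau>_less_R[of n] by linarith
    finally show "z \<in> ball 0 1" by simp
  qed
  then show ?case by (intro exI[of _ "{0}"]) simp
next
  case (Suc N)
  obtain S where S: "finite S" "card S \<le> (\<Prod>j<N. card (C (Suc n + j)))"
    "generation (Suc N) (Suc n) \<subseteq> (\<Union>p\<in>S. ball p (source.rad N (Suc n)))"
    using Suc[of "Suc n"] by blast
  define S' where "S' = (\<Union>c\<in>C n. (\<lambda>p. c + \<tau> n *\<^sub>R p) ` S)"
  have "card S' \<le> (\<Sum>c\<in>C n. card ((\<lambda>p. c + \<tau> n *\<^sub>R p) ` S))"
    unfolding S'_def using finite_C by (rule card_UN_le)
  also have "\<dots> \<le> (\<Sum>c\<in>C n. card S)" by (intro sum_mono card_image_le S)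
  also have "\<dots> \<le> card (C n) * (\<Prod>j<N. card (C (Suc n + j)))" using S(2) by simp
  also have "\<dots> = (\<Prod>j<Suc N. card (C (n + j)))" unfolding prod.lessThan_Suc_shift by simp
  finally have "card S' \<le> (\<Prod>j<Suc N. card (C (n + j)))" .
  moreover have "finite S'" unfolding S'_def using finite_C S by auto
  moreover have "generation (Suc (Suc N)) n \<subseteq> (\<Union>p\<in>S'. ball p (source.rad (Suc N) n))"
  proof
    fix z assume "z \<in> generation (Suc (Suc N)) n"
    then have "\<exists>c\<in>C n. \<exists>w\<in>generation (Suc N) (Suc n). z = c + \<tau> n *\<^sub>R w"
      by (subst (asm) generation.simps(2)) blast
    then obtain c w where cw: "c \<in> C n" "w \<in> generation (Suc N) (Suc n)" "z = c + \<tau> n *\<^sub>R w"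
      by blast
    have "w \<in> (\<Union>p\<in>S. ball p (source.rad N (Suc n)))" using cw(2) S(3) by (rule subsetD[rotated])
    then obtain p where p: "p \<in> S" "dist p w < source.rad N (Suc n)" by auto
    have "dist (c + \<tau> n *\<^sub>R p) z = \<tau> n * dist p w"
      using \<tau>_pos[of n] by (simp add: cw(3) dist_norm flip: scaleR_diff_right)
    also have "\<dots> < source.rad (Suc N) n"
      using p(2) \<tau>_pos[of n] by (simp add: source.rad_Suc)
    finally show "z \<in> (\<Union>p\<in>S'. ball p (source.rad (Suc N) n))"
      using cw(1) p(1) by (auto simp: S'_def)
  qed
  ultimately show ?case by blast
qed

lemma hausdorff_content_cover_le:
  assumes S: "finite S" "E \<subseteq> (\<Union>p\<in>S. ball p r)" and r: "0 < r" "r < \<delta>" and h: "0 \<le> h r"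
  shows "hausdorff_content h \<delta> E \<le> ennreal (real (card S) * h r)"
proof -
  obtain f where f: "bij_betw f {0..<card S} S"
    using ex_bij_betw_nat_finite[OF S(1)] by blast
  have "(\<Sum>i. if i \<in> {0..<card S} then ennreal (h r) else 0) = (\<Sum>i\<in>{0..<card S}. ennreal (h r))"
    by (subst suminf_finite[of "{0..<card S}"]) auto
  also have "\<dots> = ennreal (real (card S) * h r)"
    using h by (simp add: ennreal_mult ennreal_of_nat_eq_real_of_nat)
  finally have eq: "(\<Sum>i. if i \<in> {0..<card S} then ennreal (h r) else 0) = ennreal (real (card S) * h r)" .
  have "E \<subseteq> (\<Union>i\<in>{0..<card S}. ball (f i) r)"
  proof
    fix x assume "x \<in> E"
    then obtain p where p: "p \<in> S" "x \<in> ball p r" using S(2) by auto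
    then obtain i where "i \<in> {0..<card S}" "p = f i"
      using bij_betw_imp_surj_on[OF f] by (metis imageE)
    with p show "x \<in> (\<Union>i\<in>{0..<card S}. ball (f i) r)" by blast
  qed
  then show ?thesis
    unfolding hausdorff_content_def eq[symmetric] using r
    by (intro Inf_lower CollectI exI[of _ "{0..<card S}"] exI[of _ f] exI[of _ "\<lambda>_. r"]) auto
qed

text \<open>The set lies in generation \<open>Suc N\<close>, so one cover by balls of radius
  \<open>source.rad N 0\<close> bounds the content for every \<delta> above that radius. Hence a
  single good \<open>N\<close> for each pair of tolerances makes all contents 0.\<close>

lemma hausdorff_measure_cantor_set:
  assumes h: "\<And>r. 0 < r \<Longrightarrow> 0 < h r"
    and small: "\<And>\<delta> e. 0 < \<delta> \<Longrightarrow> 0 < e \<Longrightarrow> \<exists>N. source.rad N 0 < \<delta> \<and> real (\<Prod>j<N. card (C j)) * h (source.rad N 0) \<le> e"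
  shows "hausdorff_measure h cantor_set = 0"
proof -
  have "hausdorff_content h \<delta> cantor_set = 0" if \<delta>: "0 < \<delta>" for \<delta>
  proof -
    have "hausdorff_content h \<delta> cantor_set \<le> 0"
    proof (rule ennreal_le_epsilon)
      fix e :: real assume e: "0 < e"
      obtain N where N: "source.rad N 0 < \<delta>" "real (\<Prod>j<N. card (C j)) * h (source.rad N 0) \<le> e"
        using small[OF \<delta> e] by blast
      obtain S where S: "finite S" "card S \<le> (\<Prod>j<N. card (C j))" "generation (Suc N) 0 \<subseteq> (\<Union>p\<in>S. ball p (source.rad N 0))"
        using generation_cover[where N = N and n = 0] by (auto simp del: generation.simps)
      have hp: "0 < h (source.rad N 0)" by (rule h[OF source.rad_pos])
      have "hausdorff_content h \<delta> cantor_set \<le> ennreal (real (card S) * h (source.rad N 0))"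
        using S N hp source.rad_pos
        by (intro hausdorff_content_cover_le) (auto simp: cantor_set_def simp del: generation.simps)
      also have "\<dots> \<le> ennreal (real (\<Prod>j<N. card (C j)) * h (source.rad N 0))"
        using S(2) hp by (intro ennreal_leI mult_right_mono) (simp_all del: of_nat_prod)
      also have "\<dots> \<le> ennreal e" by (intro ennreal_leI N)
      finally show "hausdorff_content h \<delta> cantor_set \<le> 0 + ennreal e" by simp
    qed
    then show ?thesis by simp
  qed
  then have "((\<lambda>\<delta>. hausdorff_content h \<delta> cantor_set) \<longlongrightarrow> 0) (at_right 0)"
    by (intro tendsto_eventually eventually_at_right_less[THEN eventually_mono]) auto
  then show ?thesis
    unfolding hausdorff_measure_def by (intro tendsto_Lim) auto
qed

lemma compact_cantor_set: "compact cantor_set"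
  unfolding cantor_set_def by (intro compact_Inter) (auto intro: compact_generation)

text \<open>The image contains all points coded at scale \<open>\<sigma>\<close>, since the map
  preserves codes, and these carry the measure whose Cauchy transform is the competitor.\<close>

lemma analytic_capacity_image_pos:
  assumes "\<And>n. 4 \<le> real (card (C n)) * \<sigma> n"
  shows "analytic_capacity (qc_map 0 ` cantor_set) > 0"
proof (rule target.analytic_capacity_pos[OF assms])
  have "continuous_on UNIV (qc_map 0)" using disc_map_qc_map[of 0] by (simp add: disc_map_def)
  then show "closed (qc_map 0 ` cantor_set)"
    by (intro compact_imp_closed compact_continuous_image compact_cantor_set) (auto intro: continuous_on_subset)
  show "target.point 0 \<omega> \<in> qc_map 0 ` cantor_set" if "\<omega> \<in> space (digits 0)" for \<omega>
    using qc_map_source_point[OF that] source_point_in_generation[OF that]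
    by (metis INT_I cantor_set_def imageI)
qed

end

section \<open>The square grid and its parameters\<close>

definition grid :: "nat \<Rightarrow> complex set" where
  "grid m = (\<lambda>(j, k). Complex ((2 * real j + 1) / (2 * real m) - 1/2) ((2 * real k + 1) / (2 * real m) - 1/2)) ` ({..<m} \<times> {..<m})"

lemma card_grid: "0 < m \<Longrightarrow> card (grid m) = m\<^sup>2"
  unfolding grid_def by (subst card_image) (auto simp: inj_on_def power2_eq_square)

text \<open>The centres lie in a square of side 1 about 0, whose half diagonal has square 1/2, below
  (3/4)^2 = 9/16.\<close>

lemma norm_grid_le:
  assumes "c \<in> grid m" "0 < m"
  shows "norm c \<le> 3/4"
proof -
  have bd: "\<bar>(2 * real j + 1) / (2 * real m) - 1/2\<bar> \<le> 1/2" if "j < m" for j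
  proof -
    have "2 * real j + 1 \<le> 2 * real m" using that by linarith
    then have "(2 * real j + 1) / (2 * real m) \<le> 1" "0 \<le> (2 * real j + 1) / (2 * real m)" using assms(2) by auto
    then show ?thesis by linarith
  qed
  have "\<bar>Re c\<bar> \<le> 1/2" "\<bar>Im c\<bar> \<le> 1/2" using assms(1) bd by (auto simp: grid_def)
  then have "(Re c)\<^sup>2 \<le> (1/2)\<^sup>2" "(Im c)\<^sup>2 \<le> (1/2)\<^sup>2" by (auto simp only: abs_le_square_iff[symmetric] abs_of_pos)
  then have "(norm c)\<^sup>2 \<le> (3/4)\<^sup>2" unfolding cmod_power2 by (simp add: power2_eq_square)
  then show ?thesis by (rule power2_le_imp_le) simp
qed

lemma grid_separated:
  assumes "c \<in> grid m" "c' \<in> grid m" "c \<noteq> c'"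
  shows "1 / real m \<le> norm (c - c')"
proof -
  have diff: "1 / real m \<le> \<bar>((2 * real j + 1) / (2 * real m) - 1/2) - ((2 * real j' + 1) / (2 * real m) - 1/2)\<bar>" if "j \<noteq> j'" for j j'
  proof -
    have "1 \<le> \<bar>real j - real j'\<bar>" using that by linarith
    then have "1 / real m \<le> \<bar>real j - real j'\<bar> / real m" by (intro divide_right_mono) auto
    also have "\<dots> = \<bar>((2 * real j + 1) / (2 * real m) - 1/2) - ((2 * real j' + 1) / (2 * real m) - 1/2)\<bar>"
    proof -
      have "((2 * real j + 1) / (2 * real m) - 1/2) - ((2 * real j' + 1) / (2 * real m) - 1/2) = (real j - real j') / real m"
        by (simp add: add_divide_distrib diff_divide_distrib)
      then show ?thesis by (simp only: abs_divide abs_of_nat)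
    qed
    finally show ?thesis .
  qed
  obtain j k j' k' where c: "c = Complex ((2 * real j + 1) / (2 * real m) - 1/2) ((2 * real k + 1) / (2 * real m) - 1/2)"
    "c' = Complex ((2 * real j' + 1) / (2 * real m) - 1/2) ((2 * real k' + 1) / (2 * real m) - 1/2)"
    using assms by (auto simp: grid_def)
  then consider "j \<noteq> j'" | "k \<noteq> k'" using assms(3) by auto
  then show ?thesis
  proof cases
    case 1
    then show ?thesis using diff[OF 1] abs_Re_le_cmod[of "c - c'"] by (simp add: c)
  next
    case 2
    then show ?thesis using diff[OF 2] abs_Im_le_cmod[of "c - c'"] by (simp add: c)
  qed
qed

text \<open>16 is the least value for which 2 \<sigma> \<le> R, that is 8/m^2 \<le> 1/(2m), and it
  keeps 3/4 + R below 1. The hypothesis \<open>small\<close> is the bound on card times \<tau>; it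
  holds for large m because K > 1. The number 8 is R-relative: \<sigma>/R = 8/m, whose K-th power is
  \<tau>/R.\<close>

lemma dense_cantor_system_grid:
  assumes K: "K > 1" and m: "\<And>n. 16 \<le> m n" and small: "\<And>n. real (m n) * (8 / real (m n)) powr K \<le> 1"
  shows "dense_cantor_system K (\<lambda>n. grid (m n)) (\<lambda>n. 1 / (2 * real (m n))) (\<lambda>n. 4 / (real (m n))\<^sup>2)
    (\<lambda>n. (8 / real (m n)) powr K / (2 * real (m n)))"
proof
  fix n
  have m0: "16 \<le> real (m n)" using m[of n] by linarith
  have R: "1 / (2 * real (m n)) \<le> 1/32" using m0 by (simp add: divide_simps)
  show "K > 1" by fact
  show "finite (grid (m n))" by (simp add: grid_def)
  show "grid (m n) \<noteq> {}" using m[of n] card_grid[of "m n"] by fastforce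
  show "0 < 1 / (2 * real (m n))" "1 / (2 * real (m n)) \<le> 1/2" using m0 R by auto
  show "0 < (8 / real (m n)) powr K / (2 * real (m n))" using m0 by simp
  have "(8 / real (m n)) powr K / (2 * real (m n)) / (1 / (2 * real (m n))) = (8 / real (m n)) powr K"
    using m0 by simp
  then show "4 / (real (m n))\<^sup>2 = 1 / (2 * real (m n)) * ((8 / real (m n)) powr K / (2 * real (m n)) / (1 / (2 * real (m n)))) powr (1 / K)"
    using K m0 by (simp only: powr_powr) (simp add: power2_eq_square)
  show "2 * (4 / (real (m n))\<^sup>2) \<le> 1 / (2 * real (m n))" using m0 by (simp add: power2_eq_square divide_simps)
  show "norm c + 1 / (2 * real (m n)) < 1" if "c \<in> grid (m n)" for c
  proof -
    have "norm c \<le> 3/4" using norm_grid_le[OF that] m[of n] by simp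
    then show ?thesis using R by linarith
  qed
  show "norm c \<le> 3/4" if "c \<in> grid (m n)" for c
    using norm_grid_le[OF that] m[of n] by simp
  show "2 * (1 / (2 * real (m n))) \<le> norm (c - c')" if "c \<in> grid (m n)" "c' \<in> grid (m n)" "c \<noteq> c'" for c c'
    using grid_separated[OF that] by simp
  have card: "real (card (grid (m n))) = (real (m n))\<^sup>2" using m[of n] by (simp add: card_grid)
  show "real (card (grid (m n))) * (1 / (2 * real (m n)))\<^sup>2 = 1/4"
    unfolding card using m0 by (simp add: power2_eq_square)
  have "real (card (grid (m n))) * ((8 / real (m n)) powr K / (2 * real (m n))) = (real (m n) * (8 / real (m n)) powr K) / 2"
    unfolding card using m0 by (simp add: power2_eq_square)
  then show "real (card (grid (m n))) * ((8 / real (m n)) powr K / (2 * real (m n))) \<le> 1/2"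
    using small[of n] by simp
qed

text \<open>\<tau> is a constant times m^-(K+1), so its power 2/(K+1) is a constant times m^-2 and
  cancels the number of discs.\<close>

lemma grid_hausdorff_ratio:
  fixes m :: real
  assumes "K > 1" "0 < m"
  shows "m\<^sup>2 * ((8 / m) powr K / (2 * m)) powr (2 / (K + 1)) = (8 powr K / 2) powr (2 / (K + 1))"
proof -
  have "(8 / m) powr K / (2 * m) = (8 powr K / 2) * m powr - (K + 1)"
  proof -
    have "m powr - (K + 1) = 1 / (m powr K * m)"
      using assms by (simp only: powr_minus_divide powr_add) simp
    then show ?thesis by (simp only: powr_divide) simp
  qed
  then have "((8 / m) powr K / (2 * m)) powr (2 / (K + 1)) = (8 powr K / 2) powr (2 / (K + 1)) * (m powr - (K + 1)) powr (2 / (K + 1))"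
    by (simp only: powr_mult)
  also have "(m powr - (K + 1)) powr (2 / (K + 1)) = m powr - 2"
  proof -
    have "- (K + 1) * (2 / (K + 1)) = - 2" using assms by (simp add: field_simps)
    then show ?thesis by (simp only: powr_powr)
  qed
  also have "\<dots> = 1 / m\<^sup>2" using assms by (simp add: powr_minus_divide)
  finally show ?thesis using assms by simp
qed

text \<open>With q = (2K+1)/K and aq = (2K+2)/K the exponents are 1 - q = -(K+1)/K and 2 - aq =
  -2/K. All powers of m cancel and 2^(2/K)/64 remains, at most 4/64; the 64 is the square of the 8
  in \<tau>.\<close>

lemma grid_riesz_ratio:
  fixes m :: real
  assumes "K > 1" "0 < m"
  shows "(m\<^sup>2) powr (- (K + 1) / K) * ((8 / m) powr K / (2 * m)) powr (- 2 / K) \<le> 1/16"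
proof -
  have "(m\<^sup>2) powr (- (K + 1) / K) = m powr (- 2 - 2 / K)"
  proof -
    have "m\<^sup>2 = m powr 2" using assms by simp
    then have "(m\<^sup>2) powr (- (K + 1) / K) = m powr (2 * (- (K + 1) / K))"
      by (simp only: powr_powr)
    also have "2 * (- (K + 1) / K) = - 2 - 2 / K" using assms by (simp add: field_simps)
    finally show ?thesis .
  qed
  moreover have "((8 / m) powr K / (2 * m)) powr (- 2 / K) = (m powr 2 / 64) * (2 powr (2 / K) * m powr (2 / K))"
  proof -
    have "((8 / m) powr K / (2 * m)) powr (- 2 / K) = ((8 / m) powr K) powr (- 2 / K) / (2 * m) powr (- 2 / K)"
      by (rule powr_divide)
    also have "((8 / m) powr K) powr (- 2 / K) = (8 / m) powr - 2"
      using assms by (simp add: powr_powr)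
    also have "\<dots> = m powr 2 / 64"
      using assms by (simp add: powr_minus_divide power_divide)
    also have "(2 * m) powr (- 2 / K) = inverse (2 powr (2 / K) * m powr (2 / K))"
      by (simp add: powr_minus powr_mult)
    finally show ?thesis by (simp only: divide_inverse[of _ "inverse _"] inverse_inverse_eq)
  qed
  ultimately have "(m\<^sup>2) powr (- (K + 1) / K) * ((8 / m) powr K / (2 * m)) powr (- 2 / K)
      = m powr (- 2 - 2 / K) * ((m powr 2 / 64) * (2 powr (2 / K) * m powr (2 / K)))"
    by (simp only:)
  also have "\<dots> = 2 powr (2 / K) / 64 * (m powr (- 2 - 2 / K) * m powr 2 * m powr (2 / K))"
    by simp
  also have "m powr (- 2 - 2 / K) * m powr 2 * m powr (2 / K) = 1"
    unfolding powr_add[symmetric] using assms by simp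
  also have "2 powr (2 / K) / 64 * 1 \<le> 1 / (16 :: real)"
  proof -
    have "2 powr (2 / K) \<le> 2 powr (2::real)"
      using assms by (intro powr_mono) (auto simp: divide_le_eq)
    then show ?thesis by simp
  qed
  finally show ?thesis .
qed

theorem theorem8p5:
  fixes K :: real and h :: "real \<Rightarrow> real"
  assumes "K > 1"
    and "\<And>r. r > 0 \<Longrightarrow> h r > 0"
    and "((\<lambda>r. h r / r powr (2 / (K + 1))) \<longlongrightarrow> 0) (at_right 0)"
  shows "\<exists>E :: complex set. compact E \<and> hausdorff_measure h E = 0 \<and>
           (\<exists>\<phi>. quasiconformal K \<phi> \<and> analytic_capacity (\<phi> ` E) > 0) \<and>
           riesz_capacity (2 * K / (2 * K + 1)) ((2 * K + 1) / (K + 1)) E > 0"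
proof -
  define t where "t = 2 / (K + 1)"
  define B where "B = (8 powr K / 2) powr t"
  have B: "1 < B"
  proof -
    have "8 powr 1 \<le> 8 powr K" using assms(1) by (intro powr_mono) auto
    then have "1 < 8 powr K / 2" by simp
    then show ?thesis unfolding B_def using assms(1) by (intro gr_one_powr) (auto simp: t_def)
  qed
  \<comment> \<open>The Hausdorff sum of generation n is \<open>B ^ n\<close> times h(r) / r^t, so
    thresholds are fixed below which this ratio beats B^(-2n). The numbers \<open>m n\<close> depend
    on \<open>h\<close> only through them.\<close>
  have "\<exists>d>0. \<forall>r. 0 < r \<and> r < d \<longrightarrow> h r / r powr t < (1 / B\<^sup>2) ^ n" for n
  proof -
    have "\<forall>\<^sub>F r in at_right 0. h r / r powr t < (1 / B\<^sup>2) ^ n"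
      using order_tendstoD(2)[OF assms(3)] B by (simp add: t_def)
    then show ?thesis unfolding eventually_at_right_field by (metis)
  qed
  then obtain d where d: "\<And>n. 0 < d n" "\<And>n r. 0 < r \<Longrightarrow> r < d n \<Longrightarrow> h r / r powr t < (1 / B\<^sup>2) ^ n"
    by metis
  \<comment> \<open>The index is shifted because stage \<open>n\<close> supplies the last factor of
    the radius of generation \<open>Suc n\<close>, and the factors before it are at most 1.\<close>
  have "\<exists>m\<ge>16. real m * (8 / real m) powr K \<le> 1 \<and> (8 / real m) powr K / (2 * real m) < d (Suc n)" for n
  proof -
    have "(\<lambda>m::nat. real m * (8 / real m) powr K) \<longlonglongrightarrow> 0"
      using assms(1) by real_asymp
    then have "\<forall>\<^sub>F m in sequentially. real m * (8 / real m) powr K < 1"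
      by (rule order_tendstoD(2)) simp
    moreover have "(\<lambda>m::nat. (8 / real m) powr K / (2 * real m)) \<longlonglongrightarrow> 0"
      using assms(1) by real_asymp
    then have "\<forall>\<^sub>F m in sequentially. (8 / real m) powr K / (2 * real m) < d (Suc n)"
      by (rule order_tendstoD(2)) (rule d)
    ultimately have "\<forall>\<^sub>F m in sequentially. 16 \<le> m \<and> real m * (8 / real m) powr K \<le> 1 \<and> (8 / real m) powr K / (2 * real m) < d (Suc n)"
      using eventually_ge_at_top[of 16] by eventually_elim auto
    then show ?thesis by (auto dest: eventually_happens)
  qed
  then obtain m where m: "\<And>n. 16 \<le> m n" "\<And>n. real (m n) * (8 / real (m n)) powr K \<le> 1"
    "\<And>n. (8 / real (m n)) powr K / (2 * real (m n)) < d (Suc n)"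
    by metis
  interpret dense_cantor_system K "\<lambda>n. grid (m n)" "\<lambda>n. 1 / (2 * real (m n))" "\<lambda>n. 4 / (real (m n))\<^sup>2"
    "\<lambda>n. (8 / real (m n)) powr K / (2 * real (m n))"
    by (rule dense_cantor_system_grid[OF assms(1) m(1,2)])
  have m0: "0 < real (m n)" "0 < m n" for n using m(1)[of n] by auto
  have card: "real (card (grid (m n))) = (real (m n))\<^sup>2" for n using m0(2)[of n] by (simp add: card_grid)
  \<comment> \<open>Each stage contributes exactly the factor \<open>B\<close>, whatever
    \<open>m\<close> is.\<close>
  have mass: "real (\<Prod>j<N. card (grid (m j))) * source.rad N 0 powr t = B ^ N" for N
  proof (induction N)
    case (Suc N)
    define \<rho> where "\<rho> = (8 / real (m N)) powr K / (2 * real (m N))"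
    have "source.rad (Suc N) 0 = source.rad N 0 * \<rho>" by (simp add: source.rad_def \<rho>_def)
    then have rad: "source.rad (Suc N) 0 powr t = source.rad N 0 powr t * \<rho> powr t"
      by (simp add: powr_mult)
    have M: "(real (m N))\<^sup>2 * \<rho> powr t = B"
      unfolding \<rho>_def B_def t_def by (rule grid_hausdorff_ratio[OF assms(1) m0(1)])
    have "real (\<Prod>j<Suc N. card (grid (m j))) * source.rad (Suc N) 0 powr t
        = (real (\<Prod>j<N. card (grid (m j))) * source.rad N 0 powr t) * B"
    proof -
      have "real (\<Prod>j<Suc N. card (grid (m j))) = real (\<Prod>j<N. card (grid (m j))) * (real (m N))\<^sup>2"
        by (simp only: prod.lessThan_Suc of_nat_mult card)
      then show ?thesis
        unfolding rad M[symmetric] by (simp only: mult_ac)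
    qed
    then show ?case by (simp only: Suc power_Suc2)
  qed simp
  have "hausdorff_measure h cantor_set = 0"
  proof (rule hausdorff_measure_cantor_set[OF assms(2)])
    fix \<delta> e :: real assume "0 < \<delta>" "0 < e"
    have "\<forall>\<^sub>F N in sequentially. source.rad N 0 < \<delta>"
      using order_tendstoD(2)[OF source.rad_tendsto_0 \<open>0 < \<delta>\<close>] .
    moreover have "(\<lambda>N. (1 / B) ^ N) \<longlonglongrightarrow> 0"
      using B by (intro LIMSEQ_realpow_zero) auto
    then have "\<forall>\<^sub>F N in sequentially. (1 / B) ^ N < e"
      by (rule order_tendstoD(2)) fact
    ultimately have "\<forall>\<^sub>F N in sequentially. source.rad N 0 < \<delta> \<and> (1 / B) ^ N < e \<and> 1 \<le> N"
      using eventually_ge_at_top[of 1] by eventually_elim auto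
    then obtain N where N: "source.rad N 0 < \<delta>" "(1 / B) ^ N < e" "1 \<le> N"
      by (auto dest: eventually_happens)
    define r where "r = source.rad N 0"
    have r: "0 < r" unfolding r_def by (rule source.rad_pos)
    \<comment> \<open>Stage \<open>k\<close> is the last one in the radius of generation
      \<open>N\<close>; the threshold for \<open>N\<close> was imposed on it.\<close>
    obtain k where k: "N = Suc k" using N(3) by (cases N) auto
    have "r < d N"
    proof -
      have "r = source.rad k 0 * ((8 / real (m k)) powr K / (2 * real (m k)))"
        unfolding r_def k by (simp add: source.rad_def)
      also have "\<dots> \<le> 1 * ((8 / real (m k)) powr K / (2 * real (m k)))"
        using source.rad_le[of k 0] power_le_one[of "1/4 :: real" k] by (intro mult_right_mono) auto
      also have "\<dots> < d N" using m(3)[of k] by (simp add: k)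
      finally show ?thesis .
    qed
    then have "h r / r powr t < (1 / B\<^sup>2) ^ N" using r d(2) by blast
    then have "h r \<le> (1 / B\<^sup>2) ^ N * r powr t" using r by (simp add: divide_less_eq)
    then have "real (\<Prod>j<N. card (grid (m j))) * h r \<le> real (\<Prod>j<N. card (grid (m j))) * ((1 / B\<^sup>2) ^ N * r powr t)"
      by (intro mult_left_mono of_nat_0_le_iff)
    \<comment> \<open>The growth of the covering numbers uses up one of the two powers of
      \<open>B\<close> gained from the choice of \<open>m\<close>.\<close>
    also have "\<dots> = (1 / B\<^sup>2) ^ N * B ^ N"
      unfolding mass[of N, symmetric] r_def by (simp add: mult_ac)
    also have "\<dots> = (1 / B\<^sup>2 * B) ^ N" by (rule power_mult_distrib[symmetric])
    also have "1 / B\<^sup>2 * B = 1 / B" using B by (simp add: power2_eq_square)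
    finally show "\<exists>N. source.rad N 0 < \<delta> \<and> real (\<Prod>j<N. card (grid (m j))) * h (source.rad N 0) \<le> e"
      using N by (intro exI[of _ N]) (auto simp: r_def)
  qed
  moreover have "compact cantor_set" by (rule compact_cantor_set)
  moreover have "quasiconformal K (qc_map 0)" by (rule quasiconformal_qc_map)
  moreover have "analytic_capacity (qc_map 0 ` cantor_set) > 0"
  proof (rule analytic_capacity_image_pos)
    show "4 \<le> real (card (grid (m n))) * (4 / (real (m n))\<^sup>2)" for n
      unfolding card using m0[of n] by simp
  qed
  moreover have "riesz_capacity (2 * K / (2 * K + 1)) ((2 * K + 1) / (K + 1)) cantor_set > 0"
  proof (rule source.riesz_capacity_pos)
    \<comment> \<open>The conjugate exponent is q = (2K+1)/K = 2 + 1/K; below, \<open>a\<close>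
      computes the kernel exponent and \<open>aq\<close> its product with q.\<close>
    have q: "(2 * K + 1) / (K + 1) / ((2 * K + 1) / (K + 1) - 1) = (2 * K + 1) / K"
    proof -
      have "(2 * K + 1) / (K + 1) - 1 = K / (K + 1)" using assms(1) by (simp add: field_simps)
      then show ?thesis using assms(1) by simp
    qed
    have a: "2 - 2 * K / (2 * K + 1) = (2 * K + 2) / (2 * K + 1)"
      using assms(1) by (simp add: field_simps)
    have aq: "(2 * K + 2) / (2 * K + 1) * ((2 * K + 1) / K) = (2 * K + 2) / K"
    proof -
      have "2 * K + 1 \<noteq> 0" using assms(1) by simp
      then show ?thesis by simp
    qed
    show "0 < 2 * K / (2 * K + 1)" "2 * K / (2 * K + 1) < 2" "1 < (2 * K + 1) / (K + 1)"
      using assms(1) by (simp_all add: divide_simps)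
    show "(2 * K + 1) / (K + 1) / ((2 * K + 1) / (K + 1) - 1) \<le> 3"
      unfolding q using assms(1) by (simp add: divide_simps)
    show "2 < (2 - 2 * K / (2 * K + 1)) * ((2 * K + 1) / (K + 1) / ((2 * K + 1) / (K + 1) - 1))"
      unfolding q a aq using assms(1) by (simp add: divide_simps)
    show "real (card (grid (m n))) powr (1 - (2 * K + 1) / (K + 1) / ((2 * K + 1) / (K + 1) - 1)) *
       ((8 / real (m n)) powr K / (2 * real (m n))) powr (2 - (2 - 2 * K / (2 * K + 1)) * ((2 * K + 1) / (K + 1) / ((2 * K + 1) / (K + 1) - 1))) \<le> 1/16" for n
    proof -
      have e: "1 - (2 * K + 1) / K = - (K + 1) / K" "2 - (2 * K + 2) / K = - 2 / K"
        using assms(1) by (simp_all add: field_simps)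
      show ?thesis unfolding q a aq e card by (rule grid_riesz_ratio[OF assms(1) m0(1)])
    qed
    show "closed cantor_set" by (intro compact_imp_closed compact_cantor_set)
    show "source.point 0 \<omega> \<in> cantor_set" if "\<omega> \<in> space (digits 0)" for \<omega>
      using source_point_in_generation[OF that] by (auto simp: cantor_set_def)
  qed
  ultimately show ?thesis by blast
qed

end
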